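(* If $\omega(M,\mathbf t)$ is non-zero on $P(\Gamma_{\mathbb L})$ (equivalently, the set $\{\phi_i\}_{i=3,\dots,5d+1}$ is linearly independent in the $\mathcal O(P(\Gamma_{\mathbb L}))$-module $H^0(\Omega_M\otimes\mathcal O_{P(\Gamma_{\mathbb L})})$), then the Zariski tangent space of $P(\Gamma_{\mathbb L})$ at a generic maximal (closed) point has dimension $$\dim(M)-\deg(\omega(M,\mathbf t)).$$
   Context: Everything is over $\mathbb C$; "generic" means outside a countable union of proper Zariski closed subsets. Fix $d\ge1$. $S=\mathbf P(H^0(\mathcal O_{\mathbf P^4}(5)))$ is the space of quintics, and $[f]\in S$ is the class of $f\in H^0(\mathcal O_{\mathbf P^4}(5))\setminus\{0\}$. $M=H^0(\mathcal O_{\mathbf P^1}(d))^{\oplus5}\simeq\mathbb C^{5d+5}$; a point $c=(c^0,\dots,c^4)\in M$ is viewed as a 5-tuple of polynomials of degree $\le d$ in the affine coordinate $t\in\mathbb C\subset\mathbf P^1$, and $c(t)=(c^0(t),\dots,c^4(t))$. $M_d\subset M$ is the subset of those $c$ defining maps $\mathbf P^1\to\mathbf P^4$ that are birational onto their image and whose image has degree $d$. For a quintic $f$, $c^\ast(f)$ is the pull-back section $f(c(t))$ of $\mathcal O_{\mathbf P^1}(5d)$. $f_0,f_1,f_2$ are generic quintics and $\mathbb L\subset S$ is an open set of the plane spanned by $[f_0],[f_1],[f_2]$, centered around $[f_0]$. $\Gamma_{\mathbb L}$ is an irreducible component of the incidence scheme $\{(c,[f])\in M_d\times\mathbb L: c^\ast(f)=0\}$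 that is onto $\mathbb L$ and contains a point $(c_0,[f_0])$ (it is assumed throughout that such a component exists). $P$ is the projection to $M$ and $P(\Gamma_{\mathbb L})\subset M$ is the scheme-theoretic image. $t_1,\dots,t_{5d+1}$ are generic distinct complex numbers, viewed as points of $\mathbb C\subset\mathbf P^1$, and $\mathbf t=(t_1,\dots,t_{5d+1})$. For $i=3,\dots,5d+1$ define the 1-forms on $M$ (in the variable $c\in M$) $$\phi_i=d\left|\begin{array}{ccc} f_2(c(t_i))&f_1(c(t_i))&f_0(c(t_i))\\ f_2(c(t_1))&f_1(c(t_1))&f_0(c(t_1))\\ f_2(c(t_2))&f_1(c(t_2))&f_0(c(t_2))\end{array}\right|,$$ where $|\cdot|$ is the determinant, and $\omega(M,\mathbf t)=\wedge_{i=3}^{5d+1}\phi_i\in H^0(\Omega_M^{5d-1})$, a form of degree $\deg(\omega(M,\mathbf t))=5d-1$. *)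

theory Defs
  imports
    "HOL-Analysis.Analysis"
    "HOL-Library.Function_Algebras"
    "HOL-Computational_Algebra.Polynomial"
begin

section \<open>Zariski topology\<close>

text \<open>
  The parameter \<open>C\<close> is always a set of linear coordinate functions on a complex vector space
  \<open>'x\<close>, and \<open>X\<close> a subset of \<open>'x\<close> whose points are separated by \<open>C\<close>. Over the infinite field of
  complex numbers a polynomial is the same as the function it defines.
\<close>

inductive_set polynomial_functions :: "('x \<Rightarrow> complex) set \<Rightarrow> ('x \<Rightarrow> complex) set"
  for C :: "('x \<Rightarrow> complex) set" where
  const: "(\<lambda>_. a) \<in> polynomial_functions C"
| coord: "u \<in> C \<Longrightarrow> u \<in> polynomial_functions C"
| add: "p \<in> polynomial_functions C \<Longrightarrow> q \<in> polynomial_functions C \<Longrightarrow>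
    (\<lambda>x. p x + q x) \<in> polynomial_functions C"
| mult: "p \<in> polynomial_functions C \<Longrightarrow> q \<in> polynomial_functions C \<Longrightarrow>
    (\<lambda>x. p x * q x) \<in> polynomial_functions C"

text \<open>
  For a linear subspace \<open>X\<close>, this is the coordinate ring of the affine space \<open>X\<close>. Only the values
  on \<open>X\<close> matter: ideals below are closed under changing a function outside \<open>X\<close>.
\<close>

definition regular :: "('x \<Rightarrow> complex) set \<Rightarrow> 'x set \<Rightarrow> ('x \<Rightarrow> complex) set" where
  "regular C X = {g. \<exists>p\<in>polynomial_functions C. \<forall>x\<in>X. g x = p x}"

definition zariski_closed :: "('x \<Rightarrow> complex) set \<Rightarrow> 'x set \<Rightarrow> 'x set \<Rightarrow> bool" where
  "zariski_closed C X Z \<longleftrightarrow>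
     (\<exists>G \<subseteq> polynomial_functions C. Z = {x \<in> X. \<forall>g\<in>G. g x = 0})"

definition zariski_irreducible :: "('x \<Rightarrow> complex) set \<Rightarrow> 'x set \<Rightarrow> bool" where
  "zariski_irreducible C X \<longleftrightarrow> X \<noteq> {} \<and>
     (\<forall>Y Z. zariski_closed C X Y \<longrightarrow> zariski_closed C X Z \<longrightarrow> X = Y \<union> Z \<longrightarrow> X = Y \<or> X = Z)"

definition irreducible_component :: "('x \<Rightarrow> complex) set \<Rightarrow> 'x set \<Rightarrow> 'x set \<Rightarrow> bool" where
  "irreducible_component C X Y \<longleftrightarrow>
     zariski_closed C X Y \<and> zariski_irreducible C Y \<and>
     (\<forall>Z. zariski_closed C X Z \<longrightarrow> zariski_irreducible C Z \<longrightarrow> Y \<subseteq> Z \<longrightarrow> Z = Y)"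

text \<open>Generic is meant in the sense that is often called very general.\<close>

definition generically :: "('x \<Rightarrow> complex) set \<Rightarrow> 'x set \<Rightarrow> ('x \<Rightarrow> bool) \<Rightarrow> bool" where
  "generically C X P \<longleftrightarrow>
     (\<exists>\<Z>. countable \<Z> \<and> (\<forall>Z\<in>\<Z>. zariski_closed C X Z \<and> Z \<noteq> X) \<and> (\<forall>x \<in> X - \<Union>\<Z>. P x))"

definition ideal_generated :: "('x \<Rightarrow> complex) set \<Rightarrow> 'x set \<Rightarrow> ('x \<Rightarrow> complex) set \<Rightarrow> ('x \<Rightarrow> complex) set"
  where
  "ideal_generated C X G =
     {p. \<exists>(n::nat) q g. (\<forall>j<n. q j \<in> regular C X \<and> g j \<in> G) \<and>
           (\<forall>x\<in>X. p x = (\<Sum>j<n. q j x * g j x))}"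

text \<open>
  Let \<open>I\<close> be an ideal of the coordinate ring \<open>regular C X\<close> of an affine space \<open>X\<close>, and \<open>x\<close> a closed
  point of the closed subscheme defined by \<open>I\<close>. If \<open>m\<close> is the maximal ideal of \<open>x\<close> in
  \<open>regular C X\<close>, then the maximal ideal of \<open>x\<close> in the quotient by \<open>I\<close> is \<open>m / I\<close>, and the Zariski
  tangent space of the subscheme at \<open>x\<close> is the dual of \<open>(m / I) / (m / I)^2 = m / (I + m^2)\<close>. Its
  elements are the linear forms on \<open>m\<close> that vanish on \<open>I\<close> and on \<open>m^2\<close> (extended by the value 0
  to functions outside \<open>m\<close>).
\<close>

definition maximal_ideal_at :: "('x \<Rightarrow> complex) set \<Rightarrow> 'x set \<Rightarrow> 'x \<Rightarrow> ('x \<Rightarrow> complex) set" where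
  "maximal_ideal_at C X x = {g \<in> regular C X. g x = 0}"

definition zariski_tangent_space ::
  "('x \<Rightarrow> complex) set \<Rightarrow> 'x set \<Rightarrow> ('x \<Rightarrow> complex) set \<Rightarrow> 'x \<Rightarrow> (('x \<Rightarrow> complex) \<Rightarrow> complex) set"
  where
  "zariski_tangent_space C X I x =
     (let m = maximal_ideal_at C X x in
      {\<theta>. (\<forall>g. g \<notin> m \<longrightarrow> \<theta> g = 0) \<and>
           (\<forall>g\<in>m. \<forall>h\<in>m. \<theta> (\<lambda>y. g y + h y) = \<theta> g + \<theta> h) \<and>
           (\<forall>a. \<forall>g\<in>m. \<theta> (\<lambda>y. a * g y) = a * \<theta> g) \<and>
           (\<forall>g \<in> m \<inter> I. \<theta> g = 0) \<and>
           (\<forall>g\<in>m. \<forall>h\<in>m. \<theta> (\<lambda>y. g y * h y) = 0)})"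

definition fscale :: "complex \<Rightarrow> ('i \<Rightarrow> complex) \<Rightarrow> ('i \<Rightarrow> complex)" where
  "fscale a f = (\<lambda>i. a * f i)"

section \<open>Forms on projective 4-space\<close>

text \<open>
  A form of degree \<open>m\<close> in the homogeneous coordinates \<open>x\<^sub>0, \<dots>, x\<^sub>4\<close> is given by its coefficients,
  indexed by the exponents \<open>e\<close> of total degree \<open>m\<close>.
\<close>

definition exponents :: "nat \<Rightarrow> (5 \<Rightarrow> nat) set" where
  "exponents m = {e. (\<Sum>i\<in>UNIV. e i) = m}"

type_synonym form = "(5 \<Rightarrow> nat) \<Rightarrow> complex"

definition forms :: "nat \<Rightarrow> form set" where
  "forms m = {F. \<forall>e. e \<notin> exponents m \<longrightarrow> F e = 0}"

definition form_eval :: "nat \<Rightarrow> form \<Rightarrow> complex ^ 5 \<Rightarrow> complex" where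
  "form_eval m F x = (\<Sum>e\<in>exponents m. F e * (\<Prod>i\<in>UNIV. (x $ i) ^ e i))"

abbreviation quintics :: "form set" where
  "quintics \<equiv> forms 5"

definition form_coords :: "(form \<Rightarrow> complex) set" where
  "form_coords = {\<lambda>f. f e | e. True}"

definition form_triple_coords :: "(form \<times> form \<times> form \<Rightarrow> complex) set" where
  "form_triple_coords =
     (\<Union>e. {\<lambda>(f0, f1, f2). f0 e, \<lambda>(f0, f1, f2). f1 e, \<lambda>(f0, f1, f2). f2 e})"

section \<open>The space \<open>M\<close> and its subset \<open>M\<^sub>d\<close>\<close>

type_synonym tuple = "complex poly ^ 5"

definition M :: "nat \<Rightarrow> tuple set" where
  "M d = {c. \<forall>i. degree (c $ i) \<le> d}"

definition tscale :: "complex \<Rightarrow> tuple \<Rightarrow> tuple" where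
  "tscale a c = (\<chi> i. smult a (c $ i))"

definition M_coords :: "(tuple \<Rightarrow> complex) set" where
  "M_coords = {\<lambda>c. coeff (c $ i) k | i k. True}"

definition affine_value :: "tuple \<Rightarrow> complex \<Rightarrow> complex ^ 5" where
  "affine_value c t = (\<chi> i. poly (c $ i) t)"

text \<open>
  The components of \<open>c\<close> as binary forms of degree \<open>d\<close>; the affine coordinate is \<open>t = x / y\<close>, so
  that \<open>(1, 0)\<close> is the point at infinity.
\<close>

definition hom_value :: "nat \<Rightarrow> tuple \<Rightarrow> complex \<Rightarrow> complex \<Rightarrow> complex ^ 5" where
  "hom_value d c x y = (\<chi> i. \<Sum>k\<le>d. coeff (c $ i) k * x ^ k * y ^ (d - k))"

definition defines_map :: "nat \<Rightarrow> tuple \<Rightarrow> bool" where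
  "defines_map d c \<longleftrightarrow> (\<forall>x y. (x, y) \<noteq> (0, 0) \<longrightarrow> hom_value d c x y \<noteq> 0)"

text \<open>Points of projective 4-space are the lines through 0.\<close>

definition map_image :: "nat \<Rightarrow> tuple \<Rightarrow> (complex ^ 5) set set" where
  "map_image d c = {range (\<lambda>a. a *s hom_value d c x y) | x y. (x, y) \<noteq> (0, 0)}"

text \<open>
  There is a rational map \<open>[v] \<mapsto> [A(v) : B(v)]\<close> that is defined at the general point of the
  image of \<open>c\<close> and is inverse to \<open>c\<close>.
\<close>

definition birational_onto_image :: "tuple \<Rightarrow> bool" where
  "birational_onto_image c \<longleftrightarrow>
     (\<exists>m. \<exists>A\<in>forms m. \<exists>B\<in>forms m.
        finite {t. \<not> (form_eval m B (affine_value c t) \<noteq> 0 \<and>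
                      form_eval m A (affine_value c t) = t * form_eval m B (affine_value c t))})"

text \<open>The degree of a projective curve is its number of points on a generic hyperplane.\<close>

definition curve_degree :: "(complex ^ 5) set set \<Rightarrow> nat \<Rightarrow> bool" where
  "curve_degree K n \<longleftrightarrow>
     generically {\<lambda>a. a $ i | i. True} UNIV
       (\<lambda>a. finite {l \<in> K. \<forall>v\<in>l. (\<Sum>i\<in>UNIV. a $ i * v $ i) = 0} \<and>
            card {l \<in> K. \<forall>v\<in>l. (\<Sum>i\<in>UNIV. a $ i * v $ i) = 0} = n)"

definition M_bir :: "nat \<Rightarrow> tuple set" where
  "M_bir d = {c \<in> M d. defines_map d c \<and> birational_onto_image c \<and> curve_degree (map_image d c) d}"

section \<open>The incidence scheme\<close>

text \<open>The section \<open>c\<^sup>*(f) = f(c(t))\<close>, as a polynomial in the affine coordinate \<open>t\<close>.\<close>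

definition pullback :: "form \<Rightarrow> tuple \<Rightarrow> complex poly" where
  "pullback f c = (\<Sum>e\<in>exponents 5. smult (f e) (\<Prod>i\<in>UNIV. (c $ i) ^ e i))"

text \<open>
  A subset of the projective space \<open>S\<close> of quintics (or of \<open>M \<times> S\<close>) is represented by the cone
  over it, that is by the set of all \<open>f\<close> (or \<open>(c, f)\<close>) with \<open>f \<noteq> 0\<close> whose class \<open>[f]\<close> (or
  \<open>(c, [f])\<close>) belongs to it. As \<open>S\<close> carries the quotient topology, this preserves closed and open
  subsets, and irreducible components correspond to irreducible components.
\<close>

definition plane :: "form \<Rightarrow> form \<Rightarrow> form \<Rightarrow> form set" where
  "plane f0 f1 f2 = module.span fscale {f0, f1, f2} - {0}"

definition open_in_plane :: "form \<Rightarrow> form \<Rightarrow> form \<Rightarrow> form set \<Rightarrow> bool" where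
  "open_in_plane f0 f1 f2 L \<longleftrightarrow>
     L \<subseteq> plane f0 f1 f2 \<and> (\<forall>f\<in>L. \<forall>a. a \<noteq> 0 \<longrightarrow> fscale a f \<in> L) \<and>
     zariski_closed form_coords (plane f0 f1 f2) (plane f0 f1 f2 - L)"

definition MS_coords :: "(tuple \<times> form \<Rightarrow> complex) set" where
  "MS_coords = {\<lambda>(c, f). u c | u. u \<in> M_coords} \<union> {\<lambda>(c, f). u f | u. u \<in> form_coords}"

definition incidence :: "nat \<Rightarrow> form set \<Rightarrow> (tuple \<times> form) set" where
  "incidence d L = {(c, f). c \<in> M_bir d \<and> f \<in> L \<and> pullback f c = 0}"

text \<open>
  The equations of the incidence scheme: the coefficients of \<open>c\<^sup>*(f)\<close> and the linear equations of
  the plane.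
\<close>

definition incidence_ideal :: "nat \<Rightarrow> form \<Rightarrow> form \<Rightarrow> form \<Rightarrow> (tuple \<times> form \<Rightarrow> complex) set" where
  "incidence_ideal d f0 f1 f2 =
     ideal_generated MS_coords (M d \<times> quintics)
       ({\<lambda>(c, f). coeff (pullback f c) k | k. True} \<union>
        {\<lambda>(c, f). (\<Sum>e\<in>exponents 5. b e * f e) | b.
            \<forall>g\<in>{f0, f1, f2}. (\<Sum>e\<in>exponents 5. b e * g e) = 0})"

text \<open>
  An irreducible component \<open>\<Gamma>\<close> of a scheme carries two natural scheme structures: the reduced one,
  and the one of the scheme near the generic point of \<open>\<Gamma>\<close>, that is the smallest closed subscheme
  that agrees with the incidence scheme at that point. A function vanishes in the local ring of the
  generic point iff some multiple by a function not vanishing identically on \<open>\<Gamma>\<close> is in the ideal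
  of the incidence scheme. (The sets \<open>M\<^sub>d\<close> and \<open>\<L>\<close> being open in \<open>M\<close> and in the plane, they do not
  contribute equations.)
\<close>

definition reduced_ideal :: "nat \<Rightarrow> (tuple \<times> form) set \<Rightarrow> (tuple \<times> form \<Rightarrow> complex) set" where
  "reduced_ideal d \<Gamma> = {p \<in> regular MS_coords (M d \<times> quintics). \<forall>x\<in>\<Gamma>. p x = 0}"

definition generic_ideal ::
  "nat \<Rightarrow> form \<Rightarrow> form \<Rightarrow> form \<Rightarrow> (tuple \<times> form) set \<Rightarrow> (tuple \<times> form \<Rightarrow> complex) set" where
  "generic_ideal d f0 f1 f2 \<Gamma> =
     {p \<in> regular MS_coords (M d \<times> quintics).
        \<exists>h \<in> regular MS_coords (M d \<times> quintics).
          (\<exists>x\<in>\<Gamma>. h x \<noteq> 0) \<and> (\<lambda>x. h x * p x) \<in> incidence_ideal d f0 f1 f2}"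

text \<open>
  The scheme-theoretic image of the subscheme with ideal \<open>K\<close> under the projection to \<open>M\<close> is the
  closed subscheme of \<open>M\<close> whose ideal consists of the functions with pull-back in \<open>K\<close>.
\<close>

definition image_ideal :: "nat \<Rightarrow> (tuple \<times> form \<Rightarrow> complex) set \<Rightarrow> (tuple \<Rightarrow> complex) set" where
  "image_ideal d K = {g \<in> regular M_coords (M d). (\<lambda>(c, f). g c) \<in> K}"

text \<open>
  The closed points of the scheme-theoretic image; the underlying space, the closure of the
  projection of \<open>\<Gamma>\<close>, does not depend on the scheme structure of \<open>\<Gamma>\<close>.
\<close>

definition image_points :: "nat \<Rightarrow> (tuple \<times> form) set \<Rightarrow> tuple set" where
  "image_points d \<Gamma> = {c \<in> M d. \<forall>g \<in> image_ideal d (reduced_ideal d \<Gamma>). g c = 0}"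

section \<open>The differential forms\<close>

definition differential :: "(tuple \<Rightarrow> complex) \<Rightarrow> tuple \<Rightarrow> tuple \<Rightarrow> complex" where
  "differential g c v = deriv (\<lambda>s. g (c + tscale s v)) 0"

definition phi :: "form \<Rightarrow> form \<Rightarrow> form \<Rightarrow> (nat \<Rightarrow> complex) \<Rightarrow> nat \<Rightarrow> tuple \<Rightarrow> tuple \<Rightarrow> complex" where
  "phi f0 f1 f2 t i =
     differential (\<lambda>c.
       let val = (\<lambda>f j. form_eval 5 f (affine_value c (t j))) in
       det (vector [vector [val f2 i, val f1 i, val f0 i],
                    vector [val f2 1, val f1 1, val f0 1],
                    vector [val f2 2, val f1 2, val f0 2]] :: complex ^ 3 ^ 3))"

text \<open>
  The wedge product of the 1-forms \<open>\<phi>\<^sub>i\<close> at the point \<open>c\<close>, as an alternating form evaluated on the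
  tangent vectors \<open>v 3, \<dots>, v (5 * d + 1)\<close>.
\<close>

definition omega ::
  "nat \<Rightarrow> form \<Rightarrow> form \<Rightarrow> form \<Rightarrow> (nat \<Rightarrow> complex) \<Rightarrow> tuple \<Rightarrow> (nat \<Rightarrow> tuple) \<Rightarrow> complex" where
  "omega d f0 f1 f2 t c v =
     (\<Sum>\<pi> | \<pi> permutes {3..5 * d + 1}.
        of_int (sign \<pi>) * (\<Prod>i = 3..5 * d + 1. phi f0 f1 f2 t i c (v (\<pi> i))))"

definition omega_nonzero_on ::
  "nat \<Rightarrow> form \<Rightarrow> form \<Rightarrow> form \<Rightarrow> (nat \<Rightarrow> complex) \<Rightarrow> tuple set \<Rightarrow> bool" where
  "omega_nonzero_on d f0 f1 f2 t Z \<longleftrightarrow>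
     (\<exists>c\<in>Z. \<exists>v. (\<forall>j\<in>{3..5 * d + 1}. v j \<in> M d) \<and> omega d f0 f1 f2 t c v \<noteq> 0)"

text \<open>
  Linear independence of the \<open>\<phi>\<^sub>i\<close> in the module of 1-forms on \<open>M\<close> with coefficients in
  \<open>regular M_coords (M d) / I\<close>. That module is free on the differentials of the coordinates, so a
  1-form is zero in it iff its contractions with all constant vector fields \<open>v\<close> are in \<open>I\<close>.
\<close>

definition phi_independent_mod ::
  "nat \<Rightarrow> form \<Rightarrow> form \<Rightarrow> form \<Rightarrow> (nat \<Rightarrow> complex) \<Rightarrow> (tuple \<Rightarrow> complex) set \<Rightarrow> bool" where
  "phi_independent_mod d f0 f1 f2 t I \<longleftrightarrow>
     (\<forall>g. (\<forall>i\<in>{3..5 * d + 1}. g i \<in> regular M_coords (M d)) \<longrightarrow>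
          (\<forall>v\<in>M d. (\<lambda>c. \<Sum>i = 3..5 * d + 1. g i c * phi f0 f1 f2 t i c v) \<in> I) \<longrightarrow>
          (\<forall>i\<in>{3..5 * d + 1}. g i \<in> I))"

end

theory Submission imports Defs begin

text \<open>
  Let \<open>V\<close> be the closure of the projection of \<open>\<Gamma>\<close> to \<open>M\<close>, and call the vector of the values of
  \<open>f0, f1, f2\<close> at the point \<open>c(t\<^sub>l)\<close> the \<open>l\<close>-th row of \<open>c\<close>. As \<open>dim M = 5 d + 5\<close>, the claim is that the tangent
  space of the image has dimension 6 at a very general point of \<open>V\<close>, for both scheme structures on \<open>\<Gamma>\<close>.

  Upper bound. If \<open>c\<close> lies on the quintic with plane coordinates \<open>a\<close>, then all rows of \<open>c\<close> are orthogonal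
  to \<open>a\<close>, so the determinants whose differentials are the \<open>\<phi>\<^sub>i\<close> vanish. By Cramer's rule they even belong to
  the ideal of the larger of the two schemes (\<open>incidence_det_in_J\<close>). So tangent vectors are killed by all
  \<open>\<phi>\<^sub>i\<close>, and where \<open>omega\<close> is not zero these are \<open>5 d - 1\<close> independent conditions (\<open>dim_tangent_le\<close>).

  Lower bound. It is enough to find six independent tangent vectors for the smaller, reduced scheme. Four come
  from \<open>GL\<^sub>2\<close> acting on the parameter of the curve: it preserves the incidence set, hence the irreducible
  component \<open>\<Gamma>\<close> (\<open>component_invariant\<close>, \<open>flow_velocity_tangent\<close>), and its infinitesimal action at a
  birational curve is injective because not all Wronskians of the components vanish. The other two come from \<open>\<Gamma>\<close> being onto the
  two-dimensional \<open>\<L>\<close>. Choose a countable ring \<open>k\<close> over which \<open>V\<close> is defined, and \<open>c\<close> so general that a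
  polynomial over \<open>k\<close> vanishing at \<open>c\<close> vanishes on \<open>V\<close>. A nonzero \<open>omega\<close> forces two rows to be
  independent; then their cross product gives the only quintic of the plane that contains the curve, and because \<open>\<Gamma>\<close> is onto
  \<open>\<L>\<close>, its two affine plane coordinates are algebraically independent over \<open>k\<close>
  (\<open>plane_coordinates_independent\<close>). In characteristic 0 there are derivations \<open>D1, D2\<close> of \<open>\<complex>\<close> over
  \<open>k\<close> that are dual to these two numbers (\<open>algebraically_independent_derivation\<close>). Applied to the coefficients of
  \<open>c\<close> they give tangent vectors, as \<open>dg (D c) = D (g c) = 0\<close> for the equations \<open>g\<close> of \<open>V\<close> over \<open>k\<close>
  (\<open>derivation_tangent\<close>). They move the quintic, whereas reparametrizations do not, and this gives the
  independence of the six vectors (\<open>dim_tangent_ge\<close>).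

  The two formulations of the hypothesis agree because the ideal of \<open>V\<close> is prime: a nonvanishing maximal minor
  kills every relation between the \<open>\<phi>\<^sub>i\<close>, and if all maximal minors vanish, the cofactors of a largest
  nonvanishing minor form a relation.
\<close>

section \<open>Derivations of the complex numbers\<close>

text \<open>
  A derivation \<open>D\<close> on a subring of the complex numbers is the same as a ring homomorphism
  \<open>a \<mapsto> a + D a \<epsilon>\<close> into the dual numbers. Its image is a subring on which the projection to the
  standard part is injective, and extending \<open>D\<close> means enlarging that subring. In this form the
  quotient rule and the well-definedness of an extension come for free from ring arithmetic.
\<close>

datatype dual = Dual (std: complex) (eps: complex)

instantiation dual :: comm_ring_1
begin
definition "0 = Dual 0 0"
definition "1 = Dual 1 0"
definition "a + b = Dual (std a + std b) (eps a + eps b)"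
definition "a - b = Dual (std a - std b) (eps a - eps b)"
definition "- a = Dual (- std a) (- eps a)"
definition "a * b = Dual (std a * std b) (std a * eps b + eps a * std b)"
instance
  by standard (auto simp: zero_dual_def one_dual_def plus_dual_def minus_dual_def
      uminus_dual_def times_dual_def algebra_simps dual.expand)
end

lemma dual_simps [simp]:
  "std 0 = 0" "eps 0 = 0" "std 1 = 1" "eps 1 = 0"
  "std (a + b) = std a + std b" "eps (a + b) = eps a + eps b"
  "std (a - b) = std a - std b" "eps (a - b) = eps a - eps b"
  "std (- a) = - std a" "eps (- a) = - eps a"
  "std (a * b) = std a * std b" "eps (a * b) = std a * eps b + eps a * std b"
  by (simp_all add: zero_dual_def one_dual_def plus_dual_def minus_dual_def
      uminus_dual_def times_dual_def)

definition subring_set :: "'a::comm_ring_1 set \<Rightarrow> bool" where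
  "subring_set G \<longleftrightarrow> 1 \<in> G \<and> (\<forall>a\<in>G. \<forall>b\<in>G. a - b \<in> G \<and> a * b \<in> G)"

lemma subring_setD:
  assumes "subring_set G"
  shows "1 \<in> G" "0 \<in> G" "a \<in> G \<Longrightarrow> b \<in> G \<Longrightarrow> a - b \<in> G" "a \<in> G \<Longrightarrow> b \<in> G \<Longrightarrow> a * b \<in> G"
    "a \<in> G \<Longrightarrow> - a \<in> G" "a \<in> G \<Longrightarrow> b \<in> G \<Longrightarrow> a + b \<in> G" "a \<in> G \<Longrightarrow> a ^ n \<in> G"
proof -
  show 1: "1 \<in> G" and d: "\<And>a b. a \<in> G \<Longrightarrow> b \<in> G \<Longrightarrow> a - b \<in> G"
    and m: "\<And>a b. a \<in> G \<Longrightarrow> b \<in> G \<Longrightarrow> a * b \<in> G"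
    using assms by (auto simp: subring_set_def)
  show 0: "0 \<in> G" using d[OF 1 1] by simp
  show n: "\<And>a. a \<in> G \<Longrightarrow> - a \<in> G" using d[OF 0] by fastforce
  show "\<And>a b. a \<in> G \<Longrightarrow> b \<in> G \<Longrightarrow> a + b \<in> G" using d n by fastforce
  show "a \<in> G \<Longrightarrow> a ^ n \<in> G" by (induction n) (auto intro: 1 m)
qed

lemma subring_set_sum: "subring_set G \<Longrightarrow> (\<And>i. i \<in> A \<Longrightarrow> f i \<in> G) \<Longrightarrow> sum f A \<in> G"
  by (induction A rule: infinite_finite_induct) (auto intro: subring_setD)

lemma poly_extension_memI:
  "\<forall>n. coeff q n \<in> G \<Longrightarrow> w = poly q z \<Longrightarrow> w \<in> {poly q z | q. \<forall>n. coeff q n \<in> G}"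
  by blast

lemma poly_extension_subring:
  assumes G: "subring_set G"
  shows "subring_set {poly q z | q. \<forall>n. coeff q n \<in> G}" (is "subring_set ?H")
proof -
  have mult: "coeff (q * r) n \<in> G" if "\<forall>n. coeff q n \<in> G" "\<forall>n. coeff r n \<in> G" for q r n
    unfolding coeff_mult using that G by (intro subring_set_sum subring_setD) auto
  moreover have "coeff (1 :: 'a poly) n \<in> G" for n
    using G by (auto simp: coeff_1 subring_setD)
  moreover have "1 \<in> ?H"
    by (rule poly_extension_memI[of 1]) (use \<open>\<And>n. coeff 1 n \<in> G\<close> in auto)
  moreover have "a - b \<in> ?H \<and> a * b \<in> ?H" if ab: "a \<in> ?H" "b \<in> ?H" for a b
  proof -
    obtain q r where qr: "a = poly q z" "b = poly r z" "\<forall>n. coeff q n \<in> G" "\<forall>n. coeff r n \<in> G"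
      using ab by blast
    show ?thesis
      using qr subring_setD(3)[OF G] mult
      by (intro conjI poly_extension_memI[of "q - r"] poly_extension_memI[of "q * r"]) auto
  qed
  ultimately show ?thesis unfolding subring_set_def by blast
qed

text \<open>
  For a subring, the condition on the standard part says that it is the graph of a function.
\<close>

definition derivation_graph :: "dual set \<Rightarrow> bool" where
  "derivation_graph G \<longleftrightarrow> subring_set G \<and> (\<forall>g\<in>G. std g = 0 \<longrightarrow> g = 0)"

text \<open>
  The polynomials in \<open>z\<close> form a subring again, so a maximal graph contains every dual number
  that it can adjoin without producing a nonzero multiple of \<open>\<epsilon>\<close>.
\<close>

lemma derivation_graph_adjoin:
  assumes "derivation_graph G"
    and max: "\<And>H. derivation_graph H \<Longrightarrow> G \<subseteq> H \<Longrightarrow> H = G"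
    and z: "\<And>q. \<forall>n. coeff q n \<in> G \<Longrightarrow> std (poly q z) = 0 \<Longrightarrow> poly q z = 0"
  shows "z \<in> G"
proof -
  have G: "subring_set G" using assms by (auto simp: derivation_graph_def)
  let ?H = "{poly q z | q. \<forall>n. coeff q n \<in> G}"
  have "derivation_graph ?H"
    using poly_extension_subring[OF G] z by (auto simp: derivation_graph_def)
  moreover have "G \<subseteq> ?H"
  proof
    fix g assume "g \<in> G"
    then have "\<forall>n. coeff [:g:] n \<in> G" using G by (auto simp: coeff_pCons subring_setD split: nat.split)
    then show "g \<in> ?H" by (rule poly_extension_memI) simp
  qed
  ultimately have H: "?H = G" using max by blast
  have "\<forall>n. coeff [:0, 1:] n \<in> G" using G by (auto simp: coeff_pCons subring_setD split: nat.split)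
  then have "z \<in> ?H" by (rule poly_extension_memI) simp
  then show ?thesis using H by simp
qed

text \<open>
  A nonzero element \<open>g\<close> of a graph is a unit \<open>a + b \<epsilon>\<close> of the dual numbers. Adjoining its inverse
  \<open>h\<close> is harmless: multiplication by a power of \<open>g\<close> carries a polynomial in \<open>h\<close> back into the graph.
  Hence a maximal graph projects onto a field.
\<close>

lemma maximal_derivation_graph_inverse:
  assumes G: "derivation_graph G"
    and max: "\<And>H. derivation_graph H \<Longrightarrow> G \<subseteq> H \<Longrightarrow> H = G"
    and g: "g \<in> G" "g \<noteq> 0"
  shows "\<exists>h\<in>G. g * h = 1"
proof -
  have sG: "subring_set G" and inj: "\<And>g. g \<in> G \<Longrightarrow> std g = 0 \<Longrightarrow> g = 0"
    using G by (auto simp: derivation_graph_def)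
  have rg: "std g \<noteq> 0" using inj g by blast
  define h where "h = Dual (1 / std g) (- eps g / (std g)\<^sup>2)"
  have gh: "g * h = 1"
    using rg by (auto simp: h_def one_dual_def times_dual_def power2_eq_square field_simps)
  have "h \<in> G"
  proof (rule derivation_graph_adjoin[OF G max])
    fix q assume q: "\<forall>n. coeff q n \<in> G" and 0: "std (poly q h) = 0"
    define n where "n = degree q"
    have "g ^ n * poly q h = (\<Sum>i\<le>n. coeff q i * g ^ (n - i))"
      unfolding poly_altdef n_def sum_distrib_left
    proof (rule sum.cong[OF refl])
      fix i assume "i \<in> {..degree q}"
      then have "g ^ degree q = g ^ i * g ^ (degree q - i)" by (simp flip: power_add)
      moreover have "g ^ i * h ^ i = 1" by (simp add: gh flip: power_mult_distrib)
      ultimately show "g ^ degree q * (coeff q i * h ^ i) = coeff q i * g ^ (degree q - i)"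
        by (metis (no_types, lifting) mult.assoc mult.commute mult.left_neutral)
    qed
    also have "\<dots> \<in> G" using q g sG by (intro subring_set_sum subring_setD) auto
    finally have "g ^ n * poly q h \<in> G" .
    then have "g ^ n * poly q h = 0" using 0 by (intro inj) auto
    then have "h ^ n * g ^ n * poly q h = 0" by (simp add: mult.assoc)
    moreover have "h ^ n * g ^ n = 1" using gh by (simp add: mult.commute flip: power_mult_distrib)
    ultimately show "poly q h = 0" by simp
  qed auto
  then show ?thesis using gh by blast
qed

lemma std_poly_dual: "std (poly q (Dual y u)) = poly (map_poly std q) y"
  by (induction q) (auto simp: map_poly_pCons)

lemma eps_poly_dual:
  "eps (poly q (Dual y u)) = eps (poly q (Dual y 0)) + u * poly (pderiv (map_poly std q)) y"
  by (induction q) (auto simp: map_poly_pCons std_poly_dual pderiv_pCons algebra_simps)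

text \<open>
  The field \<open>E\<close> below a maximal graph is all of \<open>\<complex>\<close>. If \<open>y\<close> is transcendental over \<open>E\<close>, its derivative can be
  chosen to be 0. If \<open>p\<close> is an equation of minimal degree for \<open>y\<close>, the derivative is the \<open>u\<close> with
  \<open>p (y + u \<epsilon>) = 0\<close>. It exists because minimality and characteristic 0 make \<open>p'(y)\<close> nonzero, and it
  creates no new relation because every relation is a multiple of \<open>p\<close>.
\<close>

lemma maximal_derivation_graph_total:
  assumes G: "derivation_graph G"
    and max: "\<And>H. derivation_graph H \<Longrightarrow> G \<subseteq> H \<Longrightarrow> H = G"
  shows "\<exists>u. Dual y u \<in> G"
proof (cases "\<exists>p. (\<forall>n. coeff p n \<in> G) \<and> p \<noteq> 0 \<and> poly (map_poly std p) y = 0")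
  case False
  have "Dual y 0 \<in> G"
  proof (rule derivation_graph_adjoin[OF G max])
    fix q assume "\<forall>n. coeff q n \<in> G" "std (poly q (Dual y 0)) = 0"
    then show "poly q (Dual y 0) = 0" using False by (cases "q = 0") (auto simp: std_poly_dual)
  qed auto
  then show ?thesis by blast
next
  case True
  have sG: "subring_set G" and inj: "\<And>g. g \<in> G \<Longrightarrow> std g = 0 \<Longrightarrow> g = 0"
    using G by (auto simp: derivation_graph_def)
  let ?P = "\<lambda>p. (\<forall>n. coeff p n \<in> G) \<and> p \<noteq> 0 \<and> poly (map_poly std p) y = 0"
  obtain p where p: "?P p" and min: "\<And>q. ?P q \<Longrightarrow> degree p \<le> degree q"
    using ex_has_least_nat[of ?P _ degree] True by metis
  have deg_re: "degree (map_poly std q) = degree q" if "\<forall>n. coeff q n \<in> G" for q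
  proof (cases "q = 0")
    case False
    then have "std (lead_coeff q) \<noteq> 0" using that inj by fastforce
    then show ?thesis by (intro map_poly_degree_eq) simp
  qed simp
  let ?r = "map_poly std p"
  have r0: "?r \<noteq> 0"
    using p inj by (metis coeff_map_poly dual_simps(1) leading_coeff_0_iff coeff_0)
  have dp: "degree p > 0"
  proof (rule ccontr)
    assume "\<not> degree p > 0"
    then have "degree ?r = 0" using deg_re p by simp
    then obtain a where "?r = [:a:]" by (rule degree_eq_zeroE)
    then show False using r0 p by auto
  qed
  have ne: "poly (pderiv ?r) y \<noteq> 0"
  proof
    assume 0: "poly (pderiv ?r) y = 0"
    \<comment> \<open>The formal derivative, written out because the dual numbers have zero divisors.\<close>
    define p' where "p' = (\<Sum>n<degree p. monom (of_nat (Suc n) * coeff p (Suc n)) n)"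
    have c: "coeff p' n = of_nat (Suc n) * coeff p (Suc n)" for n
      by (cases "n < degree p")
         (auto simp: p'_def coeff_sum coeff_eq_0 simp del: of_nat_Suc)
    have "coeff p' n \<in> G" for n
    proof -
      have "of_nat m \<in> G" for m by (induction m) (auto intro: sG subring_setD)
      then show ?thesis using p sG by (auto simp: c intro!: subring_setD(4) simp del: of_nat_Suc)
    qed
    moreover have ofn: "std (of_nat m) = of_nat m" for m by (induction m) auto
    have mp: "map_poly std p' = pderiv ?r"
      by (rule poly_eqI) (simp add: coeff_map_poly coeff_pderiv c ofn del: of_nat_Suc)
    moreover have "pderiv ?r \<noteq> 0" using dp deg_re p by (simp add: pderiv_eq_0_iff)
    then have "p' \<noteq> 0" using mp by fastforce
    moreover have "degree p' < degree p"
      using dp degree_le[of "degree p - 1" p'] by (force simp: c coeff_eq_0)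
    ultimately show False using min[of p'] 0 by simp
  qed
  define u where "u = - eps (poly p (Dual y 0)) / poly (pderiv ?r) y"
  \<comment> \<open>The Taylor expansion of \<open>p\<close> at \<open>y\<close> ends after the linear term because \<open>\<epsilon>\<^sup>2 = 0\<close>.\<close>
  have "eps (poly p (Dual y u)) = 0"
    unfolding eps_poly_dual[of p y u] using ne by (simp add: u_def)
  then have pz: "poly p (Dual y u) = 0"
    using p by (intro dual.expand) (simp add: std_poly_dual)
  obtain l where l: "l \<in> G" "lead_coeff p * l = 1"
    using maximal_derivation_graph_inverse[OF G max, of "lead_coeff p"] p by auto
  have "poly q (Dual y u) = 0"
    if "\<forall>n. coeff q n \<in> G" "std (poly q (Dual y u)) = 0" for q
    using that
  proof (induction "degree q" arbitrary: q rule: less_induct)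
    case (less q)
    show ?case
    proof (cases "q = 0 \<or> degree q < degree p")
      case True
      then show ?thesis using min[of q] less.prems by (cases "q = 0") (auto simp: std_poly_dual)
    next
      case False
      \<comment> \<open>Division with remainder by \<open>p\<close>, one leading term at a time; the leading coefficient of \<open>p\<close> is a unit.\<close>
      define w where "w = monom (lead_coeff q * l) (degree q - degree p)"
      define q' where "q' = q - w * p"
      have wG: "coeff w n \<in> G" for n
        using less.prems sG l by (auto simp: w_def intro: subring_setD)
      have G': "\<forall>n. coeff q' n \<in> G"
        unfolding q'_def coeff_diff coeff_mult using less.prems sG wG p
        by (auto intro!: subring_setD(3) subring_set_sum subring_setD(4))
      have e: "poly q' (Dual y u) = poly q (Dual y u)" by (simp add: q'_def pz)
      have "coeff (w * p) (degree q) = lead_coeff q * l * lead_coeff p"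
        unfolding w_def using False by (simp add: coeff_monom_mult)
      also have "\<dots> = lead_coeff q" using l by (simp add: mult.assoc mult.commute[of l])
      finally have c0: "coeff q' (degree q) = 0" by (simp add: q'_def)
      have "degree (w * p) \<le> degree q"
        using degree_mult_le[of w p] degree_monom_le[of "lead_coeff q * l" "degree q - degree p"] False
        unfolding w_def by linarith
      then have "degree q' \<le> degree q" unfolding q'_def by (intro degree_diff_le) auto
      moreover have "degree q' \<noteq> degree q \<or> q' = 0" using c0 by (metis leading_coeff_0_iff)
      ultimately show ?thesis
        using less.hyps[of q'] G' e less.prems by (cases "q' = 0") auto
    qed
  qed
  then have "Dual y u \<in> G" by (intro derivation_graph_adjoin[OF G max]) auto
  then show ?thesis by blast
qed

definition derivation :: "(complex \<Rightarrow> complex) \<Rightarrow> bool" where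
  "derivation D \<longleftrightarrow> (\<forall>a b. D (a + b) = D a + D b) \<and> (\<forall>a b. D (a * b) = a * D b + D a * b)"

lemma derivation_extends_graph:
  assumes G0: "derivation_graph G0"
  shows "\<exists>D. derivation D \<and> (\<forall>g\<in>G0. D (std g) = eps g)"
proof -
  have "\<exists>G\<in>{H. derivation_graph H \<and> G0 \<subseteq> H}. \<forall>H\<in>{H. derivation_graph H \<and> G0 \<subseteq> H}. G \<subseteq> H \<longrightarrow> H = G"
  proof (rule subset_Zorn_nonempty)
    show "{H. derivation_graph H \<and> G0 \<subseteq> H} \<noteq> {}" using G0 by auto
  next
    fix C assume C0: "C \<noteq> {}" and C: "subset.chain {H. derivation_graph H \<and> G0 \<subseteq> H} C"
    have dg: "derivation_graph H" "G0 \<subseteq> H" if "H \<in> C" for H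
      using C that by (auto simp: subset.chain_def)
    have "a - b \<in> \<Union>C \<and> a * b \<in> \<Union>C" if ab: "a \<in> \<Union>C" "b \<in> \<Union>C" for a b
    proof -
      obtain A B where AB: "A \<in> C" "B \<in> C" "a \<in> A" "b \<in> B" using ab by blast
      then have "A \<subseteq> B \<or> B \<subseteq> A" using C by (metis subset_chain_def)
      then obtain H where "H \<in> C" "a \<in> H" "b \<in> H" using AB by blast
      then show ?thesis using dg[of H] by (auto simp: derivation_graph_def subring_set_def)
    qed
    moreover have "1 \<in> \<Union>C" using C0 dg by (auto simp: derivation_graph_def subring_set_def)
    ultimately have "subring_set (\<Union>C)" by (auto simp: subring_set_def)
    moreover have "\<forall>g\<in>\<Union>C. std g = 0 \<longrightarrow> g = 0" using dg by (auto simp: derivation_graph_def)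
    moreover obtain H where "H \<in> C" using C0 by blast
    then have "G0 \<subseteq> \<Union>C" using dg(2)[of H] by (meson Union_upper subset_trans)
    ultimately show "\<Union>C \<in> {H. derivation_graph H \<and> G0 \<subseteq> H}"
      unfolding derivation_graph_def by (intro CollectI conjI)
  qed
  then obtain G where "G \<in> {H. derivation_graph H \<and> G0 \<subseteq> H}"
    and mx: "\<forall>H\<in>{H. derivation_graph H \<and> G0 \<subseteq> H}. G \<subseteq> H \<longrightarrow> H = G" by (elim bexE)
  then have G: "derivation_graph G" "G0 \<subseteq> G" by simp_all
  have max: "H = G" if "derivation_graph H" "G \<subseteq> H" for H
  proof -
    have "H \<in> {H. derivation_graph H \<and> G0 \<subseteq> H}" using that G(2) by simp
    with mx that(2) show ?thesis by simp
  qed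
  have sG: "subring_set G" and inj: "\<And>g. g \<in> G \<Longrightarrow> std g = 0 \<Longrightarrow> g = 0"
    using G by (auto simp: derivation_graph_def)
  obtain D where D: "Dual y (D y) \<in> G" for y
    using maximal_derivation_graph_total[OF G(1) max] by metis
  have De: "D (std g) = eps g" if "g \<in> G" for g
    using inj[OF subring_setD(3)[OF sG D that]] that
    by (auto simp: dual.expand dest: arg_cong[where f = eps])
  have "derivation D"
    unfolding derivation_def
    using De[OF subring_setD(6)[OF sG D D]] De[OF subring_setD(4)[OF sG D D]] by auto
  then show ?thesis using De G by blast
qed

text \<open>
  The graph of \<open>d / dx\<close> on the ring of polynomials in \<open>x\<close> over \<open>R\<close> extends to \<open>\<complex>\<close> by Zorn's lemma.
\<close>

lemma derivation_of_transcendental: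
  assumes R: "subring_set (R :: complex set)"
    and x: "\<And>p. \<forall>n. coeff p n \<in> R \<Longrightarrow> poly p x = 0 \<Longrightarrow> p = 0"
  shows "\<exists>D. derivation D \<and> (\<forall>r\<in>R. D r = 0) \<and> D x = 1"
proof -
  let ?B = "{Dual r 0 | r. r \<in> R}"
  let ?G = "{poly q (Dual x 1) | q. \<forall>n. coeff q n \<in> ?B}"
  have "subring_set ?B"
    unfolding subring_set_def using subring_setD[OF R]
    by (auto simp: one_dual_def minus_dual_def times_dual_def)
  then have s: "subring_set ?G" by (rule poly_extension_subring)
  have q0: "q = 0" if q: "\<forall>n. coeff q n \<in> ?B" "std (poly q (Dual x 1)) = 0" for q
  proof -
    have "coeff (map_poly std q) n \<in> R" for n
      using q(1)[rule_format, of n] by (auto simp: coeff_map_poly)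
    then have "map_poly std q = 0" using x q by (auto simp: std_poly_dual)
    then have re0: "std (coeff q n) = 0" for n
      using coeff_map_poly[of std q n] by simp
    have "coeff q n = 0" for n
      using q(1)[rule_format, of n] re0[of n] by (auto simp: zero_dual_def)
    then show "q = 0" by (intro poly_eqI) simp
  qed
  have "derivation_graph ?G"
    unfolding derivation_graph_def
  proof (intro conjI s ballI impI)
    fix g assume "g \<in> ?G" "std g = 0"
    then obtain q where "g = poly q (Dual x 1)" "\<forall>n. coeff q n \<in> ?B" by (elim CollectE exE conjE)
    with q0[of q] \<open>std g = 0\<close> show "g = 0" by simp
  qed
  from derivation_extends_graph[OF this]
  obtain D where D: "derivation D" "\<forall>g\<in>?G. D (std g) = eps g" by (elim exE conjE)
  have "D r = 0" if "r \<in> R" for r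
  proof -
    have "\<forall>n. coeff [:Dual r 0:] n \<in> ?B"
      using that subring_setD[OF R] by (auto simp: coeff_pCons zero_dual_def split: nat.split)
    then have "Dual r 0 \<in> ?G" by (rule poly_extension_memI) simp
    from D(2)[rule_format, OF this] show ?thesis by simp
  qed
  moreover have "D x = 1"
  proof -
    have "\<forall>n. coeff [:0, 1:] n \<in> ?B"
      using subring_setD[OF R] by (auto simp: coeff_pCons zero_dual_def one_dual_def split: nat.split)
    then have "Dual x 1 \<in> ?G" by (rule poly_extension_memI) simp
    from D(2)[rule_format, OF this] show ?thesis by simp
  qed
  ultimately show ?thesis using D by blast
qed

lemma derivation_rules:
  assumes "derivation D"
  shows "D 0 = 0" "D 1 = 0" "D (a + b) = D a + D b" "D (a * b) = a * D b + D a * b"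
    "D (- a) = - D a" "D (a - b) = D a - D b" "D (sum f A) = (\<Sum>i\<in>A. D (f i))"
proof -
  have a: "\<And>a b. D (a + b) = D a + D b" and m: "\<And>a b. D (a * b) = a * D b + D a * b"
    using assms by (auto simp: derivation_def)
  show 0: "D 0 = 0" using a[of 0 0] by simp
  show "D 1 = 0" using m[of 1 1] by simp
  show n: "D (- a) = - D a" for a using a[of a "- a"] 0 by (simp add: add_eq_0_iff)
  show "D (a - b) = D a - D b" using a[of a "- b"] n by simp
  show "D (a + b) = D a + D b" "D (a * b) = a * D b + D a * b" by (rule a m)+
  show "D (sum f A) = (\<Sum>i\<in>A. D (f i))"
    by (induction A rule: infinite_finite_induct) (auto simp: 0 a)
qed

lemma derivation_combination:
  assumes "derivation D" "derivation E"
  shows "derivation (\<lambda>x. a * D x + b * E x)"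
  using assms by (auto simp: derivation_def algebra_simps)

lemma poly_coeff_sum: "degree p \<le> d \<Longrightarrow> poly p t = (\<Sum>k\<le>d. coeff p k * t ^ k)" for p :: "complex poly"
  unfolding poly_altdef by (auto intro!: sum.mono_neutral_left coeff_eq_0)

text \<open>
  Polynomials in two variables are encoded by their coefficients \<open>P i j\<close> with \<open>i, j \<le> N\<close>.
\<close>

definition algebraically_independent_pair :: "complex set \<Rightarrow> complex \<Rightarrow> complex \<Rightarrow> bool" where
  "algebraically_independent_pair k x y \<longleftrightarrow>
     (\<forall>P N. (\<forall>i j. P i j \<in> k) \<longrightarrow> (\<Sum>i\<le>(N::nat). \<Sum>j\<le>N. P i j * x ^ i * y ^ j) = 0 \<longrightarrow>
        (\<forall>i\<le>N. \<forall>j\<le>N. P i j = 0))"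

lemma algebraically_independent_swap:
  assumes "algebraically_independent_pair k x y"
  shows "algebraically_independent_pair k y x"
  unfolding algebraically_independent_pair_def
proof (intro allI impI)
  fix P :: "nat \<Rightarrow> nat \<Rightarrow> complex" and N i j
  assume P: "\<forall>i j. P i j \<in> k" and 0: "(\<Sum>i\<le>N. \<Sum>j\<le>N. P i j * y ^ i * x ^ j) = 0" and ij: "i \<le> N" "j \<le> N"
  have "(\<Sum>i\<le>N. \<Sum>j\<le>N. P j i * x ^ i * y ^ j) = (\<Sum>i\<le>N. \<Sum>j\<le>N. P i j * y ^ i * x ^ j)"
    by (subst sum.swap) (simp add: mult_ac)
  then show "P i j = 0"
    using assms[unfolded algebraically_independent_pair_def, rule_format, of "\<lambda>i j. P j i" N j i] P 0 ij by simp
qed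

text \<open>
  Independence makes \<open>x\<close> transcendental over the ring of polynomials in \<open>y\<close>, so \<open>d / dx\<close> can be
  required to vanish on that ring, in particular at \<open>y\<close>.
\<close>

lemma algebraically_independent_derivation:
  assumes k: "subring_set k" and ind: "algebraically_independent_pair k x y"
  shows "\<exists>D. derivation D \<and> (\<forall>a\<in>k. D a = 0) \<and> D x = 1 \<and> D y = 0"
proof -
  let ?R = "{poly q y | q. \<forall>n. coeff q n \<in> k}"
  have R: "subring_set ?R" by (rule poly_extension_subring[OF k])
  have p0: "p = 0" if p: "\<forall>n. coeff p n \<in> ?R" "poly p x = 0" for p
  proof -
    have "\<forall>n. \<exists>q. (\<forall>n. coeff q n \<in> k) \<and> coeff p n = poly q y" using p(1) by blast
    then obtain q where q: "\<And>n. \<forall>m. coeff (q n) m \<in> k" "\<And>n. coeff p n = poly (q n) y" by metis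
    define Q where "Q i = (if i \<le> degree p then q i else 0)" for i
    have Q: "\<forall>i j. coeff (Q i) j \<in> k" "coeff p i = poly (Q i) y" for i
      using q(1) subring_setD(2)[OF k] q(2)[of i] coeff_eq_0[of p i] by (auto simp: Q_def)
    define N where "N = degree p + (\<Sum>i\<le>degree p. degree (q i))"
    have N: "degree (Q i) \<le> N" for i
    proof (cases "i \<le> degree p")
      case True
      then have "degree (q i) \<le> (\<Sum>i\<le>degree p. degree (q i))" by (intro member_le_sum) auto
      then show ?thesis using True by (simp add: Q_def N_def)
    qed (simp add: Q_def)
    have "0 = (\<Sum>i\<le>N. coeff p i * x ^ i)"
      using p(2) by (subst poly_coeff_sum[symmetric]) (simp_all add: N_def)
    also have "\<dots> = (\<Sum>i\<le>N. \<Sum>j\<le>N. coeff (Q i) j * x ^ i * y ^ j)"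
      unfolding Q(2) poly_coeff_sum[OF N] sum_distrib_right by (simp add: mult_ac)
    finally have s0: "(\<Sum>i\<le>N. \<Sum>j\<le>N. coeff (Q i) j * x ^ i * y ^ j) = 0" by (rule sym)
    have "\<forall>i j. coeff (Q i) j \<in> k" by (rule Q(1))
    from ind[unfolded algebraically_independent_pair_def, THEN spec, THEN spec, THEN mp, THEN mp, OF this s0]
    have "\<forall>i\<le>N. \<forall>j\<le>N. coeff (Q i) j = 0" .
    then have Q0: "coeff (Q i) (degree (Q i)) = 0" if "i \<le> degree p" for i
      using that N[of i] by (simp add: N_def)
    have QQ: "Q i = 0" if "i \<le> degree p" for i
      using Q0[OF that] by simp
    have "coeff p i = 0" for i
    proof (cases "i \<le> degree p")
      case True
      then show ?thesis using Q(2)[of i] QQ[of i] by simp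
    qed (simp add: coeff_eq_0)
    then show "p = 0" by (intro poly_eqI) simp
  qed
  have "\<exists>D. derivation D \<and> (\<forall>r\<in>?R. D r = 0) \<and> D x = 1"
    using R p0 by (rule derivation_of_transcendental)
  then obtain D where
    D: "derivation D" "\<forall>r\<in>?R. D r = 0" "D x = 1" by (elim exE conjE)
  have "D a = 0" if "a \<in> k" for a
  proof -
    have "a \<in> ?R"
      by (rule poly_extension_memI[of "[:a:]"])
        (use that subring_setD(2)[OF k] in \<open>auto simp: coeff_pCons split: nat.split\<close>)
    then show ?thesis using D(2) by blast
  qed
  moreover have "y \<in> ?R"
    by (rule poly_extension_memI[of "[:0, 1:]"])
      (use subring_setD[OF k] in \<open>auto simp: coeff_pCons split: nat.split\<close>)
  then have "D y = 0" using D(2) by blast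
  ultimately show ?thesis using D by blast
qed

section \<open>Polynomial functions\<close>

lemma pf_uminus: "p \<in> polynomial_functions C \<Longrightarrow> (\<lambda>x. - p x) \<in> polynomial_functions C"
  using polynomial_functions.mult[OF polynomial_functions.const[of "-1"]] by simp

lemma pf_diff:
  "p \<in> polynomial_functions C \<Longrightarrow> q \<in> polynomial_functions C \<Longrightarrow>
    (\<lambda>x. p x - q x) \<in> polynomial_functions C"
  using polynomial_functions.add[OF _ pf_uminus] by fastforce

lemma pf_sum:
  "(\<And>i. i \<in> A \<Longrightarrow> p i \<in> polynomial_functions C) \<Longrightarrow>
    (\<lambda>x. \<Sum>i\<in>A. p i x) \<in> polynomial_functions C"
  by (induction A rule: infinite_finite_induct) (auto intro: polynomial_functions.intros)

lemma pf_prod: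
  "(\<And>i. i \<in> A \<Longrightarrow> p i \<in> polynomial_functions C) \<Longrightarrow>
    (\<lambda>x. \<Prod>i\<in>A. p i x) \<in> polynomial_functions C"
  by (induction A rule: infinite_finite_induct) (auto intro: polynomial_functions.intros)

lemma pf_power: "p \<in> polynomial_functions C \<Longrightarrow> (\<lambda>x. p x ^ n) \<in> polynomial_functions C"
  by (induction n) (auto intro: polynomial_functions.intros)

lemmas pf_intros = polynomial_functions.const polynomial_functions.add polynomial_functions.mult
  pf_uminus pf_diff pf_sum pf_prod pf_power

lemma pf_compose:
  assumes "p \<in> polynomial_functions C" "\<And>u. u \<in> C \<Longrightarrow> (\<lambda>x. u (h x)) \<in> polynomial_functions C'"
  shows "(\<lambda>x. p (h x)) \<in> polynomial_functions C'"
  using assms(1) by induction (auto intro: polynomial_functions.intros assms(2))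

lemma pf_regular: "p \<in> polynomial_functions C \<Longrightarrow> p \<in> regular C X"
  by (auto simp: regular_def)

lemma regularE:
  assumes "g \<in> regular C X"
  obtains p where "p \<in> polynomial_functions C" "\<And>x. x \<in> X \<Longrightarrow> g x = p x"
  using assms by (auto simp: regular_def)

lemma regularI: "p \<in> polynomial_functions C \<Longrightarrow> (\<And>x. x \<in> X \<Longrightarrow> g x = p x) \<Longrightarrow> g \<in> regular C X"
  by (auto simp: regular_def)

lemma regular_add:
  assumes "g \<in> regular C X" "h \<in> regular C X"
  shows "(\<lambda>x. g x + h x) \<in> regular C X"
proof -
  obtain p q where "p \<in> polynomial_functions C" "\<And>x. x \<in> X \<Longrightarrow> g x = p x"
    "q \<in> polynomial_functions C" "\<And>x. x \<in> X \<Longrightarrow> h x = q x"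
    using regularE[OF assms(1)] regularE[OF assms(2)] by (metis (no_types))
  then show ?thesis by (intro regularI[of "\<lambda>x. p x + q x"] polynomial_functions.add) auto
qed

lemma regular_mult:
  assumes "g \<in> regular C X" "h \<in> regular C X"
  shows "(\<lambda>x. g x * h x) \<in> regular C X"
proof -
  obtain p q where "p \<in> polynomial_functions C" "\<And>x. x \<in> X \<Longrightarrow> g x = p x"
    "q \<in> polynomial_functions C" "\<And>x. x \<in> X \<Longrightarrow> h x = q x"
    using regularE[OF assms(1)] regularE[OF assms(2)] by (metis (no_types))
  then show ?thesis by (intro regularI[of "\<lambda>x. p x * q x"] polynomial_functions.mult) auto
qed

lemma regular_cmult: "g \<in> regular C X \<Longrightarrow> (\<lambda>x. a * g x) \<in> regular C X"
  using regular_mult[OF pf_regular[OF polynomial_functions.const]] by blast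

lemma regular_sum:
  "(\<And>i. i \<in> A \<Longrightarrow> g i \<in> regular C X) \<Longrightarrow> (\<lambda>x. \<Sum>i\<in>A. g i x) \<in> regular C X"
  by (induction A rule: infinite_finite_induct)
    (auto intro: regular_add pf_regular polynomial_functions.const)

lemma regular_prod:
  "(\<And>i. i \<in> A \<Longrightarrow> g i \<in> regular C X) \<Longrightarrow> (\<lambda>x. \<Prod>i\<in>A. g i x) \<in> regular C X"
  by (induction A rule: infinite_finite_induct)
    (auto intro: regular_mult pf_regular polynomial_functions.const)

lemma one_regular: "(\<lambda>_. 1) \<in> regular C X"
  by (intro pf_regular polynomial_functions.const)

definition is_poly :: "(complex \<Rightarrow> complex) \<Rightarrow> bool" where
  "is_poly h \<longleftrightarrow> (\<exists>q. \<forall>s. h s = poly q s)"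

lemma is_poly_intros:
  "is_poly (\<lambda>s. a)" "is_poly (\<lambda>s. s)"
  "is_poly f \<Longrightarrow> is_poly g \<Longrightarrow> is_poly (\<lambda>s. f s + g s)"
  "is_poly f \<Longrightarrow> is_poly g \<Longrightarrow> is_poly (\<lambda>s. f s - g s)"
  "is_poly f \<Longrightarrow> is_poly g \<Longrightarrow> is_poly (\<lambda>s. f s * g s)"
  "is_poly f \<Longrightarrow> is_poly (\<lambda>s. f s ^ n)"
  "(\<And>i. i \<in> A \<Longrightarrow> is_poly (F i)) \<Longrightarrow> is_poly (\<lambda>s. \<Sum>i\<in>A. F i s)"
  "(\<And>i. i \<in> A \<Longrightarrow> is_poly (F i)) \<Longrightarrow> is_poly (\<lambda>s. \<Prod>i\<in>A. F i s)"
proof -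
  show c: "is_poly (\<lambda>s. a)" for a unfolding is_poly_def by (rule exI[of _ "[:a:]"]) simp
  show "is_poly (\<lambda>s. s)" unfolding is_poly_def by (rule exI[of _ "[:0, 1:]"]) simp
  show a: "is_poly f \<Longrightarrow> is_poly g \<Longrightarrow> is_poly (\<lambda>s. f s + g s)" for f g
    unfolding is_poly_def by (metis poly_add)
  show "is_poly f \<Longrightarrow> is_poly g \<Longrightarrow> is_poly (\<lambda>s. f s - g s)"
    unfolding is_poly_def by (metis poly_diff)
  show m: "is_poly f \<Longrightarrow> is_poly g \<Longrightarrow> is_poly (\<lambda>s. f s * g s)" for f g
    unfolding is_poly_def by (metis poly_mult)
  show "is_poly f \<Longrightarrow> is_poly (\<lambda>s. f s ^ n)"
    unfolding is_poly_def by (metis poly_power)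
  show "(\<And>i. i \<in> A \<Longrightarrow> is_poly (F i)) \<Longrightarrow> is_poly (\<lambda>s. \<Sum>i\<in>A. F i s)"
    by (induction A rule: infinite_finite_induct) (auto intro: c a)
  show "(\<And>i. i \<in> A \<Longrightarrow> is_poly (F i)) \<Longrightarrow> is_poly (\<lambda>s. \<Prod>i\<in>A. F i s)"
    by (induction A rule: infinite_finite_induct) (auto intro: c m)
qed

lemma is_poly_finite_zeros:
  "is_poly h \<Longrightarrow> h a \<noteq> 0 \<Longrightarrow> finite {s. h s = 0}"
  unfolding is_poly_def by (metis (mono_tags, lifting) Collect_cong poly_0 poly_roots_finite)

lemma is_poly_zero:
  "is_poly h \<Longrightarrow> infinite S \<Longrightarrow> (\<And>s. s \<in> S \<Longrightarrow> h s = 0) \<Longrightarrow> h a = 0"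
  using is_poly_finite_zeros[of h a] finite_subset[of S "{s. h s = 0}"] by blast

lemma is_poly_no_zero_divisors:
  assumes "is_poly f" "is_poly g" "\<And>s. s \<in> S \<Longrightarrow> f s * g s = 0" "infinite S"
  shows "(\<forall>s. f s = 0) \<or> (\<forall>s. g s = 0)"
proof (rule ccontr)
  assume "\<not> ?thesis"
  then have "finite {s. f s = 0}" "finite {s. g s = 0}"
    using is_poly_finite_zeros assms by blast+
  then have "finite ({s. f s = 0} \<union> {s. g s = 0})" by simp
  moreover have "S \<subseteq> {s. f s = 0} \<union> {s. g s = 0}" using assms by auto
  ultimately show False using assms(4) finite_subset by blast
qed

text \<open>
  This turns statements about polynomial functions along a one-parameter family into statements
  about polynomials in one variable, which have finitely many zeros.
\<close>

lemma polynomial_function_along: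
  assumes "p \<in> polynomial_functions C" "\<And>u. u \<in> C \<Longrightarrow> is_poly (\<lambda>s. u (x s))"
  shows "is_poly (\<lambda>s. p (x s))"
  using assms(1) by induction (auto intro: is_poly_intros assms(2))

section \<open>Differentials of polynomial functions on the space of tuples\<close>

lemma M_add: "v \<in> M d \<Longrightarrow> w \<in> M d \<Longrightarrow> v + w \<in> M d"
  and M_tscale: "v \<in> M d \<Longrightarrow> tscale a v \<in> M d"
  and M_0: "0 \<in> M d"
  by (auto simp: M_def tscale_def intro: degree_add_le order_trans[OF degree_smult_le])

lemma M_coeff: "x \<in> M d \<Longrightarrow> k > d \<Longrightarrow> coeff (x $ i) k = 0"
  by (metis (mono_tags, lifting) M_def coeff_eq_0 le_less_trans mem_Collect_eq)

lemma tscale_nth [simp]: "tscale a c $ i = smult a (c $ i)"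
  by (simp add: tscale_def)

lemma differential_cong:
  assumes "\<And>x. x \<in> M d \<Longrightarrow> g x = h x" "c \<in> M d" "v \<in> M d"
  shows "differential g c v = differential h c v"
  unfolding differential_def using assms M_add M_tscale by simp

definition tangent_curve :: "(complex \<Rightarrow> tuple) \<Rightarrow> tuple \<Rightarrow> bool" where
  "tangent_curve \<gamma> v \<longleftrightarrow>
     (\<forall>i k. ((\<lambda>s. coeff (\<gamma> s $ i) k) has_field_derivative coeff (v $ i) k) (at 0))"

lemma tangent_curve_line: "tangent_curve (\<lambda>s. c + tscale s v) v"
  unfolding tangent_curve_def by (auto intro!: derivative_eq_intros)

text \<open>
  The chain rule. By induction on \<open>g\<close>, the derivative of \<open>g\<close> along a curve depends only on the point and
  the velocity, so it can be computed along the straight line that defines \<open>differential\<close>.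
\<close>

lemma has_differential:
  assumes "g \<in> polynomial_functions M_coords" "tangent_curve \<gamma> v"
  shows "((\<lambda>s. g (\<gamma> s)) has_field_derivative differential g (\<gamma> 0) v) (at 0)"
proof -
  have "\<exists>L. \<forall>\<gamma>. \<gamma> 0 = c \<longrightarrow> tangent_curve \<gamma> v \<longrightarrow> ((\<lambda>s. g (\<gamma> s)) has_field_derivative L) (at 0)" for c
    using assms(1)
  proof induction
    case (const a)
    then show ?case by (intro exI[of _ 0]) auto
  next
    case (coord u)
    then obtain i k where "u = (\<lambda>c. coeff (c $ i) k)" by (auto simp: M_coords_def)
    then show ?case by (intro exI[of _ "coeff (v $ i) k"]) (auto simp: tangent_curve_def)
  next
    case (add p q)
    then obtain K L where
      "\<And>\<gamma>. \<gamma> 0 = c \<Longrightarrow> tangent_curve \<gamma> v \<Longrightarrow> ((\<lambda>s. p (\<gamma> s)) has_field_derivative K) (at 0)"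
      "\<And>\<gamma>. \<gamma> 0 = c \<Longrightarrow> tangent_curve \<gamma> v \<Longrightarrow> ((\<lambda>s. q (\<gamma> s)) has_field_derivative L) (at 0)"
      by blast
    then show ?case by (intro exI[of _ "K + L"]) (auto intro: DERIV_add)
  next
    case (mult p q)
    then obtain K L where
      "\<And>\<gamma>. \<gamma> 0 = c \<Longrightarrow> tangent_curve \<gamma> v \<Longrightarrow> ((\<lambda>s. p (\<gamma> s)) has_field_derivative K) (at 0)"
      "\<And>\<gamma>. \<gamma> 0 = c \<Longrightarrow> tangent_curve \<gamma> v \<Longrightarrow> ((\<lambda>s. q (\<gamma> s)) has_field_derivative L) (at 0)"
      by blast
    then show ?case by (intro exI[of _ "K * q c + L * p c"]) (auto dest: DERIV_mult)
  qed
  then obtain L where L: "\<And>\<delta>. \<delta> 0 = \<gamma> 0 \<Longrightarrow> tangent_curve \<delta> v \<Longrightarrow>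
      ((\<lambda>s. g (\<delta> s)) has_field_derivative L) (at 0)" by metis
  have "((\<lambda>s. g (\<gamma> 0 + tscale s v)) has_field_derivative L) (at 0)"
    by (rule L) (auto simp: tangent_curve_line vec_eq_iff)
  then have "differential g (\<gamma> 0) v = L" unfolding differential_def by (rule DERIV_imp_deriv)
  then show ?thesis using L[OF refl assms(2)] by simp
qed

lemma has_differential_line:
  assumes "g \<in> polynomial_functions M_coords"
  shows "((\<lambda>s. g (c + tscale s v)) has_field_derivative differential g c v) (at 0)"
proof -
  have "c + tscale 0 v = c" by (simp add: vec_eq_iff)
  then show ?thesis using has_differential[OF assms tangent_curve_line[of c v]] by simp
qed

lemma differential_const: "differential (\<lambda>_. a) c v = 0"
  by (simp add: differential_def)

lemma differential_coord: "differential (\<lambda>c. coeff (c $ i) k) c v = coeff (v $ i) k"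
  unfolding differential_def by (rule DERIV_imp_deriv) (auto intro!: derivative_eq_intros)

lemma differential_add:
  assumes "p \<in> polynomial_functions M_coords" "q \<in> polynomial_functions M_coords"
  shows "differential (\<lambda>x. p x + q x) c v = differential p c v + differential q c v"
  unfolding differential_def[of "\<lambda>x. p x + q x"]
  by (rule DERIV_imp_deriv) (intro DERIV_add has_differential_line assms)

lemma differential_mult:
  assumes "p \<in> polynomial_functions M_coords" "q \<in> polynomial_functions M_coords"
  shows "differential (\<lambda>x. p x * q x) c v = p c * differential q c v + differential p c v * q c"
proof -
  have "c + tscale 0 v = c" by (simp add: vec_eq_iff)
  then show ?thesis
    unfolding differential_def[of "\<lambda>x. p x * q x"]
    using DERIV_mult[OF has_differential_line[OF assms(1), of c v] has_differential_line[OF assms(2), of c v]]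
    by (intro DERIV_imp_deriv) (simp add: algebra_simps)
qed

lemma differential_cmult:
  assumes "p \<in> polynomial_functions M_coords"
  shows "differential (\<lambda>x. a * p x) c v = a * differential p c v"
  using differential_mult[OF polynomial_functions.const assms] by (simp add: differential_const)

lemma differential_diff:
  assumes "p \<in> polynomial_functions M_coords" "q \<in> polynomial_functions M_coords"
  shows "differential (\<lambda>x. p x - q x) c v = differential p c v - differential q c v"
  using differential_add[OF assms(1) pf_uminus[OF assms(2)]] differential_cmult[OF assms(2), of "-1"]
  by simp

lemma differential_add_vector:
  assumes "g \<in> polynomial_functions M_coords"
  shows "differential g c (v + w) = differential g c v + differential g c w"
  using assms
  by induction (auto simp: M_coords_def differential_const differential_coord differential_add
      differential_mult algebra_simps)

lemma differential_tscale:
  assumes "g \<in> polynomial_functions M_coords"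
  shows "differential g c (tscale a v) = a * differential g c v"
  using assms
  by induction (auto simp: M_coords_def differential_const differential_coord differential_add
      differential_mult algebra_simps)

lemma differential_along_polynomial_field:
  assumes g: "g \<in> polynomial_functions M_coords"
    and X: "\<And>i k. (\<lambda>c. coeff (X c $ i) k) \<in> polynomial_functions M_coords"
  shows "(\<lambda>c. differential g c (X c)) \<in> polynomial_functions M_coords"
  using g
proof induction
  case (coord u)
  then obtain i k where "u = (\<lambda>c. coeff (c $ i) k)" by (auto simp: M_coords_def)
  then show ?case using X by (simp add: differential_coord)
qed (auto simp: differential_const differential_add differential_mult
    intro!: polynomial_functions.const polynomial_functions.add polynomial_functions.mult)

section \<open>Polynomial functions over a countable ring\<close>

text \<open>
  Used for the subring generated by a set of numbers, for polynomials over a countable ring and for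
  monomials; all three are countable for the same reason.
\<close>

inductive_set closure2 :: "('a \<Rightarrow> 'a \<Rightarrow> 'a) \<Rightarrow> ('a \<Rightarrow> 'a \<Rightarrow> 'a) \<Rightarrow> 'a set \<Rightarrow> 'a set"
  for f g A where
  base: "a \<in> A \<Longrightarrow> a \<in> closure2 f g A"
| left: "a \<in> closure2 f g A \<Longrightarrow> b \<in> closure2 f g A \<Longrightarrow> f a b \<in> closure2 f g A"
| right: "a \<in> closure2 f g A \<Longrightarrow> b \<in> closure2 f g A \<Longrightarrow> g a b \<in> closure2 f g A"

lemma countable_closure2:
  assumes "countable A"
  shows "countable (closure2 f g A)"
proof -
  define step where "step B = B \<union> (\<lambda>(a, b). f a b) ` (B \<times> B) \<union> (\<lambda>(a, b). g a b) ` (B \<times> B)" for B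
  define U where "U n = (step ^^ n) A" for n
  have c: "countable (U n)" for n
    by (induction n) (auto simp: U_def step_def assms)
  have S: "U (Suc n) = step (U n)" for n by (simp add: U_def)
  have mono: "U m \<subseteq> U n" if "m \<le> n" for m n
    using that by (rule lift_Suc_mono_le[rotated]) (auto simp: S step_def)
  have "x \<in> (\<Union>n. U n)" if "x \<in> closure2 f g A" for x
    using that
  proof induction
    case (base a)
    then show ?case by (auto simp: U_def intro!: exI[of _ 0])
  next
    case (left a b)
    then obtain m n where "a \<in> U m" "b \<in> U n" by blast
    then have "a \<in> U (max m n)" "b \<in> U (max m n)" using mono by (meson max.cobounded1 max.cobounded2 subsetD)+
    then have "f a b \<in> U (Suc (max m n))" by (force simp: S step_def)
    then show ?case by blast
  next
    case (right a b)
    then obtain m n where "a \<in> U m" "b \<in> U n" by blast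
    then have "a \<in> U (max m n)" "b \<in> U (max m n)" using mono by (meson max.cobounded1 max.cobounded2 subsetD)+
    then have "g a b \<in> U (Suc (max m n))" by (force simp: S step_def)
    then show ?case by blast
  qed
  then have "closure2 f g A \<subseteq> (\<Union>n. U n)" by blast
  then show ?thesis using c countable_subset countable_UN[of UNIV U] by blast
qed

lemma countable_subring:
  assumes "countable (A :: complex set)"
  shows "\<exists>k. A \<subseteq> k \<and> countable k \<and> subring_set k"
proof -
  let ?k = "closure2 (-) (*) (insert 1 A)"
  have "subring_set ?k" unfolding subring_set_def by (auto intro: closure2.intros)
  moreover have "countable ?k" using assms by (intro countable_closure2) auto
  ultimately show ?thesis by (intro exI[of _ ?k]) (auto intro: closure2.base)
qed

inductive_set polys_over :: "complex set \<Rightarrow> ('x \<Rightarrow> complex) set \<Rightarrow> ('x \<Rightarrow> complex) set"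
  for k C where
  const: "a \<in> k \<Longrightarrow> (\<lambda>_. a) \<in> polys_over k C"
| coord: "u \<in> C \<Longrightarrow> u \<in> polys_over k C"
| add: "p \<in> polys_over k C \<Longrightarrow> q \<in> polys_over k C \<Longrightarrow> (\<lambda>x. p x + q x) \<in> polys_over k C"
| mult: "p \<in> polys_over k C \<Longrightarrow> q \<in> polys_over k C \<Longrightarrow> (\<lambda>x. p x * q x) \<in> polys_over k C"

lemma countable_polys_over:
  assumes "countable k" "countable C"
  shows "countable (polys_over k C)"
proof -
  let ?U = "closure2 (\<lambda>p q x. p x + q x) (\<lambda>p q x. p x * q x) ((\<lambda>a _. a) ` k \<union> C)"
  have "p \<in> ?U" if "p \<in> polys_over k C" for p
    using that
  proof induction
    case (add p q)
    then show ?case using closure2.left[of p "\<lambda>p q x. p x + q x"] by fast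
  next
    case (mult p q)
    then show ?case using closure2.right[of p _ "\<lambda>p q x. p x * q x"] by fast
  qed (auto intro: closure2.base)
  moreover have "countable ?U" using assms by (intro countable_closure2) auto
  ultimately show ?thesis by (meson countable_subset subsetI)
qed

lemma polys_over_pf: "p \<in> polys_over k C \<Longrightarrow> p \<in> polynomial_functions C"
  by (induction rule: polys_over.induct) (auto intro: polynomial_functions.intros)

lemma polys_over_more:
  assumes "subring_set k"
  shows "p \<in> polys_over k C \<Longrightarrow> q \<in> polys_over k C \<Longrightarrow> (\<lambda>x. p x - q x) \<in> polys_over k C"
    "(\<And>i. i \<in> A \<Longrightarrow> F i \<in> polys_over k C) \<Longrightarrow> (\<lambda>x. \<Sum>i\<in>A. F i x) \<in> polys_over k C"
    "(\<And>i. i \<in> A \<Longrightarrow> F i \<in> polys_over k C) \<Longrightarrow> (\<lambda>x. \<Prod>i\<in>A. F i x) \<in> polys_over k C"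
    "p \<in> polys_over k C \<Longrightarrow> (\<lambda>x. p x ^ n) \<in> polys_over k C"
proof -
  have m1: "(\<lambda>_. - 1) \<in> polys_over k C" using assms by (intro polys_over.const subring_setD)
  show "(\<lambda>x. p x - q x) \<in> polys_over k C" if "p \<in> polys_over k C" "q \<in> polys_over k C"
    using polys_over.add[OF that(1) polys_over.mult[OF m1 that(2)]] by simp
  have c: "(\<lambda>_. 0) \<in> polys_over k C" "(\<lambda>_. 1) \<in> polys_over k C"
    using assms by (auto intro: polys_over.const subring_setD)
  show "(\<And>i. i \<in> A \<Longrightarrow> F i \<in> polys_over k C) \<Longrightarrow> (\<lambda>x. \<Sum>i\<in>A. F i x) \<in> polys_over k C"
    by (induction A rule: infinite_finite_induct) (auto intro: c polys_over.intros)
  show "(\<And>i. i \<in> A \<Longrightarrow> F i \<in> polys_over k C) \<Longrightarrow> (\<lambda>x. \<Prod>i\<in>A. F i x) \<in> polys_over k C"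
    by (induction A rule: infinite_finite_induct) (auto intro: c polys_over.intros)
  show "p \<in> polys_over k C \<Longrightarrow> (\<lambda>x. p x ^ n) \<in> polys_over k C"
    by (induction n) (auto intro: c polys_over.intros)
qed

definition apply_derivation :: "(complex \<Rightarrow> complex) \<Rightarrow> tuple \<Rightarrow> tuple" where
  "apply_derivation D c = (\<chi> i. map_poly D (c $ i))"

lemma coeff_apply_derivation:
  "derivation D \<Longrightarrow> coeff (apply_derivation D c $ i) k = D (coeff (c $ i) k)"
  by (simp add: apply_derivation_def coeff_map_poly derivation_rules)

lemma apply_derivation_M: "derivation D \<Longrightarrow> c \<in> M d \<Longrightarrow> apply_derivation D c \<in> M d"
  unfolding M_def
  by (auto intro!: degree_le simp: coeff_apply_derivation derivation_rules
      coeff_eq_0[OF order.strict_trans1[of "degree _" d]])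

text \<open>
  A derivation that kills the coefficients of \<open>g\<close> satisfies \<open>D (g c) = dg (D c)\<close>. This is how
  derivations of the complex numbers produce tangent vectors.
\<close>

lemma derivation_polys_over:
  assumes D: "derivation D" "\<And>a. a \<in> k \<Longrightarrow> D a = 0" and g: "g \<in> polys_over k M_coords"
  shows "D (g c) = differential g c (apply_derivation D c)"
  using g
proof induction
  case (const a)
  then show ?case using D by (simp add: differential_const)
next
  case (coord u)
  then obtain i k where "u = (\<lambda>c. coeff (c $ i) k)" by (auto simp: M_coords_def)
  then show ?case using D by (simp add: differential_coord coeff_apply_derivation)
next
  case (add p q)
  then show ?case using D by (simp add: differential_add derivation_rules polys_over_pf)
next
  case (mult p q)
  then show ?case using D by (simp add: differential_mult derivation_rules polys_over_pf)
qed

section \<open>Dimension counts\<close>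

context vector_space begin

lemma independent_family:
  assumes J: "finite J"
    and ind: "\<And>l. (\<Sum>j\<in>J. scale (l j) (w j)) = 0 \<Longrightarrow> \<forall>j\<in>J. l j = 0"
  shows "inj_on w J" "independent (w ` J)"
proof -
  show inj: "inj_on w J"
  proof (rule inj_onI, rule ccontr)
    fix i j assume ij: "i \<in> J" "j \<in> J" "w i = w j" "i \<noteq> j"
    let ?l = "\<lambda>x. if x = i then 1 else if x = j then -1 else 0"
    have "(\<Sum>x\<in>J. scale (?l x) (w x)) = (\<Sum>x\<in>J. (if x = i then w i else 0) - (if x = j then w j else 0))"
      using ij by (intro sum.cong) auto
    also have "\<dots> = 0" using ij J by (simp add: sum_subtractf)
    finally show False using ind ij(1) by force
  qed
  show "independent (w ` J)"
  proof (rule independent_if_scalars_zero)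
    fix f x assume *: "(\<Sum>x\<in>w ` J. scale (f x) (x)) = 0" "x \<in> w ` J"
    have "(\<Sum>j\<in>J. scale (f (w j)) (w j)) = 0" using *(1) by (simp add: sum.reindex[OF inj])
    from ind[OF this] show "f x = 0" using *(2) by auto
  qed (use J in simp)
qed

lemma dim_lower_bound:
  assumes W: "W \<subseteq> span T" "finite T"
    and J: "finite J" "\<And>l. (\<Sum>j\<in>J. scale (l j) (w j)) = 0 \<Longrightarrow> \<forall>j\<in>J. l j = 0" "w ` J \<subseteq> W"
  shows "card J \<le> dim W"
proof -
  obtain B where B: "B \<subseteq> W" "independent B" "W \<subseteq> span B" "card B = dim W"
    using basis_exists by blast
  have "finite B" using independent_span_bound[OF W(2) B(2)] B(1) W(1) by blast
  then have "card (w ` J) \<le> card B"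
    using independent_span_bound[OF _ independent_family(2)[OF J(1,2)]] J(3) B(3) by blast
  then show ?thesis using B(4) card_image[OF independent_family(1)[OF J(1,2)]] by simp
qed

text \<open>
  A basis of \<open>W\<close> together with vectors that are independent modulo \<open>W\<close> is independent.
\<close>

lemma dim_upper_bound:
  assumes W: "subspace W" "W \<subseteq> span T" "finite T"
    and I: "finite I" "v ` I \<subseteq> span T"
    and ind: "\<And>a. (\<Sum>i\<in>I. scale (a i) (v i)) \<in> W \<Longrightarrow> \<forall>i\<in>I. a i = 0"
  shows "dim W + card I \<le> card T"
proof -
  obtain B where B: "B \<subseteq> W" "independent B" "W \<subseteq> span B" "card B = dim W"
    using basis_exists by blast
  have fB: "finite B" using independent_span_bound[OF W(3) B(2)] B(1) W(2) by blast
  let ?w = "\<lambda>x. case x of Inl b \<Rightarrow> b | Inr i \<Rightarrow> v i"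
  have ind_w: "\<forall>j\<in>B <+> I. l j = 0" if "(\<Sum>j\<in>B <+> I. scale (l j) (?w j)) = 0" for l
  proof -
    have e: "(\<Sum>b\<in>B. scale (l (Inl b)) (b)) + (\<Sum>i\<in>I. scale (l (Inr i)) (v i)) = 0"
      using that fB I(1) by (simp add: sum.Plus)
    then have "(\<Sum>i\<in>I. scale (l (Inr i)) (v i)) = - (\<Sum>b\<in>B. scale (l (Inl b)) (b))"
      by (simp add: add_eq_0_iff)
    also have "\<dots> \<in> W"
      using B(1) by (intro subspace_neg[OF W(1)] subspace_sum[OF W(1)] subspace_scale[OF W(1)]) auto
    finally have i: "\<forall>i\<in>I. l (Inr i) = 0" by (rule ind)
    then have "(\<Sum>b\<in>B. scale (l (Inl b)) (b)) = 0" using e by simp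
    then have "\<forall>b\<in>B. l (Inl b) = 0" using independentD[OF B(2) fB order.refl, of "\<lambda>b. l (Inl b)"] by blast
    then show ?thesis using i by auto
  qed
  have "inj_on ?w (B <+> I)" "independent (?w ` (B <+> I))"
    using independent_family[OF _ ind_w] fB I(1) by auto
  moreover have "?w ` (B <+> I) \<subseteq> span T" using B(1) W(2) I(2) by auto
  ultimately have "card (B <+> I) \<le> card T"
    using independent_span_bound[OF W(3)] by (metis card_image)
  then show ?thesis using fB I(1) B(4) by (simp add: card_Plus)
qed

end

lemma (in vector_space_pair) dim_linear_image:
  assumes f: "Vector_Spaces.linear s1 s2 f" and W: "vs1.subspace W" "W \<subseteq> vs1.span T" "finite T" and inj: "inj_on f W"
  shows "vs2.dim (f ` W) = vs1.dim W"
proof -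
  obtain B where B: "B \<subseteq> W" "vs1.independent B" "W \<subseteq> vs1.span B" "card B = vs1.dim W"
    using vs1.basis_exists by blast
  have "vs1.span B \<subseteq> W" using B(1) W(1) by (rule vs1.span_minimal)
  then have "vs1.span B = W" using B(3) by blast
  then have "vs2.independent (f ` B)"
    using linear_independent_injective_image[OF f B(2)] inj by simp
  moreover have "f ` W \<subseteq> vs2.span (f ` B)"
    using linear_span_image[OF f, of B] B(3) by blast
  ultimately have "card (f ` B) = vs2.dim (f ` W)"
    using B(1) by (intro vs2.basis_card_eq_dim) auto
  then show ?thesis using B(4) card_image[OF inj_on_subset[OF inj B(1)]] by simp
qed

global_interpretation fs: vector_space fscale
  by standard (auto simp: fscale_def algebra_simps fun_eq_iff)

global_interpretation ts: vector_space tscale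
  by standard (auto simp: vec_eq_iff smult_add_right smult_add_left)

global_interpretation ts_fs: vector_space_pair tscale fscale ..

lemma ts_subspace_M: "ts.subspace (M d)"
  by (rule ts.subspaceI) (auto intro: M_add M_tscale M_0)

definition M_basis :: "5 \<times> nat \<Rightarrow> tuple" where
  "M_basis x = axis (fst x) (monom 1 (snd x))"

lemma M_basis_combination:
  "(\<Sum>x\<in>UNIV \<times> {..d}. tscale (l x) (M_basis x)) $ i = (\<Sum>k\<le>d. monom (l (i, k)) k)"
proof -
  have "(\<Sum>x\<in>UNIV \<times> {..d}. tscale (l x) (M_basis x)) $ i
      = (\<Sum>j\<in>UNIV. \<Sum>k\<le>d. smult (l (j, k)) (axis j (monom 1 k) $ i))"
    by (simp add: sum.cartesian_product M_basis_def case_prod_unfold)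
  also have "\<dots> = (\<Sum>j\<in>UNIV. if j = i then \<Sum>k\<le>d. monom (l (i, k)) k else 0)"
    by (intro sum.cong) (auto simp: axis_def smult_monom)
  finally show ?thesis by simp
qed

lemma M_basis_in_M: "M_basis ` (UNIV \<times> {..d}) \<subseteq> M d"
  by (auto simp: M_def M_basis_def axis_def degree_monom_eq)

lemma M_basis_independent:
  assumes "(\<Sum>x\<in>UNIV \<times> {..d}. tscale (l x) (M_basis x)) = 0"
  shows "\<forall>x\<in>UNIV \<times> {..d}. l x = 0"
proof
  fix x :: "5 \<times> nat" assume x: "x \<in> UNIV \<times> {..d}"
  obtain i k where [simp]: "x = (i, k)" by (cases x)
  have "coeff (\<Sum>k\<le>d. monom (l (i, k)) k) k = 0"
    using assms M_basis_combination[of l d i] by simp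
  then show "l x = 0" using x by (simp add: coeff_sum)
qed

lemma M_basis_family:
  "inj_on M_basis (UNIV \<times> {..d})" "ts.independent (M_basis ` (UNIV \<times> {..d}))"
  using ts.independent_family[where w = M_basis, OF _ M_basis_independent] by auto

lemma M_span: "M d = ts.span (M_basis ` (UNIV \<times> {..d}))"
proof
  show "ts.span (M_basis ` (UNIV \<times> {..d})) \<subseteq> M d"
    using M_basis_in_M ts_subspace_M by (rule ts.span_minimal)
  show "M d \<subseteq> ts.span (M_basis ` (UNIV \<times> {..d}))"
  proof
    fix c assume "c \<in> M d"
    then have "c = (\<Sum>x\<in>UNIV \<times> {..d}. tscale (coeff (c $ fst x) (snd x)) (M_basis x))"
      unfolding vec_eq_iff M_basis_combination
      by (auto simp: M_def poly_as_sum_of_monoms')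
    also have "\<dots> \<in> ts.span (M_basis ` (UNIV \<times> {..d}))"
      by (intro ts.span_sum ts.span_scale ts.span_base) auto
    finally show "c \<in> ts.span (M_basis ` (UNIV \<times> {..d}))" .
  qed
qed

lemma card_M_basis: "card (M_basis ` (UNIV \<times> {..d})) = 5 * d + 5"
  using card_image[OF M_basis_family(1)[of d]]
  by (simp add: card_cartesian_product)

lemma dim_M: "ts.dim (M d) = 5 * d + 5"
  using ts.dim_span_eq_card_independent[OF M_basis_family(2)[of d]]
  by (simp add: card_M_basis flip: M_span)

section \<open>Minors\<close>

text \<open>
  The Leibniz formula over an arbitrary finite set of indices, which is the form in which \<open>omega\<close> is
  defined and in which passing to submatrices is just passing to subsets.
\<close>

definition minor :: "nat set \<Rightarrow> (nat \<Rightarrow> nat \<Rightarrow> complex) \<Rightarrow> complex" where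
  "minor R a = (\<Sum>\<pi> | \<pi> permutes R. of_int (sign \<pi>) * (\<Prod>i\<in>R. a i (\<pi> i)))"

text \<open>
  The factor of \<open>a i j\<close> in the Leibniz formula, obtained by keeping the permutations that
  send \<open>i\<close> to \<open>j\<close>; the sign is part of the permutation.
\<close>

definition cofactor :: "nat set \<Rightarrow> (nat \<Rightarrow> nat \<Rightarrow> complex) \<Rightarrow> nat \<Rightarrow> nat \<Rightarrow> complex" where
  "cofactor R a i j =
     (\<Sum>\<pi> | \<pi> permutes R \<and> \<pi> i = j. of_int (sign \<pi>) * (\<Prod>l\<in>R - {i}. a l (\<pi> l)))"

lemma minor_expand_column:
  assumes R: "finite R" "j \<in> R"
  shows "minor R a = (\<Sum>i\<in>R. a i j * cofactor R a i j)"
proof -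
  let ?t = "\<lambda>\<pi>. of_int (sign \<pi>) * (\<Prod>i\<in>R. a i (\<pi> i)) :: complex"
  have fin: "finite {\<pi>. \<pi> permutes R}" using R by (simp add: finite_permutations)
  have "(\<Sum>\<pi> | \<pi> permutes R. ?t \<pi>) = (\<Sum>i\<in>R. \<Sum>\<pi> | \<pi> \<in> {\<pi>. \<pi> permutes R} \<and> inv \<pi> j = i. ?t \<pi>)"
    using R fin by (intro sum.group[symmetric]) (auto simp: permutes_in_image permutes_inv)
  also have "\<dots> = (\<Sum>i\<in>R. a i j * cofactor R a i j)"
  proof (rule sum.cong[OF refl])
    fix i assume i: "i \<in> R"
    have "{\<pi>. \<pi> \<in> {\<pi>. \<pi> permutes R} \<and> inv \<pi> j = i} = {\<pi>. \<pi> permutes R \<and> \<pi> i = j}"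
      by (auto simp: permutes_inverses permutes_inv_eq)
    then show "(\<Sum>\<pi> | \<pi> \<in> {\<pi>. \<pi> permutes R} \<and> inv \<pi> j = i. ?t \<pi>) = a i j * cofactor R a i j"
      unfolding cofactor_def sum_distrib_left
      using R i by (intro sum.cong) (auto simp: prod.remove[of R i])
  qed
  finally show ?thesis unfolding minor_def .
qed

lemma cofactor_cong:
  assumes "\<And>l m. l \<in> R - {i} \<Longrightarrow> m \<in> R - {j} \<Longrightarrow> a l m = b l m" "i \<in> R"
  shows "cofactor R a i j = cofactor R b i j"
  unfolding cofactor_def
proof (intro sum.cong arg_cong2[where f = "(*)"] prod.cong refl)
  fix \<pi> l assume "\<pi> \<in> {\<pi>. \<pi> permutes R \<and> \<pi> i = j}" "l \<in> R - {i}"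
  then have "\<pi> l \<in> R - {j}"
    by (auto simp: permutes_in_image dest: permutes_inj injD)
  then show "a l (\<pi> l) = b l (\<pi> l)" using assms \<open>l \<in> R - {i}\<close> by blast
qed

lemma cofactor_insert:
  assumes "i \<notin> R" "finite R"
  shows "cofactor (insert i R) a i i = minor R a"
proof -
  have "{\<pi>. \<pi> permutes insert i R \<and> \<pi> i = i} = {\<pi>. \<pi> permutes R}"
    using assms permutes_superset[of _ "insert i R" R]
    by (auto simp: permutes_not_in intro: permutes_subset)
  then show ?thesis unfolding cofactor_def minor_def using assms by simp
qed

text \<open>
  The transposition of the two columns changes the sign of every term and no product.
\<close>

lemma minor_equal_columns:
  assumes R: "finite R" "j \<in> R" "k \<in> R" "j \<noteq> k" and eq: "\<And>i. i \<in> R \<Longrightarrow> a i j = a i k"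
  shows "minor R a = 0"
proof -
  let ?\<tau> = "Transposition.transpose j k"
  let ?t = "\<lambda>\<pi>. of_int (sign \<pi>) * (\<Prod>i\<in>R. a i (\<pi> i)) :: complex"
  have \<tau>: "?\<tau> permutes R" using R by (simp add: permutes_swap_id)
  have "minor R a = (\<Sum>\<pi> | \<pi> permutes R. ?t (?\<tau> \<circ> \<pi>))"
    unfolding minor_def by (rule setum_permutations_compose_left[OF \<tau>])
  also have "\<dots> = (\<Sum>\<pi> | \<pi> permutes R. - ?t \<pi>)"
  proof (rule sum.cong[OF refl])
    fix \<pi> assume "\<pi> \<in> {\<pi>. \<pi> permutes R}"
    then have \<pi>: "\<pi> permutes R" by simp
    have "sign (?\<tau> \<circ> \<pi>) = - sign \<pi>"
      using R \<pi> \<tau> by (subst sign_compose) (auto simp: sign_swap_id permutation_permutes)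
    moreover have "a i ((?\<tau> \<circ> \<pi>) i) = a i (\<pi> i)" if "i \<in> R" for i
      using eq[OF that] by (auto simp: Transposition.transpose_def)
    ultimately show "?t (?\<tau> \<circ> \<pi>) = - ?t \<pi>" by simp
  qed
  also have "\<dots> = - minor R a" by (simp add: minor_def sum_negf)
  finally show ?thesis by simp
qed

text \<open>
  Expanding along column \<open>j\<close> shows that the minor is linear in that column. Replacing it by the
  vanishing combination of all columns gives \<open>l j\<close> times the minor, because the other
  replacements create equal columns.
\<close>

lemma minor_dependent_columns:
  assumes R: "finite R" and dep: "\<And>i. i \<in> R \<Longrightarrow> (\<Sum>j\<in>R. a i j * l j) = 0"
    and j: "j \<in> R" "l j \<noteq> 0"
  shows "minor R a = 0"
proof -
  define b where "b k = (\<lambda>i m. if m = j then a i k else a i m)" for k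
  have mb: "minor R (b k) = (\<Sum>i\<in>R. a i k * cofactor R a i j)" for k
  proof -
    have "minor R (b k) = (\<Sum>i\<in>R. b k i j * cofactor R (b k) i j)"
      using minor_expand_column[OF R j(1)] .
    also have "\<dots> = (\<Sum>i\<in>R. a i k * cofactor R a i j)"
      by (intro sum.cong arg_cong2[where f = "(*)"] cofactor_cong refl) (auto simp: b_def)
    finally show ?thesis .
  qed
  have 0: "minor R (b k) = 0" if "k \<in> R - {j}" for k
    using that j R by (intro minor_equal_columns[of R j k]) (auto simp: b_def)
  have "b j = a" by (auto simp: b_def fun_eq_iff)
  have "l j * minor R a = (\<Sum>k\<in>R. l k * minor R (b k))"
    using R j 0 \<open>b j = a\<close> by (subst sum.remove[of R j]) auto
  also have "\<dots> = (\<Sum>k\<in>R. \<Sum>i\<in>R. l k * a i k * cofactor R a i j)"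
    by (simp add: mb sum_distrib_left mult.assoc)
  also have "\<dots> = (\<Sum>i\<in>R. (\<Sum>k\<in>R. a i k * l k) * cofactor R a i j)"
    by (subst sum.swap) (simp add: sum_distrib_right mult.commute[of "l _"])
  also have "\<dots> = 0" using dep by simp
  finally show ?thesis using j by simp
qed

lemma minor_transpose:
  assumes "finite R"
  shows "minor R (\<lambda>i j. a j i) = minor R a"
proof -
  have "minor R (\<lambda>i j. a j i) = (\<Sum>\<pi> | \<pi> permutes R. of_int (sign (inv \<pi>)) * (\<Prod>i\<in>R. a (inv \<pi> i) i))"
    unfolding minor_def by (rule sum_permutations_inverse)
  also have "\<dots> = minor R a"
    unfolding minor_def
  proof (rule sum.cong[OF refl])
    fix \<pi> assume "\<pi> \<in> {\<pi>. \<pi> permutes R}"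
    then have \<pi>: "\<pi> permutes R" by simp
    have "(\<Prod>i\<in>R. a (inv \<pi> i) i) = (\<Prod>i\<in>R. a (inv \<pi> (\<pi> i)) (\<pi> i))"
      using prod.permute[OF \<pi>, of "\<lambda>i. a (inv \<pi> i) i"] by (simp add: o_def)
    then have "(\<Prod>i\<in>R. a (inv \<pi> i) i) = (\<Prod>i\<in>R. a i (\<pi> i))"
      using permutes_inverses(2)[OF \<pi>] by simp
    moreover have "sign (inv \<pi>) = sign \<pi>" using \<pi> assms by (intro sign_inverse) (auto simp: permutation_permutes)
    ultimately show "of_int (sign (inv \<pi>)) * (\<Prod>i\<in>R. a (inv \<pi> i) i) = of_int (sign \<pi>) * (\<Prod>i\<in>R. a i (\<pi> i))"
      by simp
  qed
  finally show ?thesis .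
qed

lemma minor_dependent_rows:
  assumes R: "finite R" and dep: "\<And>j. j \<in> R \<Longrightarrow> (\<Sum>i\<in>R. l i * a i j) = 0"
    and i: "i \<in> R" "l i \<noteq> 0"
  shows "minor R a = 0"
proof -
  have "minor R (\<lambda>i j. a j i) = 0"
    using dep i by (intro minor_dependent_columns[OF R, of _ l i]) (simp_all add: mult.commute)
  then show ?thesis unfolding minor_transpose[OF R, of a] .
qed

lemma minor_regular:
  assumes "\<And>i j. i \<in> R \<Longrightarrow> j \<in> R \<Longrightarrow> (\<lambda>x. a x i j) \<in> regular C X"
  shows "(\<lambda>x. minor R (a x)) \<in> regular C X"
  unfolding minor_def using assms
  by (intro regular_sum regular_cmult regular_prod) (auto simp: permutes_in_image)

lemma cofactor_regular:
  assumes "\<And>l m. l \<in> R - {i} \<Longrightarrow> m \<in> R - {j} \<Longrightarrow> (\<lambda>x. a x l m) \<in> regular C X" "i \<in> R"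
  shows "(\<lambda>x. cofactor R (a x) i j) \<in> regular C X"
  unfolding cofactor_def
proof (intro regular_sum regular_cmult regular_prod assms(1))
  fix \<pi> l assume "\<pi> \<in> {\<pi>. \<pi> permutes R \<and> \<pi> i = j}" "l \<in> R - {i}"
  then show "\<pi> l \<in> R - {j}" by (auto simp: permutes_in_image dest: permutes_inj injD)
qed

lemma omega_minor: "omega d f0 f1 f2 t c v = minor {3..5*d+1} (\<lambda>i j. phi f0 f1 f2 t i c (v j))"
  by (simp add: omega_def minor_def)

section \<open>Quintics along a curve\<close>

lemma form_eval_scale: "form_eval m F (s *s x) = s ^ m * form_eval m F x"
proof -
  have "(\<Prod>i\<in>UNIV. (s * x $ i) ^ e i) = s ^ m * (\<Prod>i\<in>UNIV. (x $ i) ^ e i)"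
    if "e \<in> exponents m" for e :: "5 \<Rightarrow> nat"
    using that by (simp add: exponents_def power_mult_distrib prod.distrib flip: power_sum)
  then show ?thesis by (simp add: form_eval_def sum_distrib_left mult_ac)
qed

lemma form_eval_linear:
  "form_eval m (\<lambda>e. a * F e + b * G e) x = a * form_eval m F x + b * form_eval m G x"
  by (simp add: form_eval_def sum_distrib_left sum.distrib algebra_simps)

lemma forms_linear: "F \<in> forms m \<Longrightarrow> G \<in> forms m \<Longrightarrow> (\<lambda>e. a * F e + b * G e) \<in> forms m"
  by (simp add: forms_def)

lemma finite_exponents: "finite (exponents m)"
proof (rule finite_subset)
  show "exponents m \<subseteq> UNIV \<rightarrow>\<^sub>E {..m}"
    by (auto simp: exponents_def PiE_iff intro: member_le_sum)
qed (auto intro: finite_PiE)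

lemma poly_pullback: "poly (pullback f c) t = form_eval 5 f (affine_value c t)"
  by (simp add: pullback_def form_eval_def affine_value_def poly_sum poly_prod)

lemma hom_value_affine: "c \<in> M d \<Longrightarrow> hom_value d c t 1 = affine_value c t"
  by (auto simp: hom_value_def affine_value_def vec_eq_iff M_def poly_altdef
      intro!: sum.mono_neutral_right coeff_eq_0)

lemma hom_value_scale: "hom_value d c (s * x) (s * y) = s ^ d *s hom_value d c x y"
proof -
  have "s ^ k * s ^ (d - k) = s ^ d" if "k \<le> d" for k using that by (simp flip: power_add)
  then have "a * (s * x) ^ k * (s * y) ^ (d - k) = s ^ d * (a * x ^ k * y ^ (d - k))" if "k \<le> d" for a k
    using that by (simp add: power_mult_distrib mult_ac)
  then show ?thesis
    unfolding hom_value_def vec_eq_iff vector_smult_component vec_lambda_beta sum_distrib_left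
    by (intro allI sum.cong) auto
qed

lemma hom_value_eq_affine:
  assumes "c \<in> M d" "y \<noteq> 0"
  shows "hom_value d c x y = y ^ d *s affine_value c (x / y)"
  using hom_value_scale[of d c y "x / y" 1] assms by (simp add: hom_value_affine)

lemma is_poly_hom_value:
  assumes "is_poly f" "is_poly g"
  shows "is_poly (\<lambda>s. hom_value d c (f s) (g s) $ i)"
  using assms by (simp add: hom_value_def) (intro is_poly_intros)

lemma is_poly_form_eval:
  assumes "\<And>i. is_poly (\<lambda>s. x s $ i)"
  shows "is_poly (\<lambda>s. form_eval m F (x s))"
  unfolding form_eval_def by (intro is_poly_intros assms)

lemma infinite_nonzero: "infinite (- {0 :: complex})"
  by (simp add: Compl_eq_Diff_UNIV infinite_UNIV_char_0)

text \<open>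
  At points \<open>(x, y)\<close> with \<open>y \<noteq> 0\<close> this is homogeneity; the point at infinity follows because a
  polynomial in \<open>y\<close> that vanishes for all \<open>y \<noteq> 0\<close> vanishes at 0.
\<close>

lemma pullback_zero_hom:
  assumes "c \<in> M d" "pullback f c = 0"
  shows "form_eval 5 f (hom_value d c x y) = 0"
proof (rule is_poly_zero[of "\<lambda>y. form_eval 5 f (hom_value d c x y)" "- {0}" y])
  show "is_poly (\<lambda>y. form_eval 5 f (hom_value d c x y))"
    by (intro is_poly_form_eval is_poly_hom_value is_poly_intros)
  show "form_eval 5 f (hom_value d c x s) = 0" if "s \<in> - {0}" for s
    using assms that poly_pullback[of f c "x / s"]
    by (simp add: hom_value_eq_affine form_eval_scale)
qed (rule infinite_nonzero)

lemma pullback_zeroI: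
  "(\<And>t. form_eval 5 f (affine_value c t) = 0) \<Longrightarrow> pullback f c = 0"
  using poly_eq_poly_eq_iff[of "pullback f c" 0] by (simp add: fun_eq_iff poly_pullback)

lemma degree_pullback:
  assumes "c \<in> M d"
  shows "degree (pullback f c) \<le> 5 * d"
  unfolding pullback_def
proof (intro degree_sum_le finite_exponents order_trans[OF degree_smult_le])
  fix e :: "5 \<Rightarrow> nat" assume e: "e \<in> exponents 5"
  have "degree (\<Prod>i\<in>UNIV. (c $ i) ^ e i) \<le> (\<Sum>i\<in>UNIV. degree ((c $ i) ^ e i))"
    by (rule degree_prod_sum_le[OF finite, unfolded o_def])
  also have "\<dots> \<le> (\<Sum>i\<in>UNIV. d * e i)"
    using assms by (intro sum_mono order_trans[OF degree_power_le]) (simp add: M_def)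
  also have "\<dots> = 5 * d" using e by (simp add: exponents_def flip: sum_distrib_left)
  finally show "degree (\<Prod>i\<in>UNIV. (c $ i) ^ e i) \<le> 5 * d" .
qed

section \<open>Reparametrizations\<close>

text \<open>
  The substitution \<open>(x, y) \<mapsto> (a x + b y, g x + h y)\<close> in the five binary forms of degree \<open>d\<close>. Invertible
  substitutions do not change the image curve, and they account for four of the six tangent directions.
\<close>

definition act :: "nat \<Rightarrow> complex \<Rightarrow> complex \<Rightarrow> complex \<Rightarrow> complex \<Rightarrow> tuple \<Rightarrow> tuple" where
  "act d a b g h c =
     (\<chi> i. \<Sum>k\<le>d. smult (coeff (c $ i) k) ([:b, a:] ^ k * [:h, g:] ^ (d - k)))"

lemma degree_linear_power: "degree ([:b, a:] ^ k) \<le> k" for a b :: complex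
  by (rule order_trans[OF degree_power_le]) simp

lemma act_in_M: "act d a b g h c \<in> M d"
  unfolding M_def act_def
proof (clarsimp, intro degree_sum_le finite_atMost order_trans[OF degree_smult_le])
  fix i k assume "k \<in> {..d}"
  then show "degree ([:b, a:] ^ k * [:h, g:] ^ (d - k)) \<le> d"
    using degree_linear_power[of b a k] degree_linear_power[of h g "d - k"]
    by (intro order_trans[OF degree_mult_le]) simp
qed

lemma affine_value_act: "affine_value (act d a b g h c) t = hom_value d c (a * t + b) (g * t + h)"
  by (simp add: affine_value_def act_def hom_value_def vec_eq_iff poly_sum algebra_simps)

lemma hom_value_act: "hom_value d (act d a b g h c) x y = hom_value d c (a * x + b * y) (g * x + h * y)"
proof -
  have e: "hom_value d (act d a b g h c) x s = hom_value d c (a * x + b * s) (g * x + h * s)"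
    if "s \<noteq> 0" for s
  proof -
    have "hom_value d (act d a b g h c) x s = s ^ d *s hom_value d c (a * (x / s) + b) (g * (x / s) + h)"
      using that by (simp add: hom_value_eq_affine[OF act_in_M] affine_value_act)
    also have "\<dots> = hom_value d c (s * (a * (x / s) + b)) (s * (g * (x / s) + h))"
      by (rule hom_value_scale[symmetric])
    also have "\<dots> = hom_value d c (a * x + b * s) (g * x + h * s)"
      using that by (simp add: algebra_simps)
    finally show ?thesis .
  qed
  show ?thesis
  proof (rule vec_eq_iff[THEN iffD2], rule allI)
    fix i
    have "is_poly (\<lambda>s. hom_value d (act d a b g h c) x s $ i
        - hom_value d c (a * x + b * s) (g * x + h * s) $ i)"
      by (intro is_poly_intros is_poly_hom_value)
    from is_poly_zero[OF this infinite_nonzero, of y] e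
    show "hom_value d (act d a b g h c) x y $ i = hom_value d c (a * x + b * y) (g * x + h * y) $ i"
      by simp
  qed
qed

lemma linear_substitution_nonzero:
  fixes a b g h x y :: complex
  assumes "a * h - b * g \<noteq> 0" "(x, y) \<noteq> (0, 0)"
  shows "(a * x + b * y, g * x + h * y) \<noteq> (0, 0)"
proof
  assume "(a * x + b * y, g * x + h * y) = (0, 0)"
  then have z: "a * x + b * y = 0" "g * x + h * y = 0" by auto
  have "(a * h - b * g) * x = h * (a * x + b * y) - b * (g * x + h * y)"
    "(a * h - b * g) * y = a * (g * x + h * y) - g * (a * x + b * y)"
    by (simp_all add: algebra_simps)
  then show False using z assms by auto
qed

lemma defines_map_act:
  assumes "a * h - b * g \<noteq> 0" "defines_map d c"
  shows "defines_map d (act d a b g h c)"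
  unfolding defines_map_def hom_value_act
proof (intro allI impI)
  fix x y :: complex assume "(x, y) \<noteq> (0, 0)"
  from linear_substitution_nonzero[OF assms(1) this] assms(2)
  show "hom_value d c (a * x + b * y) (g * x + h * y) \<noteq> 0"
    unfolding defines_map_def by (elim allE impE)
qed

lemma map_image_act:
  assumes D: "a * h - b * g \<noteq> 0"
  shows "map_image d (act d a b g h c) = map_image d c"
proof (rule set_eqI, rule iffI)
  fix l assume "l \<in> map_image d (act d a b g h c)"
  then obtain x y where "l = range (\<lambda>r. r *s hom_value d c (a * x + b * y) (g * x + h * y))" "(x, y) \<noteq> (0, 0)"
    unfolding map_image_def hom_value_act by blast
  with linear_substitution_nonzero[OF D this(2)] show "l \<in> map_image d c"
    unfolding map_image_def by (intro CollectI exI conjI)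
next
  fix l assume "l \<in> map_image d c"
  then obtain x y where l: "l = range (\<lambda>r. r *s hom_value d c x y)" "(x, y) \<noteq> (0, 0)"
    unfolding map_image_def by blast
  define e where "e = a * h - b * g"
  \<comment> \<open>The inverse substitution.\<close>
  define x' y' where "x' = (h / e) * x + (- b / e) * y" and "y' = (- g / e) * x + (a / e) * y"
  have "(h / e) * (a / e) - (- b / e) * (- g / e) = e / (e * e)"
    by (simp add: e_def diff_divide_distrib mult.commute)
  then have "(x', y') \<noteq> (0, 0)"
    unfolding x'_def y'_def using D l(2) by (intro linear_substitution_nonzero) (auto simp: e_def)
  moreover have "a * x' + b * y' = (a * h - b * g) / e * x" "g * x' + h * y' = (a * h - b * g) / e * y"
    by (simp_all add: x'_def y'_def algebra_simps diff_divide_distrib add_divide_distrib)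
  then have "a * x' + b * y' = x" "g * x' + h * y' = y" using D by (auto simp: e_def)
  ultimately show "l \<in> map_image d (act d a b g h c)"
    unfolding map_image_def hom_value_act using l(1)
    by (intro CollectI exI[of _ x'] exI[of _ y'] conjI) simp_all
qed

text \<open>
  The substitution acts on the parameter by a Moebius transformation \<open>\<tau>\<close>. If \<open>A / B\<close> inverts \<open>c\<close>, then the
  inverse Moebius transformation of \<open>A / B\<close>, whose numerator and denominator are again forms of degree
  \<open>m\<close>, inverts the new parametrization away from finitely many parameters.
\<close>

lemma birational_act:
  assumes c: "c \<in> M d" and D: "a * h - b * g \<noteq> 0" and bir: "birational_onto_image c"
  shows "birational_onto_image (act d a b g h c)"
proof -
  obtain m A B where AB: "A \<in> forms m" "B \<in> forms m" and
    fin: "finite {t. \<not> (form_eval m B (affine_value c t) \<noteq> 0 \<and>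
           form_eval m A (affine_value c t) = t * form_eval m B (affine_value c t))}" (is "finite ?S")
    using bir unfolding birational_onto_image_def by blast
  define A' B' where "A' = (\<lambda>e. h * A e + (- b) * B e)" and "B' = (\<lambda>e. (- g) * A e + a * B e)"
  define \<tau> where "\<tau> t = (a * t + b) / (g * t + h)" for t
  let ?c = "act d a b g h c"
  let ?good = "\<lambda>t. form_eval m B' (affine_value ?c t) \<noteq> 0 \<and>
           form_eval m A' (affine_value ?c t) = t * form_eval m B' (affine_value ?c t)"
  have good: "?good t" if t: "g * t + h \<noteq> 0" "\<tau> t \<notin> ?S" for t
  proof -
    define s where "s = ((g * t + h) ^ d) ^ m"
    define w where "w = form_eval m B (affine_value c (\<tau> t))"
    have w: "w \<noteq> 0" "form_eval m A (affine_value c (\<tau> t)) = \<tau> t * w" using t(2) by (auto simp: w_def)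
    have v: "affine_value ?c t = (g * t + h) ^ d *s affine_value c (\<tau> t)"
      using t(1) by (simp add: affine_value_act hom_value_eq_affine[OF c] \<tau>_def)
    have A': "form_eval m A' (affine_value ?c t) = s * w * (h * \<tau> t - b)"
      unfolding A'_def form_eval_linear v form_eval_scale w(2) s_def[symmetric] w_def[symmetric]
      by (simp add: algebra_simps)
    have B': "form_eval m B' (affine_value ?c t) = s * w * (a - g * \<tau> t)"
      unfolding B'_def form_eval_linear v form_eval_scale w(2) s_def[symmetric] w_def[symmetric]
      by (simp add: algebra_simps)
    have 1: "a - g * \<tau> t = (a * h - b * g) / (g * t + h)"
      and 2: "h * \<tau> t - b = t * ((a * h - b * g) / (g * t + h))"
      using t(1) by (simp_all add: \<tau>_def field_simps)
    show ?thesis unfolding A' B' 1 2 using t(1) w(1) D by (simp add: s_def)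
  qed
  have inj: "inj_on \<tau> {t. g * t + h \<noteq> 0}"
  proof (rule inj_onI)
    fix t u assume tu: "t \<in> {t. g * t + h \<noteq> 0}" "u \<in> {t. g * t + h \<noteq> 0}" "\<tau> t = \<tau> u"
    then have "(a * t + b) * (g * u + h) = (a * u + b) * (g * t + h)"
      by (simp add: \<tau>_def frac_eq_eq)
    then have "(a * h - b * g) * (t - u) = 0" by (simp add: algebra_simps)
    then show "t = u" using D by simp
  qed
  have "{t. \<not> ?good t} \<subseteq> {t. g * t + h = 0} \<union> (\<tau> -` ?S \<inter> {t. g * t + h \<noteq> 0})"
    using good by blast
  moreover have "finite {t. g * t + h = 0}"
  proof (cases "g = 0")
    case False
    then have "{t. g * t + h = 0} \<subseteq> {- h / g}" by (auto simp: field_simps add_eq_0_iff)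
    then show ?thesis using finite_subset by blast
  qed (use D in simp)
  moreover have "finite (\<tau> -` ?S \<inter> {t. g * t + h \<noteq> 0})" using fin inj by (rule finite_vimage_IntI)
  ultimately have "finite {t. \<not> ?good t}" using finite_subset by blast
  moreover have "A' \<in> forms m" "B' \<in> forms m" unfolding A'_def B'_def by (intro forms_linear AB)+
  ultimately show ?thesis unfolding birational_onto_image_def by blast
qed

lemma incidence_act:
  assumes "a * h - b * g \<noteq> 0" "(c, f) \<in> incidence d L"
  shows "(act d a b g h c, f) \<in> incidence d L"
proof -
  have c: "c \<in> M_bir d" "f \<in> L" "pullback f c = 0" using assms by (auto simp: incidence_def)
  then have M: "c \<in> M d" by (simp add: M_bir_def)
  have "pullback f (act d a b g h c) = 0"
    using pullback_zero_hom[OF M c(3)] by (intro pullback_zeroI) (simp add: affine_value_act)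
  moreover have "act d a b g h c \<in> M_bir d"
    using c(1) assms(1) M
    by (simp add: M_bir_def act_in_M defines_map_act birational_act map_image_act)
  ultimately show ?thesis using c by (simp add: incidence_def)
qed

section \<open>Infinitesimal reparametrizations\<close>

text \<open>
  The derivative at the identity of the substitutions in the direction of the matrix with rows
  \<open>(a, b)\<close> and \<open>(g, h)\<close>. In terms of the binary form \<open>c(x, y)\<close> it is
  \<open>(a x + b y) \<partial>c/\<partial>x + (g x + h y) \<partial>c/\<partial>y\<close> at \<open>y = 1\<close>, where Euler's relation gives
  \<open>\<partial>c/\<partial>y = d c - t c'\<close>.
\<close>

definition flow_velocity :: "nat \<Rightarrow> complex \<Rightarrow> complex \<Rightarrow> complex \<Rightarrow> complex \<Rightarrow> tuple \<Rightarrow> tuple" where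
  "flow_velocity d a b g h c = (\<chi> i. [:b, a:] * pderiv (c $ i) +
     [:h, g:] * (smult (of_nat d) (c $ i) - [:0, 1:] * pderiv (c $ i)))"

definition poly_tangent :: "(complex \<Rightarrow> complex poly) \<Rightarrow> complex poly \<Rightarrow> bool" where
  "poly_tangent P Q \<longleftrightarrow>
     (\<forall>n. ((\<lambda>s. coeff (P s) n) has_field_derivative coeff Q n) (at 0))"

lemma poly_tangent_mult:
  assumes "poly_tangent P Q" "poly_tangent P' Q'"
  shows "poly_tangent (\<lambda>s. P s * P' s) (P 0 * Q' + Q * P' 0)"
  unfolding poly_tangent_def coeff_mult coeff_add
proof
  fix n
  have "((\<lambda>s. coeff (P s) i * coeff (P' s) (n - i)) has_field_derivative
      coeff Q i * coeff (P' 0) (n - i) + coeff Q' (n - i) * coeff (P 0) i) (at 0)" for i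
    using assms unfolding poly_tangent_def by (intro DERIV_mult) auto
  then have "((\<lambda>s. \<Sum>i\<le>n. coeff (P s) i * coeff (P' s) (n - i)) has_field_derivative
      (\<Sum>i\<le>n. coeff Q i * coeff (P' 0) (n - i) + coeff Q' (n - i) * coeff (P 0) i)) (at 0)"
    by (intro DERIV_sum)
  then show "((\<lambda>s. \<Sum>i\<le>n. coeff (P s) i * coeff (P' s) (n - i)) has_field_derivative
      (\<Sum>i\<le>n. coeff (P 0) i * coeff Q' (n - i)) + (\<Sum>i\<le>n. coeff Q i * coeff (P' 0) (n - i))) (at 0)"
    by (simp add: sum.distrib add.commute mult.commute)
qed

lemma poly_tangent_power:
  assumes "poly_tangent P Q"
  shows "poly_tangent (\<lambda>s. P s ^ n) (of_nat n * P 0 ^ (n - 1) * Q)"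
proof (induction n)
  case 0
  then show ?case by (simp add: poly_tangent_def)
next
  case (Suc n)
  have "P 0 * (of_nat n * P 0 ^ (n - 1) * Q) + Q * P 0 ^ n = of_nat (Suc n) * P 0 ^ (Suc n - 1) * Q"
    by (cases n) (auto simp: algebra_simps)
  then show ?case using poly_tangent_mult[OF assms Suc.IH] by simp
qed

lemma poly_tangent_smult: "poly_tangent P Q \<Longrightarrow> poly_tangent (\<lambda>s. smult a (P s)) (smult a Q)"
  unfolding poly_tangent_def by (auto intro: DERIV_cmult)

lemma poly_tangent_sum:
  "(\<And>i. i \<in> A \<Longrightarrow> poly_tangent (P i) (Q i)) \<Longrightarrow> poly_tangent (\<lambda>s. \<Sum>i\<in>A. P i s) (\<Sum>i\<in>A. Q i)"
  unfolding poly_tangent_def by (auto simp: coeff_sum intro: DERIV_sum)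

lemma poly_tangent_linear: "poly_tangent (\<lambda>s. [:u + s * b, v + s * a:]) [:b, a:]"
  unfolding poly_tangent_def
  by (auto simp: coeff_pCons split: nat.split intro!: derivative_eq_intros)

text \<open>
  A straight line of matrices through the identity; it consists of invertible matrices except for at
  most two values of \<open>s\<close>, so identities that are polynomial in \<open>s\<close> can be checked on invertible ones.
\<close>

definition flow :: "nat \<Rightarrow> complex \<Rightarrow> complex \<Rightarrow> complex \<Rightarrow> complex \<Rightarrow> tuple \<Rightarrow> complex \<Rightarrow> tuple" where
  "flow d a b g h c s = act d (1 + s * a) (s * b) (s * g) (1 + s * h) c"

lemma pderiv_sum_powers:
  "pderiv (\<Sum>k\<in>A. smult (a k) ([:0, 1:] ^ k)) =
    (\<Sum>k\<in>A. smult (a k) (of_nat k * [:0, 1:] ^ (k - 1)))" for a :: "nat \<Rightarrow> complex"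
  by (induction A rule: infinite_finite_induct)
    (simp_all add: pderiv_add pderiv_smult pderiv_power pderiv_pCons of_nat_poly)

lemma smult_sum_right: "smult a (\<Sum>k\<in>A. f k) = (\<Sum>k\<in>A. smult a (f k))"
  by (induction A rule: infinite_finite_induct) (simp_all add: smult_add_right)

lemma poly_as_sum_of_powers:
  "degree p \<le> d \<Longrightarrow> (\<Sum>k\<le>d. smult (coeff p k) ([:0, 1:] ^ k)) = p"
  by (simp add: poly_as_sum_of_monoms' flip: monom_altdef)

lemma flow_0:
  assumes "c \<in> M d"
  shows "flow d a b g h c 0 = c"
proof -
  have "[:1, 0:] = (1 :: complex poly)" by (simp flip: one_pCons)
  then show ?thesis
    using assms by (simp add: flow_def act_def vec_eq_iff M_def poly_as_sum_of_powers del: pCons_0_0)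
qed

lemma flow_tangent:
  assumes c: "c \<in> M d"
  shows "tangent_curve (flow d a b g h c) (flow_velocity d a b g h c)"
proof -
  have "poly_tangent (\<lambda>s. flow d a b g h c s $ i) (flow_velocity d a b g h c $ i)" for i
  proof -
    let ?X = "[:0, 1:] :: complex poly"
    let ?c = "\<lambda>k. coeff (c $ i) k"
    have "poly_tangent (\<lambda>s. [:0 + s * b, 1 + s * a:] ^ k * [:1 + s * h, 0 + s * g:] ^ (d - k))
        ([:0 + 0 * b, 1 + 0 * a:] ^ k * (of_nat (d - k) * [:1 + 0 * h, 0 + 0 * g:] ^ (d - k - 1) * [:h, g:])
          + of_nat k * [:0 + 0 * b, 1 + 0 * a:] ^ (k - 1) * [:b, a:] * [:1 + 0 * h, 0 + 0 * g:] ^ (d - k))" for k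
      by (intro poly_tangent_mult poly_tangent_power poly_tangent_linear)
    then have t: "poly_tangent (\<lambda>s. [:s * b, 1 + s * a:] ^ k * [:1 + s * h, s * g:] ^ (d - k))
        (?X ^ k * (of_nat (d - k) * [:h, g:]) + of_nat k * ?X ^ (k - 1) * [:b, a:])" for k
      by (simp flip: one_pCons)
    have "poly_tangent (\<lambda>s. flow d a b g h c s $ i)
        (\<Sum>k\<le>d. smult (?c k) (?X ^ k * (of_nat (d - k) * [:h, g:]) + of_nat k * ?X ^ (k - 1) * [:b, a:]))"
      unfolding flow_def act_def vec_lambda_beta by (intro poly_tangent_sum poly_tangent_smult t)
    moreover have "(\<Sum>k\<le>d. smult (?c k) (?X ^ k * (of_nat (d - k) * [:h, g:]) + of_nat k * ?X ^ (k - 1) * [:b, a:]))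
        = flow_velocity d a b g h c $ i"
    proof -
      have ci: "c $ i = (\<Sum>k\<le>d. smult (?c k) (?X ^ k))"
        using c by (simp add: M_def poly_as_sum_of_powers)
      have dci: "pderiv (c $ i) = (\<Sum>k\<le>d. smult (?c k) (of_nat k * ?X ^ (k - 1)))"
        by (subst ci) (rule pderiv_sum_powers)
      have "(\<Sum>k\<le>d. smult (?c k) (of_nat (d - k) * ?X ^ k))
          = (\<Sum>k\<le>d. smult (of_nat d) (smult (?c k) (?X ^ k)) - ?X * smult (?c k) (of_nat k * ?X ^ (k - 1)))"
      proof (rule sum.cong[OF refl])
        fix k assume "k \<in> {..d}"
        then have "of_nat (d - k) = (of_nat d - of_nat k :: complex poly)" by (simp add: of_nat_diff)
        moreover have "?X * (of_nat k * ?X ^ (k - 1)) = of_nat k * ?X ^ k"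
          by (cases k) (simp_all add: mult.left_commute)
        moreover have "smult (of_nat d) q = of_nat d * q" for q :: "complex poly"
          by (simp add: of_nat_poly)
        ultimately show "smult (?c k) (of_nat (d - k) * ?X ^ k)
            = smult (of_nat d) (smult (?c k) (?X ^ k)) - ?X * smult (?c k) (of_nat k * ?X ^ (k - 1))"
          by (simp only: mult_smult_right smult_diff_right left_diff_distrib mult.left_commute[of _ "of_nat d"])
      qed
      also have "\<dots> = smult (of_nat d) (c $ i) - ?X * pderiv (c $ i)"
        unfolding dci
        by (subst (2) ci) (simp only: sum_subtractf smult_sum_right sum_distrib_left)
      finally have e: "(\<Sum>k\<le>d. smult (?c k) (of_nat (d - k) * ?X ^ k))
          = smult (of_nat d) (c $ i) - ?X * pderiv (c $ i)" .
      have "(\<Sum>k\<le>d. smult (?c k) (?X ^ k * (of_nat (d - k) * [:h, g:]) + of_nat k * ?X ^ (k - 1) * [:b, a:]))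
          = [:h, g:] * (\<Sum>k\<le>d. smult (?c k) (of_nat (d - k) * ?X ^ k))
            + [:b, a:] * (\<Sum>k\<le>d. smult (?c k) (of_nat k * ?X ^ (k - 1)))"
        unfolding sum_distrib_left sum.distrib[symmetric]
        by (intro sum.cong refl) (simp only: smult_add_right mult_smult_right mult_ac)
      then show ?thesis unfolding e dci[symmetric] flow_velocity_def by (simp only: vec_lambda_beta add.commute)
    qed
    ultimately show ?thesis by simp
  qed
  then show ?thesis unfolding tangent_curve_def poly_tangent_def by blast
qed

lemma flow_is_poly: "is_poly (\<lambda>s. coeff (flow d a b g h c s $ i) n)"
proof -
  define P where "P F \<longleftrightarrow> (\<forall>n. is_poly (\<lambda>s. coeff (F s) n))" for F :: "complex \<Rightarrow> complex poly"
  have m: "P (\<lambda>s. F s * G s)" if "P F" "P G" for F G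
    using that unfolding P_def coeff_mult by (intro allI is_poly_intros) auto
  have p: "P (\<lambda>s. F s ^ k)" if "P F" for F k
    by (induction k) (use that m in \<open>auto simp: P_def intro: is_poly_intros\<close>)
  have l: "P (\<lambda>s. [:u s, v s:])" if "is_poly u" "is_poly v" for u v
    unfolding P_def
  proof
    fix n
    show "is_poly (\<lambda>s. coeff [:u s, v s:] n)"
      by (cases n; cases "n - 1") (use that in \<open>auto simp: coeff_pCons intro: is_poly_intros\<close>)
  qed
  have "P (\<lambda>s. [:s * b, 1 + s * a:] ^ k * [:1 + s * h, s * g:] ^ (d - k))" for k
    by (intro m p l is_poly_intros)
  then show ?thesis
    unfolding P_def flow_def act_def by (simp add: coeff_sum) (intro is_poly_intros, blast)
qed

lemma flow_velocity_in_M: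
  assumes c: "c \<in> M d"
  shows "flow_velocity d a b g h c \<in> M d"
  unfolding M_def
proof (clarify, rule degree_le, clarify)
  fix i n assume n: "d < n"
  have "coeff (flow d a b g h c s $ i) n = 0" for s
    using act_in_M[of d "1 + s * a" "s * b" "s * g" "1 + s * h" c] n
    by (intro coeff_eq_0) (auto simp: M_def flow_def intro: le_less_trans)
  then have 0: "(\<lambda>s. coeff (flow d a b g h c s $ i) n) = (\<lambda>_. 0)" by (rule ext)
  have "((\<lambda>s. coeff (flow d a b g h c s $ i) n) has_field_derivative coeff (flow_velocity d a b g h c $ i) n) (at 0)"
    using flow_tangent[OF c] unfolding tangent_curve_def by blast
  from DERIV_unique[OF this[unfolded 0] DERIV_const]
  show "coeff (flow_velocity d a b g h c $ i) n = 0" .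
qed

lemma flow_invertible_infinite:
  "infinite {s :: complex. (1 + s * a) * (1 + s * h) - (s * b) * (s * g) \<noteq> 0}"
proof -
  have "is_poly (\<lambda>s. (1 + s * a) * (1 + s * h) - (s * b) * (s * g))"
    by (intro is_poly_intros)
  from is_poly_finite_zeros[OF this, of 0]
  have "finite {s. (1 + s * a) * (1 + s * h) - (s * b) * (s * g) = 0}" by simp
  then have "infinite (- {s. (1 + s * a) * (1 + s * h) - (s * b) * (s * g) = 0})"
    using infinite_UNIV_char_0 finite_compl by blast
  then show ?thesis by (simp add: Compl_eq)
qed

lemma flow_velocity_linear:
  "flow_velocity d (\<Sum>j\<in>A. l j * a j) (\<Sum>j\<in>A. l j * b j) (\<Sum>j\<in>A. l j * g j) (\<Sum>j\<in>A. l j * h j) c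
    = (\<Sum>j\<in>A. tscale (l j) (flow_velocity d (a j) (b j) (g j) (h j) c))"
proof (induction A rule: infinite_finite_induct)
  case (insert x A)
  have "flow_velocity d (u * a + a') (u * b + b') (u * g + g') (u * h + h') c
      = tscale u (flow_velocity d a b g h c) + flow_velocity d a' b' g' h' c" for u a b g h a' b' g' h'
    by (simp add: flow_velocity_def vec_eq_iff algebra_simps smult_add_right smult_diff_right smult_add_left smult_smult)
  then show ?case using insert by simp
qed (simp_all add: flow_velocity_def vec_eq_iff)

section \<open>Wronskians\<close>

definition wronskian :: "tuple \<Rightarrow> 5 \<Rightarrow> 5 \<Rightarrow> complex poly" where
  "wronskian c i j = pderiv (c $ i) * c $ j - c $ i * pderiv (c $ j)"

text \<open>
  If the velocity vanishes, then \<open>p c' + q c = 0\<close> for two polynomials built from the matrix. Eliminating \<open>q\<close>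
  shows that \<open>p\<close> kills all Wronskians, so \<open>p = 0\<close>, and then \<open>q = 0\<close>; together they determine the matrix.
\<close>

lemma flow_velocity_injective:
  assumes zero: "flow_velocity d a b g h c = 0" and W: "wronskian c i j \<noteq> 0" and d: "d \<ge> 1"
  shows "a = 0 \<and> b = 0 \<and> g = 0 \<and> h = 0"
proof -
  define p where "p = [:b, a:] - [:h, g:] * [:0, 1:]"
  define q where "q = smult (of_nat d) [:h, g:]"
  have e: "p * pderiv (c $ n) + q * c $ n = 0" for n
  proof -
    have "p * pderiv (c $ n) + q * c $ n = flow_velocity d a b g h c $ n"
      unfolding p_def q_def flow_velocity_def vec_lambda_beta
      by (simp only: algebra_simps mult_smult_left mult_smult_right)
    then show ?thesis using zero by simp
  qed
  have "p * wronskian c i j = (p * pderiv (c $ i) + q * c $ i) * c $ j - (p * pderiv (c $ j) + q * c $ j) * c $ i"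
    by (simp add: wronskian_def algebra_simps)
  then have "p = 0" using W e by simp
  then have "b = 0" "a - h = 0" "g = 0" unfolding p_def by (simp_all add: pCons_eq_iff flip: one_pCons)
  moreover have "q = 0 \<or> (c $ i = 0 \<and> c $ j = 0)" using e[of i] e[of j] \<open>p = 0\<close> by auto
  then have "q = 0" using W by (auto simp: wronskian_def)
  then have "h = 0" using d by (simp add: q_def)
  ultimately show ?thesis by simp
qed

text \<open>
  Subtract the multiple of \<open>q\<close> that makes the difference \<open>r\<close> vanish at \<open>t\<close>. If \<open>r\<close> were not zero, then
  \<open>r' q\<close> would vanish at \<open>t\<close> to smaller order than \<open>r q'\<close>.
\<close>

lemma wronskian_zero_proportional:
  fixes p q :: "complex poly"
  assumes W: "pderiv p * q = p * pderiv q" and q: "poly q t \<noteq> 0"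
  shows "p = smult (poly p t / poly q t) q"
proof (rule ccontr)
  define r where "r = p - smult (poly p t / poly q t) q"
  assume "p \<noteq> smult (poly p t / poly q t) q"
  then have r0: "r \<noteq> 0" by (simp add: r_def)
  have rt: "poly r t = 0" using q by (simp add: r_def)
  have Wr: "pderiv r * q = r * pderiv q"
    using W by (simp add: r_def pderiv_diff pderiv_smult algebra_simps)
  have d0: "pderiv r \<noteq> 0"
  proof
    assume "pderiv r = 0"
    then have "degree r = 0" by (simp add: pderiv_eq_0_iff)
    then obtain a where "r = [:a:]" by (rule degree_eq_zeroE)
    then show False using r0 rt by simp
  qed
  have q0: "q \<noteq> 0" using q by auto
  then have n1: "pderiv r * q \<noteq> 0" using d0 by simp
  then have n2: "r * pderiv q \<noteq> 0" using Wr by simp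
  have "order t (pderiv r) + order t q = order t r + order t (pderiv q)"
    using order_mult[OF n1, of t] order_mult[OF n2, of t] Wr by simp
  moreover have "order t q = 0" using q by (simp add: order_root)
  ultimately have "order t (pderiv r) = order t r + order t (pderiv q)" by simp
  moreover have "order t r = Suc (order t (pderiv r))" using order_pderiv[OF r0 rt] .
  ultimately show False by simp
qed

text \<open>
  If all Wronskians vanish, then \<open>c(t)\<close> is a scalar multiple of a fixed vector \<open>v\<close>, and the rational
  inverse \<open>A / B\<close> can only return the constant \<open>A(v) / B(v)\<close>.
\<close>

lemma birational_wronskian:
  assumes "birational_onto_image c"
  shows "\<exists>i j. wronskian c i j \<noteq> 0"
proof (rule ccontr)
  assume "\<not> ?thesis"
  then have W: "pderiv (c $ i) * c $ j = c $ i * pderiv (c $ j)" for i j by (auto simp: wronskian_def)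
  obtain m A B where AB: "A \<in> forms m" "B \<in> forms m" and
    fin: "finite {t. \<not> (form_eval m B (affine_value c t) \<noteq> 0 \<and>
           form_eval m A (affine_value c t) = t * form_eval m B (affine_value c t))}" (is "finite ?S")
    using assms unfolding birational_onto_image_def by blast
  have inf: "infinite (- ?S)" using finite_compl[OF fin] infinite_UNIV_char_0[where 'a = complex] by blast
  obtain v s where v: "\<And>t. affine_value c t = s t *s v"
  proof (cases "c = 0")
    case True
    then show ?thesis using that[of "\<lambda>_. 0" 0] by (simp add: affine_value_def vec_eq_iff)
  next
    case False
    then obtain i where "c $ i \<noteq> 0" by (auto simp: vec_eq_iff)
    then obtain t0 where t0: "poly (c $ i) t0 \<noteq> 0" using poly_all_0_iff_0 by blast
    have "affine_value c t = poly (c $ i) t *s (\<chi> j. poly (c $ j) t0 / poly (c $ i) t0)" for t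
      unfolding affine_value_def vec_eq_iff
    proof (clarsimp)
      fix j
      show "poly (c $ j) t = poly (c $ i) t * poly (c $ j) t0 / poly (c $ i) t0"
        using arg_cong[OF wronskian_zero_proportional[OF W[of j i] t0], of "\<lambda>p. poly p t"] by simp
    qed
    then show ?thesis using that by blast
  qed
  have "t = form_eval m A v / form_eval m B v" if "t \<in> - ?S" for t
  proof -
    have "s t ^ m * form_eval m B v \<noteq> 0" "s t ^ m * form_eval m A v = t * (s t ^ m * form_eval m B v)"
      using that by (simp_all add: v form_eval_scale)
    moreover have "u * y \<noteq> 0 \<Longrightarrow> u * x = t * (u * y) \<Longrightarrow> t = x / y" for u x y :: complex
      by (auto simp: field_simps)
    ultimately show ?thesis by blast
  qed
  then have "- ?S \<subseteq> {form_eval m A v / form_eval m B v}" by blast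
  then show False using inf finite_subset by blast
qed

lemma M_coord_polynomial [intro]: "(\<lambda>c. coeff (c $ i) k) \<in> polynomial_functions M_coords"
  by (rule polynomial_functions.coord) (auto simp: M_coords_def)

lemma flow_velocity_polynomial: "(\<lambda>c. coeff (flow_velocity d a b g h c $ i) k) \<in> polynomial_functions M_coords"
proof -
  have l: "(\<lambda>c. coeff ([:u, v:] * P c) k) \<in> polynomial_functions M_coords"
    if "\<And>k. (\<lambda>c. coeff (P c) k) \<in> polynomial_functions M_coords" for u v and P :: "tuple \<Rightarrow> complex poly" and k
    by (cases k) (use that in \<open>auto intro!: pf_intros\<close>)
  have p: "(\<lambda>c. coeff (pderiv (c $ i)) k) \<in> polynomial_functions M_coords" for k
    unfolding coeff_pderiv by (intro pf_intros M_coord_polynomial)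
  have "(\<lambda>c. coeff (smult (of_nat d) (c $ i) - [:0, 1:] * pderiv (c $ i)) k) \<in> polynomial_functions M_coords" for k
    unfolding coeff_diff coeff_smult by (intro pf_intros l p M_coord_polynomial)
  then show ?thesis
    unfolding flow_velocity_def vec_lambda_beta coeff_add by (intro pf_intros l p)
qed

lemma hom_value_polynomial: "(\<lambda>c. hom_value d c x y $ i) \<in> polynomial_functions M_coords"
  unfolding hom_value_def vec_lambda_beta by (intro pf_intros M_coord_polynomial)

lemma form_eval_polynomial:
  "(\<lambda>c. form_eval m f (hom_value d c x y)) \<in> polynomial_functions M_coords"
  unfolding form_eval_def by (intro pf_intros hom_value_polynomial)

lemma form_eval_polys_over:
  assumes k: "subring_set k" and f: "\<And>e. f e \<in> k" and xy: "x \<in> k" "y \<in> k"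
  shows "(\<lambda>c. form_eval m f (hom_value d c x y)) \<in> polys_over k M_coords"
proof -
  have "(\<lambda>c. coeff (c $ i) n) \<in> polys_over k M_coords" for i n
    by (rule polys_over.coord) (auto simp: M_coords_def)
  then show ?thesis
    unfolding form_eval_def hom_value_def vec_lambda_beta using k f xy
    by (intro polys_over_more[OF k] polys_over.mult polys_over.const subring_setD) auto
qed

lemma wronskian_regular:
  "\<exists>p\<in>polynomial_functions M_coords. \<forall>c\<in>M d. poly (wronskian c i j) t = p c"
proof -
  define D where "D i c = (\<Sum>k\<le>d. of_nat (Suc k) * coeff (c $ i) (Suc k) * t ^ k)" for i :: 5 and c :: tuple
  define V where "V i c = (\<Sum>k\<le>d. coeff (c $ i) k * t ^ k)" for i :: 5 and c :: tuple
  have D: "poly (pderiv (c $ i)) t = D i c" if "c \<in> M d" for c i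
    using that unfolding D_def M_def
    by (subst poly_coeff_sum[of _ d]) (auto simp: degree_pderiv coeff_pderiv intro: order_trans[OF diff_le_self])
  have V: "poly (c $ i) t = V i c" if "c \<in> M d" for c i
    using that unfolding V_def M_def by (intro poly_coeff_sum) auto
  have "(\<lambda>c. D i c * V j c - V i c * D j c) \<in> polynomial_functions M_coords"
    unfolding D_def V_def by (intro pf_intros M_coord_polynomial)
  then show ?thesis by (intro bexI[of _ "\<lambda>c. D i c * V j c - V i c * D j c"]) (auto simp: wronskian_def D V)
qed

section \<open>Countable rings of definition\<close>

lemma sum_functions_apply: "(\<Sum>m\<in>S. f m) x = (\<Sum>m\<in>S. f m x)"
  by (induction S rule: infinite_finite_induct) simp_all

lemma polynomial_functions_span:
  fixes C :: "('x \<Rightarrow> complex) set"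
  assumes "countable C"
  shows "\<exists>Mon. countable Mon \<and> Mon \<subseteq> polys_over {1} C \<and> polynomial_functions C = fs.span Mon"
proof -
  let ?m = "\<lambda>p q (x :: 'x). p x * q x :: complex"
  define Mon where "Mon = closure2 ?m ?m (insert (\<lambda>_. 1) C)"
  have "countable Mon" unfolding Mon_def using assms by (intro countable_closure2) auto
  moreover have Mon: "p \<in> polys_over {1} C" if "p \<in> Mon" for p
    using that unfolding Mon_def by induction (auto intro: polys_over.intros)
  moreover have "p \<in> fs.span Mon" if "p \<in> polynomial_functions C" for p
    using that
  proof induction
    case (const a)
    have "(\<lambda>_. 1) \<in> Mon" by (simp add: Mon_def closure2.base)
    then have "fscale a (\<lambda>_. 1) \<in> fs.span Mon" by (intro fs.span_scale fs.span_base)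
    moreover have "fscale a (\<lambda>_. 1) = (\<lambda>_ :: 'x. a)" by (simp add: fscale_def)
    ultimately show ?case by simp
  next
    case (coord u)
    then show ?case by (intro fs.span_base) (simp add: Mon_def closure2.base)
  next
    case (add p q)
    then have "p + q \<in> fs.span Mon" by (intro fs.span_add)
    then show ?case by (simp add: plus_fun_def)
  next
    case (mult p q)
    have 1: "?m p q \<in> fs.span Mon" if "p \<in> Mon" "q \<in> fs.span Mon" for p q
      using that(2)
    proof (induction rule: fs.span_induct_alt)
      case base
      then show ?case using fs.span_zero[of Mon] by (simp add: zero_fun_def)
    next
      case (step c x y)
      have "?m p x \<in> fs.span Mon" using that(1) step.hyps by (intro fs.span_base) (auto simp: Mon_def intro: closure2.left)
      then have "fscale c (?m p x) + ?m p y \<in> fs.span Mon" using step by (intro fs.span_add fs.span_scale)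
      moreover have "fscale c (?m p x) + ?m p y = ?m p (fscale c x + y)"
        by (simp add: fscale_def plus_fun_def algebra_simps fun_eq_iff)
      ultimately show ?case by simp
    qed
    have "?m p q \<in> fs.span Mon" if "p \<in> fs.span Mon" "q \<in> fs.span Mon" for p q
      using that(1)
    proof (induction rule: fs.span_induct_alt)
      case base
      then show ?case using fs.span_zero[of Mon] by (simp add: zero_fun_def)
    next
      case (step c x y)
      have "fscale c (?m x q) + ?m y q \<in> fs.span Mon" using step 1[OF _ that(2)] by (intro fs.span_add fs.span_scale)
      moreover have "fscale c (?m x q) + ?m y q = ?m (fscale c x + y) q"
        by (simp add: fscale_def plus_fun_def algebra_simps fun_eq_iff)
      ultimately show ?case by simp
    qed
    then show ?case using mult by blast
  qed
  moreover have "p \<in> polynomial_functions C" if "p \<in> fs.span Mon" for p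
    using that
  proof (induction rule: fs.span_induct_alt)
    case base
    then show ?case using polynomial_functions.const[of 0] by (simp add: zero_fun_def)
  next
    case (step c x y)
    then show ?case using polys_over_pf[OF Mon]
      by (auto simp: fscale_def plus_fun_def
          intro!: polynomial_functions.const polynomial_functions.add polynomial_functions.mult)
  qed
  ultimately show ?thesis by blast
qed

text \<open>
  A basis of \<open>J\<close> meets the span of each finite set of monomials in a finite set, because an
  independent set in a space spanned by \<open>n\<close> vectors has at most \<open>n\<close> elements.
\<close>

lemma countable_basis:
  fixes C :: "('x \<Rightarrow> complex) set"
  assumes Mon: "countable Mon" and J: "J \<subseteq> fs.span Mon"
  shows "\<exists>B. countable B \<and> B \<subseteq> J \<and> J \<subseteq> fs.span (B :: ('x \<Rightarrow> complex) set)"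
proof -
  obtain B where B: "B \<subseteq> J" "fs.independent B" "J \<subseteq> fs.span B"
    using fs.maximal_independent_subset by blast
  have fin: "finite (B \<inter> fs.span S)" if "finite S" for S
    using fs.independent_span_bound[OF that, of "B \<inter> fs.span S"] fs.independent_mono[OF B(2)] by blast
  have "B \<subseteq> (\<Union>S\<in>{S. finite S \<and> S \<subseteq> Mon}. B \<inter> fs.span S)"
  proof
    fix b assume "b \<in> B"
    then have "b \<in> fs.span Mon" using B(1) J by blast
    then obtain S where "finite S" "S \<subseteq> Mon" "b \<in> fs.span S"
      unfolding fs.span_explicit by (auto intro: fs.span_sum fs.span_scale fs.span_base)
    then show "b \<in> (\<Union>S\<in>{S. finite S \<and> S \<subseteq> Mon}. B \<inter> fs.span S)" using \<open>b \<in> B\<close> by blast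
  qed
  moreover have "countable (\<Union>S\<in>{S. finite S \<and> S \<subseteq> Mon}. B \<inter> fs.span S)"
    using fin Mon by (intro countable_UN countable_Collect_finite_subset) (auto intro: countable_finite)
  ultimately have "countable B" by (rule countable_subset)
  then show ?thesis using B by (intro exI[of _ B] conjI)
qed

text \<open>
  A field of definition, or rather a countable ring: it contains the coefficients, with respect to
  monomials, of a countable basis of \<open>J\<close>.
\<close>

lemma span_over_countable_ring:
  fixes C :: "('x \<Rightarrow> complex) set"
  assumes C: "countable C" and J: "J \<subseteq> polynomial_functions C" and A: "countable A"
  shows "\<exists>k. countable k \<and> subring_set k \<and> A \<subseteq> k \<and> J \<subseteq> fs.span (J \<inter> polys_over k C)"
proof -
  obtain Mon where Mon: "countable Mon" "Mon \<subseteq> polys_over {1} C" "polynomial_functions C = fs.span Mon"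
    using polynomial_functions_span[OF C] by blast
  have JM: "J \<subseteq> fs.span Mon" using J Mon(3) by simp
  from countable_basis[OF Mon(1) JM]
  obtain B where B: "countable B" "B \<subseteq> J" "J \<subseteq> fs.span B" by (elim exE conjE)
  have "\<exists>S r. finite S \<and> S \<subseteq> Mon \<and> b = (\<Sum>m\<in>S. fscale (r m) m)" if "b \<in> B" for b
  proof -
    have "b \<in> fs.span Mon" using that B(2) JM by (meson subsetD)
    then show ?thesis unfolding fs.span_explicit by auto
  qed
  then have "\<forall>b\<in>B. \<exists>S r. finite S \<and> S \<subseteq> Mon \<and> b = (\<Sum>m\<in>S. fscale (r m) m)" by simp
  then obtain S r where Sr: "\<And>b. b \<in> B \<Longrightarrow> finite (S b) \<and> S b \<subseteq> Mon \<and> b = (\<Sum>m\<in>S b. fscale (r b m) m)"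
    by metis
  have "countable (r b ` S b)" if "b \<in> B" for b
    using Sr[OF that] by (intro countable_finite finite_imageI) simp
  then have "countable (A \<union> (\<Union>b\<in>B. r b ` S b))"
    using A B(1) by (intro countable_Un countable_UN)
  from countable_subring[OF this]
  obtain k where k: "A \<union> (\<Union>b\<in>B. r b ` S b) \<subseteq> k" "countable k" "subring_set k"
    by (elim exE conjE)
  have "b \<in> polys_over k C" if b: "b \<in> B" for b
  proof -
    have mono: "p \<in> polys_over k C" if "p \<in> polys_over {1} C" for p
      using that by induction (auto intro: polys_over.intros subring_setD[OF k(3)])
    have "b = (\<lambda>x. \<Sum>m\<in>S b. r b m * m x)"
    proof
      fix x
      have "b x = (\<Sum>m\<in>S b. fscale (r b m) m) x" using Sr[OF b] by simp
      then show "b x = (\<Sum>m\<in>S b. r b m * m x)" by (simp add: sum_functions_apply fscale_def)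
    qed
    moreover have "(\<lambda>x. \<Sum>m\<in>S b. r b m * m x) \<in> polys_over k C"
    proof (intro polys_over_more(2)[OF k(3)] polys_over.mult polys_over.const)
      fix m assume m: "m \<in> S b"
      then show "r b m \<in> k" using k(1) b by blast
      show "m \<in> polys_over k C" using m Sr[OF b] Mon(2) mono by blast
    qed
    ultimately show ?thesis by simp
  qed
  then have "fs.span B \<subseteq> fs.span (J \<inter> polys_over k C)" using B(2) by (intro fs.span_mono) blast
  with B(3) have "J \<subseteq> fs.span (J \<inter> polys_over k C)" by (rule order.trans)
  then show ?thesis using k by (intro exI[of _ k] conjI) simp_all
qed

section \<open>Irreducible components\<close>

text \<open>
  Irreducibility of \<open>X\<close> in terms of its coordinate ring: the functions vanishing on \<open>X\<close> form a
  prime ideal.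
\<close>

lemma zariski_irreducible_iff_prime:
  "zariski_irreducible C X \<longleftrightarrow> X \<noteq> {} \<and>
    (\<forall>u\<in>polynomial_functions C. \<forall>w\<in>polynomial_functions C.
       (\<forall>x\<in>X. u x * w x = 0) \<longrightarrow> (\<forall>x\<in>X. u x = 0) \<or> (\<forall>x\<in>X. w x = 0))"
proof
  assume irr: "zariski_irreducible C X"
  show "X \<noteq> {} \<and> (\<forall>u\<in>polynomial_functions C. \<forall>w\<in>polynomial_functions C.
       (\<forall>x\<in>X. u x * w x = 0) \<longrightarrow> (\<forall>x\<in>X. u x = 0) \<or> (\<forall>x\<in>X. w x = 0))"
  proof (intro conjI ballI impI)
    show "X \<noteq> {}" using irr by (simp add: zariski_irreducible_def)
    fix u w assume u: "u \<in> polynomial_functions C" and w: "w \<in> polynomial_functions C"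
      and z: "\<forall>x\<in>X. u x * w x = 0"
    have cl: "zariski_closed C X {x\<in>X. p x = 0}" if "p \<in> polynomial_functions C" for p
      unfolding zariski_closed_def by (rule exI[of _ "{p}"]) (use that in auto)
    have "X = {x\<in>X. u x = 0} \<union> {x\<in>X. w x = 0}" using z by auto
    then have "X = {x\<in>X. u x = 0} \<or> X = {x\<in>X. w x = 0}"
      using irr cl[OF u] cl[OF w] unfolding zariski_irreducible_def by blast
    then show "(\<forall>x\<in>X. u x = 0) \<or> (\<forall>x\<in>X. w x = 0)" by blast
  qed
next
  assume *: "X \<noteq> {} \<and> (\<forall>u\<in>polynomial_functions C. \<forall>w\<in>polynomial_functions C.
       (\<forall>x\<in>X. u x * w x = 0) \<longrightarrow> (\<forall>x\<in>X. u x = 0) \<or> (\<forall>x\<in>X. w x = 0))"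
  show "zariski_irreducible C X"
    unfolding zariski_irreducible_def
  proof (intro conjI allI impI)
    show "X \<noteq> {}" using * by blast
    fix Y Z assume "zariski_closed C X Y" "zariski_closed C X Z" and YZ: "X = Y \<union> Z"
    then obtain G H where G: "G \<subseteq> polynomial_functions C" "Y = {x\<in>X. \<forall>g\<in>G. g x = 0}"
      and H: "H \<subseteq> polynomial_functions C" "Z = {x\<in>X. \<forall>g\<in>H. g x = 0}"
      unfolding zariski_closed_def by (elim exE conjE)
    show "X = Y \<or> X = Z"
    proof (rule ccontr)
      assume "\<not> (X = Y \<or> X = Z)"
      then obtain x y g h where xy: "x \<in> X" "g \<in> G" "g x \<noteq> 0" "y \<in> X" "h \<in> H" "h y \<noteq> 0"
        using G(2) H(2) by blast
      have "\<forall>x\<in>X. g x * h x = 0" using YZ G(2) H(2) xy by auto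
      then have "(\<forall>x\<in>X. g x = 0) \<or> (\<forall>x\<in>X. h x = 0)"
        using * G(1) H(1) xy(2,5) by blast
      then show False using xy by blast
    qed
  qed
qed

text \<open>
  The closure \<open>Z\<close> of the union of all translates of \<open>\<Gamma>\<close> is irreducible: if \<open>u\<close> and \<open>w\<close> do not vanish on it,
  then some \<open>x\<close> in \<open>\<Gamma>\<close> has translates at which \<open>u\<close>, respectively \<open>w\<close>, is nonzero, and the two
  polynomials in \<open>s\<close> have a common nonzero value. As \<open>Z\<close> contains the component \<open>\<Gamma>\<close>, it is equal to it.
\<close>

lemma component_invariant:
  assumes comp: "irreducible_component C X \<Gamma>"
    and S: "infinite S" "s0 \<in> S" "\<And>x. x \<in> \<Gamma> \<Longrightarrow> \<rho> s0 x = x"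
    and X: "\<And>s x. s \<in> S \<Longrightarrow> x \<in> \<Gamma> \<Longrightarrow> \<rho> s x \<in> X"
    and poly_s: "\<And>u x. u \<in> C \<Longrightarrow> is_poly (\<lambda>s. u (\<rho> s x))"
    and poly_x: "\<And>u s. u \<in> C \<Longrightarrow> (\<lambda>x. u (\<rho> s x)) \<in> polynomial_functions C"
    and s: "s \<in> S" "x \<in> \<Gamma>"
  shows "\<rho> s x \<in> \<Gamma>"
proof -
  define G where "G = {g \<in> polynomial_functions C. \<forall>s\<in>S. \<forall>x\<in>\<Gamma>. g (\<rho> s x) = 0}"
  define Z where "Z = {y \<in> X. \<forall>g\<in>G. g y = 0}"
  have \<Gamma>: "\<Gamma> \<subseteq> X" "zariski_irreducible C \<Gamma>"
    using comp by (auto simp: irreducible_component_def zariski_closed_def)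
  have prime: "(\<forall>x\<in>\<Gamma>. u x = 0) \<or> (\<forall>x\<in>\<Gamma>. w x = 0)"
    if "u \<in> polynomial_functions C" "w \<in> polynomial_functions C" "\<forall>x\<in>\<Gamma>. u x * w x = 0" for u w
    using \<Gamma>(2) that unfolding zariski_irreducible_iff_prime by blast
  have Z: "\<rho> s x \<in> Z" if "s \<in> S" "x \<in> \<Gamma>" for s x
    using X that by (auto simp: Z_def G_def)
  have \<Gamma>Z: "\<Gamma> \<subseteq> Z" using Z[OF S(2)] S(3) by force
  have "zariski_closed C X Z"
    unfolding zariski_closed_def Z_def by (rule exI[of _ G]) (auto simp: G_def)
  moreover have "zariski_irreducible C Z"
    unfolding zariski_irreducible_iff_prime
  proof (intro conjI ballI impI)
    show "Z \<noteq> {}" using \<Gamma>Z \<Gamma>(2) by (auto simp: zariski_irreducible_def)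
    fix u w assume u: "u \<in> polynomial_functions C" and w: "w \<in> polynomial_functions C"
      and uw: "\<forall>y\<in>Z. u y * w y = 0"
    have van: "\<forall>y\<in>Z. v y = 0" if "v \<in> polynomial_functions C" "\<forall>s\<in>S. \<forall>x\<in>\<Gamma>. v (\<rho> s x) = 0" for v
      using that by (auto simp: Z_def G_def)
    show "(\<forall>x\<in>Z. u x = 0) \<or> (\<forall>x\<in>Z. w x = 0)"
    proof (rule ccontr)
      assume "\<not> ?thesis"
      then obtain s1 x1 s2 x2 where 1: "s1 \<in> S" "x1 \<in> \<Gamma>" "u (\<rho> s1 x1) \<noteq> 0"
        and 2: "s2 \<in> S" "x2 \<in> \<Gamma>" "w (\<rho> s2 x2) \<noteq> 0" using van[OF u] van[OF w] by blast
      have "(\<lambda>x. u (\<rho> s1 x)) \<in> polynomial_functions C" "(\<lambda>x. w (\<rho> s2 x)) \<in> polynomial_functions C"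
        using u w poly_x by (auto intro: pf_compose)
      from prime[OF this] obtain x where x: "x \<in> \<Gamma>" "u (\<rho> s1 x) \<noteq> 0" "w (\<rho> s2 x) \<noteq> 0"
        using 1 2 by (metis mult_eq_0_iff)
      have "is_poly (\<lambda>s. u (\<rho> s x))" "is_poly (\<lambda>s. w (\<rho> s x))"
        using u w poly_s by (auto intro: polynomial_function_along)
      from is_poly_no_zero_divisors[OF this _ S(1)] show False
        using x uw Z by blast
    qed
  qed
  ultimately have "Z = \<Gamma>" using comp \<Gamma>Z by (simp add: irreducible_component_def)
  then show ?thesis using Z s by blast
qed

section \<open>Tangent spaces as spaces of vectors\<close>

text \<open>
  A regular function is prescribed only on \<open>M d\<close>. A polynomial representative makes its differential
  linear in all directions.
\<close>

definition representative :: "nat \<Rightarrow> (tuple \<Rightarrow> complex) \<Rightarrow> (tuple \<Rightarrow> complex)" where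
  "representative d g = (SOME p. p \<in> polynomial_functions M_coords \<and> (\<forall>x\<in>M d. g x = p x))"

lemma representative:
  assumes "g \<in> regular M_coords (M d)"
  shows "representative d g \<in> polynomial_functions M_coords"
    "\<And>x. x \<in> M d \<Longrightarrow> g x = representative d g x"
    "\<And>c v. c \<in> M d \<Longrightarrow> v \<in> M d \<Longrightarrow> differential g c v = differential (representative d g) c v"
proof -
  obtain p where "p \<in> polynomial_functions M_coords \<and> (\<forall>x\<in>M d. g x = p x)"
    using assms unfolding regular_def by blast
  then have *: "representative d g \<in> polynomial_functions M_coords \<and> (\<forall>x\<in>M d. g x = representative d g x)"
    unfolding representative_def
    by (rule someI[of "\<lambda>p. p \<in> polynomial_functions M_coords \<and> (\<forall>x\<in>M d. g x = p x)"])
  show "representative d g \<in> polynomial_functions M_coords" using * by simp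
  show e: "\<And>x. x \<in> M d \<Longrightarrow> g x = representative d g x" using * by simp
  show "\<And>c v. c \<in> M d \<Longrightarrow> v \<in> M d \<Longrightarrow> differential g c v = differential (representative d g) c v"
    using e by (rule differential_cong)
qed

definition tangent_vectors :: "nat \<Rightarrow> (tuple \<Rightarrow> complex) set \<Rightarrow> tuple \<Rightarrow> tuple set" where
  "tangent_vectors d J c = {v \<in> M d. \<forall>g\<in>J. differential g c v = 0}"

lemma subspace_tangent_vectors:
  assumes J: "J \<subseteq> regular M_coords (M d)" and c: "c \<in> M d"
  shows "ts.subspace (tangent_vectors d J c)"
proof (rule ts.subspaceI)
  have d: "differential g c (v + w) = differential g c v + differential g c w"
      "differential g c (tscale a v) = a * differential g c v"
    if "g \<in> J" "v \<in> M d" "w \<in> M d" for g v w a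
    using that representative[OF subsetD[OF J that(1)]] c
    by (simp_all add: M_add M_tscale differential_add_vector differential_tscale)
  show "0 \<in> tangent_vectors d J c"
    using d(2)[of _ 0 0 0] by (simp add: tangent_vectors_def M_0)
  show "v + w \<in> tangent_vectors d J c" if "v \<in> tangent_vectors d J c" "w \<in> tangent_vectors d J c" for v w
    using that d(1) by (simp add: tangent_vectors_def M_add)
  show "tscale a v \<in> tangent_vectors d J c" if "v \<in> tangent_vectors d J c" for a v
    using that d(2)[of _ v v a] by (simp add: tangent_vectors_def M_tscale)
qed

text \<open>
  A linear form on the maximal ideal that kills its square is determined by its values \<open>z i k\<close> on the
  coordinates \<open>x\<^sub>i\<^sub>k - c\<^sub>i\<^sub>k\<close>; the vector \<open>v\<close> with these entries represents it, by induction on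
  polynomials with the product rule. The coordinates with \<open>k > d\<close> vanish on \<open>M d\<close>, so \<open>v\<close> lies in \<open>M d\<close>.
\<close>

lemma tangent_space_functional:
  assumes c: "c \<in> M d" and \<theta>: "\<theta> \<in> zariski_tangent_space M_coords (M d) J c"
    and J: "\<And>g. g \<in> regular M_coords (M d) \<Longrightarrow> (\<And>x. x \<in> M d \<Longrightarrow> g x = 0) \<Longrightarrow> g \<in> J"
  shows "\<exists>v\<in>M d. \<forall>g\<in>maximal_ideal_at M_coords (M d) c. \<theta> g = differential g c v"
proof -
  let ?m = "maximal_ideal_at M_coords (M d) c"
  have add: "\<theta> (\<lambda>y. g y + h y) = \<theta> g + \<theta> h" if "g \<in> ?m" "h \<in> ?m" for g h
    using \<theta> that unfolding zariski_tangent_space_def by (simp add: Let_def)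
  have scal: "\<theta> (\<lambda>y. a * g y) = a * \<theta> g" if "g \<in> ?m" for a g
    using \<theta> that unfolding zariski_tangent_space_def by (simp add: Let_def)
  have van: "\<theta> g = 0" if "g \<in> ?m" "g \<in> J" for g
    using \<theta> that unfolding zariski_tangent_space_def by (simp add: Let_def)
  have sq: "\<theta> (\<lambda>y. g y * h y) = 0" if "g \<in> ?m" "h \<in> ?m" for g h
    using \<theta> that unfolding zariski_tangent_space_def by (simp add: Let_def)
  have m: "(\<lambda>x. p x - p c) \<in> ?m" if "p \<in> polynomial_functions M_coords" for p
    unfolding maximal_ideal_at_def using pf_diff[OF that polynomial_functions.const]
    by (simp add: pf_regular)
  have m_cmult: "(\<lambda>x. a * g x) \<in> ?m" if "g \<in> ?m" for a g
    using that by (simp add: maximal_ideal_at_def regular_cmult)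
  have m_add: "(\<lambda>x. g x + h x) \<in> ?m" if "g \<in> ?m" "h \<in> ?m" for g h
    using that by (simp add: maximal_ideal_at_def regular_add)
  have m_mult: "(\<lambda>x. g x * h x) \<in> ?m" if "g \<in> ?m" "h \<in> ?m" for g h
    using that by (simp add: maximal_ideal_at_def regular_mult)
  define z where "z i k = \<theta> (\<lambda>x. coeff (x $ i) k - coeff (c $ i) k)" for i k
  define v :: tuple where "v = (\<chi> i. \<Sum>k\<le>d. monom (z i k) k)"
  have z0: "z i k = 0" if "k > d" for i k
  proof -
    have "coeff (x $ i) k - coeff (c $ i) k = 0" if "x \<in> M d" for x
      using M_coeff[OF that \<open>k > d\<close>] M_coeff[OF c \<open>k > d\<close>] by simp
    then show ?thesis unfolding z_def using m[OF M_coord_polynomial] 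
      by (intro van J) (auto simp: maximal_ideal_at_def)
  qed
  have zv: "z i k = coeff (v $ i) k" for i k
    using z0[of k i] by (auto simp: v_def coeff_sum)
  have vM: "v \<in> M d" by (auto simp: M_def v_def intro!: degree_sum_le order_trans[OF degree_monom_le])
  have *: "\<theta> (\<lambda>x. p x - p c) = differential p c v" if "p \<in> polynomial_functions M_coords" for p
    using that
  proof induction
    case (const a)
    have "\<theta> (\<lambda>y. 0 * (a - a)) = 0"
      using scal[OF m[OF polynomial_functions.const], of 0 a] by simp
    then show ?case by (simp add: differential_const)
  next
    case (coord u)
    then obtain i k where u: "u = (\<lambda>c. coeff (c $ i) k)" by (auto simp: M_coords_def)
    show ?case unfolding u differential_coord by (simp add: zv[symmetric] z_def)
  next
    case (add p q)
    have "(\<lambda>x. p x + q x - (p c + q c)) = (\<lambda>x. (p x - p c) + (q x - q c))" by (simp add: fun_eq_iff)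
    then show ?case
      using add assms(1) by (simp add: differential_add \<open>\<And>h g. \<lbrakk>g \<in> ?m; h \<in> ?m\<rbrakk> \<Longrightarrow> \<theta> (\<lambda>y. g y + h y) = \<theta> g + \<theta> h\<close> m)
  next
    case (mult p q)
    have "(\<lambda>x. p x * q x - p c * q c)
        = (\<lambda>x. (p x - p c) * (q x - q c) + (p c * (q x - q c) + q c * (p x - p c)))"
      by (simp add: fun_eq_iff algebra_simps)
    then have "\<theta> (\<lambda>x. p x * q x - p c * q c)
        = \<theta> (\<lambda>x. (p x - p c) * (q x - q c)) + (\<theta> (\<lambda>x. p c * (q x - q c)) + \<theta> (\<lambda>x. q c * (p x - p c)))"
      using mult by (simp add: add m m_cmult m_add m_mult)
    also have "\<dots> = p c * differential q c v + q c * differential p c v"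
      using mult by (simp add: sq scal m)
    finally show ?case using mult by (simp add: differential_mult)
  qed
  have "\<theta> g = differential g c v" if g: "g \<in> ?m" for g
  proof -
    have gr: "g \<in> regular M_coords (M d)" "g c = 0" using g by (auto simp: maximal_ideal_at_def)
    let ?p = "representative d g"
    note r = representative[OF gr(1)]
    have pc: "?p c = 0" using r(2)[OF c] gr(2) by simp
    have pm: "?p \<in> ?m" using m[OF r(1)] pc by simp
    have "(\<lambda>x. g x + (- 1) * ?p x) \<in> ?m" by (intro m_add m_cmult g pm)
    moreover from this have "(\<lambda>x. g x + (- 1) * ?p x) \<in> J"
      using r(2) by (intro J) (auto simp: maximal_ideal_at_def)
    ultimately have "\<theta> (\<lambda>x. g x + (- 1) * ?p x) = 0" by (rule van)
    then have "\<theta> g = \<theta> ?p" using add[OF g m_cmult[OF pm, of "- 1"]] scal[OF pm, of "- 1"] by simp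
    also have "\<dots> = differential ?p c v" using *[OF r(1)] pc by simp
    finally show ?thesis using r(3)[OF c vM] by simp
  qed
  then show ?thesis using vM by blast
qed

lemma dim_zariski_tangent_space:
  assumes c: "c \<in> M d" and Jr: "J \<subseteq> regular M_coords (M d)"
    and Jc: "\<And>g. g \<in> J \<Longrightarrow> g c = 0"
    and J: "\<And>g. g \<in> regular M_coords (M d) \<Longrightarrow> (\<And>x. x \<in> M d \<Longrightarrow> g x = 0) \<Longrightarrow> g \<in> J"
  shows "fs.dim (zariski_tangent_space M_coords (M d) J c) = ts.dim (tangent_vectors d J c)"
proof -
  let ?m = "maximal_ideal_at M_coords (M d) c"
  define \<Psi> where "\<Psi> v = (\<lambda>g. if g \<in> ?m then differential (representative d g) c v else 0)" for v
  have mr: "g \<in> regular M_coords (M d)" if "g \<in> ?m" for g using that by (simp add: maximal_ideal_at_def)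
  have \<Psi>: "\<Psi> v g = differential g c v" if "g \<in> ?m" "v \<in> M d" for v g
    using representative(3)[OF mr[OF that(1)] c that(2)] that(1) by (simp add: \<Psi>_def)
  have lin: "Vector_Spaces.linear tscale fscale \<Psi>"
    unfolding Vector_Spaces.linear_iff
    using ts.vector_space_axioms fs.vector_space_axioms
    by (auto simp: \<Psi>_def fscale_def plus_fun_def fun_eq_iff differential_add_vector differential_tscale
        representative(1)[OF mr])
  have inj: "inj_on \<Psi> (tangent_vectors d J c)"
  proof (rule inj_onI)
    fix v w assume vw: "v \<in> tangent_vectors d J c" "w \<in> tangent_vectors d J c" "\<Psi> v = \<Psi> w"
    then have M: "v \<in> M d" "w \<in> M d" by (auto simp: tangent_vectors_def)
    have "coeff (v $ i) k = coeff (w $ i) k" for i k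
    proof -
      let ?u = "\<lambda>x :: tuple. coeff (x $ i) k - coeff (c $ i) k"
      have "?u \<in> ?m" unfolding maximal_ideal_at_def
        by (auto intro!: pf_regular pf_diff polynomial_functions.const)
      then have "differential ?u c v = differential ?u c w" using vw(3) M \<Psi> by (metis (no_types, lifting))
      then show ?thesis
        by (simp add: differential_diff differential_coord differential_const M_coord_polynomial
            polynomial_functions.const)
    qed
    then show "v = w" by (simp add: vec_eq_iff poly_eq_iff)
  qed
  have "zariski_tangent_space M_coords (M d) J c = \<Psi> ` tangent_vectors d J c"
  proof (rule set_eqI, rule iffI)
    fix \<theta> assume \<theta>: "\<theta> \<in> zariski_tangent_space M_coords (M d) J c"
    from tangent_space_functional[OF c this J] obtain v where
      v: "v \<in> M d" "\<And>g. g \<in> ?m \<Longrightarrow> \<theta> g = differential g c v" by blast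
    have out: "\<theta> g = 0" if "g \<notin> ?m" for g
      using \<theta> that unfolding zariski_tangent_space_def by (simp add: Let_def)
    have inJ: "\<theta> g = 0" if "g \<in> ?m" "g \<in> J" for g
      using \<theta> that unfolding zariski_tangent_space_def by (simp add: Let_def)
    have "\<theta> = \<Psi> v"
    proof
      fix g show "\<theta> g = \<Psi> v g" using v(2)[of g] \<Psi>[of g v] v(1) out[of g] by (cases "g \<in> ?m") (auto simp: \<Psi>_def)
    qed
    moreover have "v \<in> tangent_vectors d J c"
      using v inJ Jr Jc by (auto simp: tangent_vectors_def maximal_ideal_at_def subset_iff)
    ultimately show "\<theta> \<in> \<Psi> ` tangent_vectors d J c" by blast
  next
    fix \<theta> assume "\<theta> \<in> \<Psi> ` tangent_vectors d J c"
    then obtain v where v: "\<theta> = \<Psi> v" "v \<in> M d" "\<And>g. g \<in> J \<Longrightarrow> differential g c v = 0"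
      by (auto simp: tangent_vectors_def)
    note r = representative[OF mr]
    have 1: "(\<lambda>y. g y + h y) \<in> ?m \<and> differential (\<lambda>y. g y + h y) c v = differential g c v + differential h c v"
      if "g \<in> ?m" "h \<in> ?m" for g h
    proof -
      have "differential (\<lambda>y. g y + h y) c v = differential (\<lambda>y. representative d g y + representative d h y) c v"
        using r(2)[OF that(1)] r(2)[OF that(2)] by (intro differential_cong[of d] c v(2)) simp
      then show ?thesis using that r(3)[OF _ c v(2)]
        by (simp add: differential_add r(1) maximal_ideal_at_def regular_add)
    qed
    have 2: "(\<lambda>y. g y * h y) \<in> ?m \<and> differential (\<lambda>y. g y * h y) c v = 0"
      if "g \<in> ?m" "h \<in> ?m" for g h
    proof -
      have "differential (\<lambda>y. g y * h y) c v = differential (\<lambda>y. representative d g y * representative d h y) c v"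
        using r(2)[OF that(1)] r(2)[OF that(2)] by (intro differential_cong[of d] c v(2)) simp
      moreover have "representative d g c = 0" "representative d h c = 0"
        using r(2)[OF that(1) c] r(2)[OF that(2) c] that by (simp_all add: maximal_ideal_at_def)
      ultimately show ?thesis using that
        by (simp add: differential_mult r(1) maximal_ideal_at_def regular_mult)
    qed
    have 3: "(\<lambda>y. a * g y) \<in> ?m \<and> differential (\<lambda>y. a * g y) c v = a * differential g c v"
      if "g \<in> ?m" for a g
    proof -
      have "differential (\<lambda>y. a * g y) c v = differential (\<lambda>y. a * representative d g y) c v"
        using r(2)[OF that(1)] by (intro differential_cong[of d] c v(2)) simp
      then show ?thesis using that r(3)[OF _ c v(2)]
        by (simp add: differential_cmult r(1) maximal_ideal_at_def regular_cmult)
    qed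
    show "\<theta> \<in> zariski_tangent_space M_coords (M d) J c"
      unfolding zariski_tangent_space_def Let_def v(1)
      using 1 2 3 \<Psi>[OF _ v(2)] v(3) by (simp add: \<Psi>_def)
  qed
  moreover have "tangent_vectors d J c \<subseteq> ts.span (M_basis ` (UNIV \<times> {..d}))"
    by (auto simp: tangent_vectors_def simp flip: M_span)
  ultimately show ?thesis
    using ts_fs.dim_linear_image[OF lin subspace_tangent_vectors[OF Jr c] _ _ inj] by simp
qed

section \<open>The component and its image\<close>

text \<open>
  The forms \<open>b0, b1, b2\<close> are coefficient vectors of linear functionals dual to \<open>f0, f1, f2\<close>; they
  give the coordinates on the plane as polynomial functions of a quintic.
\<close>

locale quintic_component =
  fixes d :: nat and f0 f1 f2 :: form and b0 b1 b2 :: form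
    and t :: "nat \<Rightarrow> complex" and L :: "form set" and \<Gamma> :: "(tuple \<times> form) set"
  assumes d: "d \<ge> 1"
    and quintics: "f0 \<in> quintics" "f1 \<in> quintics" "f2 \<in> quintics"
    and dual_basis:
      "(\<Sum>e\<in>exponents 5. b0 e * f0 e) = 1" "(\<Sum>e\<in>exponents 5. b0 e * f1 e) = 0" "(\<Sum>e\<in>exponents 5. b0 e * f2 e) = 0"
      "(\<Sum>e\<in>exponents 5. b1 e * f0 e) = 0" "(\<Sum>e\<in>exponents 5. b1 e * f1 e) = 1" "(\<Sum>e\<in>exponents 5. b1 e * f2 e) = 0"
      "(\<Sum>e\<in>exponents 5. b2 e * f0 e) = 0" "(\<Sum>e\<in>exponents 5. b2 e * f1 e) = 0" "(\<Sum>e\<in>exponents 5. b2 e * f2 e) = 1"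
    and L: "open_in_plane f0 f1 f2 L" "f0 \<in> L"
    and comp: "irreducible_component MS_coords (incidence d L) \<Gamma>"
    and onto: "snd ` \<Gamma> = L"
begin

definition pairing :: "form \<Rightarrow> form \<Rightarrow> complex" where
  "pairing b f = (\<Sum>e\<in>exponents 5. b e * f e)"

lemma pairing_linear: "pairing b (\<lambda>e. x * f e + y * g e + z * h e) = x * pairing b f + y * pairing b g + z * pairing b h"
  by (simp add: pairing_def sum_distrib_left sum.distrib algebra_simps)

lemma pairing_dual [simp]:
  "pairing b0 f0 = 1" "pairing b0 f1 = 0" "pairing b0 f2 = 0"
  "pairing b1 f0 = 0" "pairing b1 f1 = 1" "pairing b1 f2 = 0"
  "pairing b2 f0 = 0" "pairing b2 f1 = 0" "pairing b2 f2 = 1"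
  by (simp_all add: pairing_def dual_basis)

abbreviation plane_form :: "complex \<Rightarrow> complex \<Rightarrow> complex \<Rightarrow> form" where
  "plane_form x y z \<equiv> \<lambda>e. x * f0 e + y * f1 e + z * f2 e"

lemma span_plane_form: "fs.span {f0, f1, f2} = {plane_form x y z | x y z. True}"
proof (rule set_eqI, rule iffI)
  fix f assume "f \<in> fs.span {f0, f1, f2}"
  then obtain x y z where "f - fscale x f0 - fscale y f1 - fscale z f2 = 0"
    unfolding fs.span_breakdown_eq fs.span_empty by blast
  then have "f e = plane_form x y z e" for e
    using fun_cong[of "f - fscale x f0 - fscale y f1 - fscale z f2" 0 e]
    by (simp add: fscale_def algebra_simps)
  then have "f = plane_form x y z" by (rule ext)
  then show "f \<in> {plane_form x y z | x y z. True}" by (intro CollectI exI conjI TrueI)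
next
  fix f assume "f \<in> {plane_form x y z | x y z. True}"
  then obtain x y z where "f = fscale x f0 + fscale y f1 + fscale z f2"
    by (auto simp: fscale_def plus_fun_def)
  then show "f \<in> fs.span {f0, f1, f2}"
    by (auto intro!: fs.span_add fs.span_scale intro: fs.span_base)
qed

lemma plane_eq: "plane f0 f1 f2 = {plane_form x y z | x y z. (x, y, z) \<noteq> (0, 0, 0)}"
proof -
  have c0: "plane_form x y z = 0 \<longleftrightarrow> (x, y, z) = (0, 0, 0)" for x y z
  proof
    assume *: "plane_form x y z = 0"
    have "pairing b (plane_form x y z) = 0" for b unfolding * by (simp add: pairing_def)
    from this[of b0] this[of b1] this[of b2] show "(x, y, z) = (0, 0, 0)"
      unfolding pairing_linear by simp
  qed (simp add: zero_fun_def)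
  show ?thesis
  proof (rule set_eqI, rule iffI)
    fix f assume "f \<in> plane f0 f1 f2"
    then obtain x y z where f: "f = plane_form x y z" "f \<noteq> 0" unfolding plane_def span_plane_form by auto
    then have "(x, y, z) \<noteq> (0, 0, 0)" using c0[of x y z] by simp
    then show "f \<in> {plane_form x y z | x y z. (x, y, z) \<noteq> (0, 0, 0)}"
      using f(1) by (intro CollectI exI conjI)
  next
    fix f assume "f \<in> {plane_form x y z | x y z. (x, y, z) \<noteq> (0, 0, 0)}"
    then obtain x y z where f: "f = plane_form x y z" "(x, y, z) \<noteq> (0, 0, 0)" by (elim CollectE exE conjE)
    then have "f \<noteq> 0" using c0[of x y z] by simp
    moreover have "f \<in> {plane_form x y z | x y z. True}" using f(1) by (intro CollectI exI conjI TrueI)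
    ultimately show "f \<in> plane f0 f1 f2" unfolding plane_def span_plane_form by simp
  qed
qed

lemma L_coordinates:
  assumes "f \<in> L"
  shows "f = plane_form (pairing b0 f) (pairing b1 f) (pairing b2 f)"
    "(pairing b0 f, pairing b1 f, pairing b2 f) \<noteq> (0, 0, 0)"
proof -
  have "f \<in> plane f0 f1 f2" using assms L by (auto simp: open_in_plane_def)
  then obtain x y z where f: "f = plane_form x y z" "(x, y, z) \<noteq> (0, 0, 0)"
    unfolding plane_eq by (elim CollectE exE conjE)
  then show "f = plane_form (pairing b0 f) (pairing b1 f) (pairing b2 f)" "(pairing b0 f, pairing b1 f, pairing b2 f) \<noteq> (0, 0, 0)"
    unfolding f(1) pairing_linear by simp_all
qed

lemma L_quintics: "L \<subseteq> quintics"
proof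
  fix f assume "f \<in> L"
  have "plane_form (pairing b0 f) (pairing b1 f) (pairing b2 f) \<in> quintics"
    using quintics by (simp add: forms_def)
  then show "f \<in> quintics" using L_coordinates(1)[OF \<open>f \<in> L\<close>] by simp
qed

lemma incidenceD:
  assumes "(c, f) \<in> \<Gamma>"
  shows "c \<in> M d" "c \<in> M_bir d" "f \<in> L" "pullback f c = 0"
proof -
  have "(c, f) \<in> incidence d L"
    using assms comp unfolding irreducible_component_def zariski_closed_def by blast
  then show "c \<in> M d" "c \<in> M_bir d" "f \<in> L" "pullback f c = 0" by (auto simp: incidence_def M_bir_def)
qed

lemma \<Gamma>_subset: "\<Gamma> \<subseteq> M d \<times> quintics"
  using incidenceD L_quintics by fast

lemma \<Gamma>_nonempty: "\<Gamma> \<noteq> {}"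
  using onto L by auto

lemma \<Gamma>_prime:
  assumes "u \<in> polynomial_functions MS_coords" "w \<in> polynomial_functions MS_coords"
    "x \<in> \<Gamma>" "u x \<noteq> 0" "y \<in> \<Gamma>" "w y \<noteq> 0"
  shows "\<exists>z\<in>\<Gamma>. u z \<noteq> 0 \<and> w z \<noteq> 0"
proof -
  have "zariski_irreducible MS_coords \<Gamma>" using comp by (simp add: irreducible_component_def)
  then have "\<not> (\<forall>z\<in>\<Gamma>. u z * w z = 0)"
    unfolding zariski_irreducible_iff_prime using assms by blast
  then show ?thesis by auto
qed

lemma pf_fst:
  assumes "p \<in> polynomial_functions M_coords"
  shows "(\<lambda>x. p (fst x)) \<in> polynomial_functions MS_coords"
  using assms
proof (rule pf_compose)
  fix u assume "u \<in> M_coords"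
  then have "(\<lambda>(c, f). u c) \<in> MS_coords" by (auto simp: MS_coords_def)
  then show "(\<lambda>x. u (fst x)) \<in> polynomial_functions MS_coords"
    by (intro polynomial_functions.coord) (simp add: case_prod_unfold)
qed

lemma pf_snd: "(\<lambda>x. snd x e) \<in> polynomial_functions (MS_coords :: (tuple \<times> form \<Rightarrow> complex) set)"
proof -
  have "(\<lambda>(c, f). f e) \<in> MS_coords" by (auto simp: MS_coords_def form_coords_def)
  then show ?thesis by (intro polynomial_functions.coord) (simp add: case_prod_unfold)
qed

lemma pf_pairing: "(\<lambda>x. pairing b (snd x)) \<in> polynomial_functions MS_coords"
  unfolding pairing_def by (intro pf_intros pf_snd)

text \<open>
  The reparametrizations preserve the incidence set, hence its irreducible component.
\<close>

lemma flow_in_\<Gamma>: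
  assumes s: "(1 + s * a) * (1 + s * h) - (s * b) * (s * g) \<noteq> 0" and cf: "(c, f) \<in> \<Gamma>"
  shows "(flow d a b g h c s, f) \<in> \<Gamma>"
proof -
  let ?S = "{s :: complex. (1 + s * a) * (1 + s * h) - (s * b) * (s * g) \<noteq> 0}"
  let ?\<rho> = "\<lambda>s (c, f). (flow d a b g h c s, f) :: tuple \<times> form"
  have "?\<rho> s (c, f) \<in> \<Gamma>"
  proof (rule component_invariant[where \<rho> = ?\<rho>, OF comp flow_invertible_infinite[of a h b g]])
    show "0 \<in> ?S" by simp
    show "?\<rho> 0 x = x" if "x \<in> \<Gamma>" for x
      using that incidenceD(1)[of "fst x" "snd x"] by (simp add: flow_0 case_prod_unfold)
    show "?\<rho> s x \<in> incidence d L" if "s \<in> ?S" "x \<in> \<Gamma>" for s x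
    proof -
      have "x \<in> incidence d L" using that comp by (auto simp: irreducible_component_def zariski_closed_def)
      then show "?\<rho> s x \<in> incidence d L"
        using that(1) by (cases x) (auto simp: flow_def intro!: incidence_act)
    qed
    fix u :: "tuple \<times> form \<Rightarrow> complex" assume u: "u \<in> MS_coords"
    then consider i k where "u = (\<lambda>(c, f). coeff (c $ i) k)" | e where "u = (\<lambda>(c, f). f e)"
      by (auto simp: MS_coords_def M_coords_def form_coords_def)
    note cs = this
    show "is_poly (\<lambda>s. u (?\<rho> s x))" for x
      using cs by cases (auto simp: case_prod_unfold intro: flow_is_poly is_poly_intros)
    show "(\<lambda>x. u (?\<rho> s x)) \<in> polynomial_functions MS_coords" for s
      using cs
    proof cases
      case (1 i k)
      have "(\<lambda>c. coeff (flow d a b g h c s $ i) k) \<in> polynomial_functions M_coords"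
        by (auto simp: flow_def act_def coeff_sum intro!: pf_intros)
      from pf_fst[OF this] show ?thesis by (simp add: 1 case_prod_unfold)
    next
      case (2 e)
      then show ?thesis using pf_snd by (simp add: case_prod_unfold)
    qed
  qed (use s cf in auto)
  then show ?thesis by simp
qed

abbreviation I :: "(tuple \<Rightarrow> complex) set" where "I \<equiv> image_ideal d (reduced_ideal d \<Gamma>)"
abbreviation V :: "tuple set" where "V \<equiv> image_points d \<Gamma>"

lemma pf_fst_regular:
  assumes "g \<in> regular M_coords (M d)"
  shows "(\<lambda>(c, f). g c) \<in> regular MS_coords (M d \<times> quintics)"
proof -
  obtain p where p: "p \<in> polynomial_functions M_coords" "\<And>x. x \<in> M d \<Longrightarrow> g x = p x"
    using regularE[OF assms] by blast
  then show ?thesis by (intro regularI[OF pf_fst[OF p(1)]]) auto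
qed

lemma I_iff: "g \<in> I \<longleftrightarrow> g \<in> regular M_coords (M d) \<and> (\<forall>(c, f)\<in>\<Gamma>. g c = 0)"
  unfolding image_ideal_def reduced_ideal_def using pf_fst_regular by auto

lemma V_subset: "V \<subseteq> M d" and \<Gamma>_V: "(c, f) \<in> \<Gamma> \<Longrightarrow> c \<in> V"
  using incidenceD(1) by (auto simp: image_points_def I_iff)

lemma V_vanish: "g \<in> regular M_coords (M d) \<Longrightarrow> (\<And>c f. (c, f) \<in> \<Gamma> \<Longrightarrow> g c = 0) \<Longrightarrow> c \<in> V \<Longrightarrow> g c = 0"
  using I_iff[of g] unfolding image_points_def by fast

lemma V_witness:
  assumes "g \<in> regular M_coords (M d)" "c \<in> V" "g c \<noteq> 0"
  shows "\<exists>x\<in>\<Gamma>. g (fst x) \<noteq> 0"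
proof (rule ccontr)
  assume "\<not> ?thesis"
  then have "g c' = 0" if "(c', f) \<in> \<Gamma>" for c' f using that by force
  from V_vanish[OF assms(1) this assms(2)] show False using assms(3) by simp
qed

lemma I_iff_V: "g \<in> I \<longleftrightarrow> g \<in> regular M_coords (M d) \<and> (\<forall>c\<in>V. g c = 0)"
  using V_witness[of g] \<Gamma>_V by (fastforce simp: I_iff)

text \<open>
  A product that vanishes on \<open>V\<close> vanishes on the irreducible set \<open>\<Gamma>\<close> when pulled back.
\<close>

lemma V_prime:
  assumes "u \<in> regular M_coords (M d)" "w \<in> regular M_coords (M d)" "\<And>c. c \<in> V \<Longrightarrow> u c * w c = 0"
  shows "(\<forall>c\<in>V. u c = 0) \<or> (\<forall>c\<in>V. w c = 0)"
proof (rule ccontr)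
  obtain p where p: "p \<in> polynomial_functions M_coords" "\<And>x. x \<in> M d \<Longrightarrow> u x = p x"
    using regularE[OF assms(1)] by blast
  obtain q where q: "q \<in> polynomial_functions M_coords" "\<And>x. x \<in> M d \<Longrightarrow> w x = q x"
    using regularE[OF assms(2)] by blast
  assume "\<not> ?thesis"
  then obtain c1 c2 where "c1 \<in> V" "u c1 \<noteq> 0" "c2 \<in> V" "w c2 \<noteq> 0" by blast
  then obtain x y where xy: "x \<in> \<Gamma>" "y \<in> \<Gamma>" "u (fst x) \<noteq> 0" "w (fst y) \<noteq> 0"
    using V_witness[OF assms(1)] V_witness[OF assms(2)] by metis
  then have "fst x \<in> M d" "fst y \<in> M d" using \<Gamma>_subset by auto
  then obtain z where z: "z \<in> \<Gamma>" "p (fst z) \<noteq> 0" "q (fst z) \<noteq> 0"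
    using \<Gamma>_prime[OF pf_fst[OF p(1)] pf_fst[OF q(1)] xy(1) _ xy(2)] xy p(2) q(2) by auto
  then have "fst z \<in> V" "fst z \<in> M d" using \<Gamma>_V[of "fst z" "snd z"] \<Gamma>_subset by auto
  then show False using assms(3) z p(2) q(2) by force
qed

lemma incidence_ideal_vanish:
  assumes "p \<in> incidence_ideal d f0 f1 f2" "x \<in> \<Gamma>"
  shows "p x = 0"
proof -
  obtain c f where x: "x = (c, f)" by (cases x)
  have f: "f \<in> L" "pullback f c = 0" "x \<in> M d \<times> quintics" using incidenceD[of c f] assms(2) \<Gamma>_subset x by auto
  have "(\<Sum>e\<in>exponents 5. b e * f e) = 0" if "\<forall>g\<in>{f0, f1, f2}. (\<Sum>e\<in>exponents 5. b e * g e) = 0" for b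
  proof -
    have "pairing b f = pairing b (plane_form (pairing b0 f) (pairing b1 f) (pairing b2 f))" using L_coordinates(1)[OF f(1)] by simp
    also have "\<dots> = 0" unfolding pairing_linear using that by (simp add: pairing_def)
    finally show ?thesis by (simp add: pairing_def)
  qed
  then show ?thesis
    using assms(1) f unfolding incidence_ideal_def ideal_generated_def x
    by (force intro!: sum.neutral)
qed

text \<open>
  The ideal of the image when \<open>\<Gamma>\<close> carries the scheme structure of the incidence scheme near its generic
  point. It is contained in \<open>I\<close>, so the tangent space that it defines contains the one of \<open>I\<close>.
\<close>

abbreviation J :: "(tuple \<Rightarrow> complex) set" where "J \<equiv> image_ideal d (generic_ideal d f0 f1 f2 \<Gamma>)"

lemma J_subset_I: "J \<subseteq> I"
proof
  fix g assume "g \<in> J"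
  then have g: "g \<in> regular M_coords (M d)" and "(\<lambda>(c, f). g c) \<in> generic_ideal d f0 f1 f2 \<Gamma>"
    by (auto simp: image_ideal_def)
  then obtain h x where h: "h \<in> regular MS_coords (M d \<times> quintics)" "x \<in> \<Gamma>" "h x \<noteq> 0"
    "(\<lambda>x. h x * (case x of (c, f) \<Rightarrow> g c)) \<in> incidence_ideal d f0 f1 f2"
    by (auto simp: generic_ideal_def)
  obtain p where p: "p \<in> polynomial_functions M_coords" "\<And>x. x \<in> M d \<Longrightarrow> g x = p x"
    using regularE[OF g] by blast
  obtain q where q: "q \<in> polynomial_functions MS_coords" "\<And>x. x \<in> M d \<times> quintics \<Longrightarrow> h x = q x"
    using regularE[OF h(1)] by blast
  have "g c = 0" if cf: "(c, f) \<in> \<Gamma>" for c f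
  proof (rule ccontr)
    assume "g c \<noteq> 0"
    then have "p (fst (c, f)) \<noteq> 0" using p(2) incidenceD(1)[OF cf] by simp
    moreover have "q x \<noteq> 0" using q(2) h(2,3) \<Gamma>_subset by auto
    ultimately obtain z where z: "z \<in> \<Gamma>" "q z \<noteq> 0" "p (fst z) \<noteq> 0"
      using \<Gamma>_prime[OF q(1) pf_fst[OF p(1)] h(2) _ cf] by blast
    have zM: "z \<in> M d \<times> quintics" using z(1) \<Gamma>_subset by blast
    then have "h z * g (fst z) \<noteq> 0" using z p(2)[of "fst z"] q(2)[OF zM] by auto
    then show False using incidence_ideal_vanish[OF h(4) z(1)] by (simp add: case_prod_unfold)
  qed
  then show "g \<in> I" using g by (auto simp: I_iff)
qed

lemma J_trivial:
  assumes "g \<in> regular M_coords (M d)" "\<And>x. x \<in> M d \<Longrightarrow> g x = 0"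
  shows "g \<in> J"
proof -
  have "(\<lambda>x. 1 * (case x of (c, f) \<Rightarrow> g c)) \<in> incidence_ideal d f0 f1 f2"
    unfolding incidence_ideal_def ideal_generated_def using assms(2)
    by (auto intro!: exI[of _ "0 :: nat"])
  then show ?thesis
    unfolding image_ideal_def generic_ideal_def
    using assms(1) pf_fst_regular[OF assms(1)] \<Gamma>_nonempty one_regular
    by (auto intro!: bexI[of _ "\<lambda>_. 1"])
qed

end

section \<open>Ideals given by generators\<close>

lemma ideal_generated_base:
  "g \<in> G \<Longrightarrow> q \<in> regular C X \<Longrightarrow> (\<And>x. x \<in> X \<Longrightarrow> p x = q x * g x) \<Longrightarrow> p \<in> ideal_generated C X G"
  unfolding ideal_generated_def
  by (intro CollectI exI[of _ "1 :: nat"] exI[of _ "\<lambda>_. q"] exI[of _ "\<lambda>_. g"]) simp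

lemma ideal_generated_add:
  assumes "p \<in> ideal_generated C X G" "p' \<in> ideal_generated C X G"
  shows "(\<lambda>x. p x + p' x) \<in> ideal_generated C X G"
proof -
  obtain n q g where 1: "\<forall>j<n. q j \<in> regular C X \<and> g j \<in> G" "\<forall>x\<in>X. p x = (\<Sum>j<(n::nat). q j x * g j x)"
    using assms(1) unfolding ideal_generated_def by auto
  obtain m q' g' where 2: "\<forall>j<m. q' j \<in> regular C X \<and> g' j \<in> G" "\<forall>x\<in>X. p' x = (\<Sum>j<(m::nat). q' j x * g' j x)"
    using assms(2) unfolding ideal_generated_def by auto
  let ?q = "\<lambda>j. if j < n then q j else q' (j - n)" and ?g = "\<lambda>j. if j < n then g j else g' (j - n)"
  have split: "(\<Sum>j<n+m. f j) = (\<Sum>j<n. f j) + (\<Sum>j<m. f (n + j))" for f :: "nat \<Rightarrow> complex"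
    by (induction m) (auto simp: add.assoc)
  have "p x + p' x = (\<Sum>j<n+m. ?q j x * ?g j x)" if "x \<in> X" for x
    unfolding split using 1(2) 2(2) that by (auto intro!: arg_cong2[where f = "(+)"] sum.cong)
  moreover have "\<forall>j<n+m. ?q j \<in> regular C X \<and> ?g j \<in> G" using 1(1) 2(1) by auto
  ultimately show ?thesis
    unfolding ideal_generated_def
    by (intro CollectI exI[of _ "n + m"] exI[of _ ?q] exI[of _ ?g] conjI ballI)
qed

lemma ideal_generated_0: "(\<And>x. x \<in> X \<Longrightarrow> p x = 0) \<Longrightarrow> p \<in> ideal_generated C X G"
  unfolding ideal_generated_def by (intro CollectI exI[of _ "0 :: nat"]) simp

lemma ideal_generated_sum:
  assumes "finite A" "\<And>a. a \<in> A \<Longrightarrow> p a \<in> ideal_generated C X G"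
  shows "(\<lambda>x. \<Sum>a\<in>A. p a x) \<in> ideal_generated C X G"
  using assms by (induction A) (auto intro: ideal_generated_add ideal_generated_0)

lemma ideal_generated_mult:
  assumes "p \<in> ideal_generated C X G" "r \<in> regular C X"
  shows "(\<lambda>x. r x * p x) \<in> ideal_generated C X G"
proof -
  obtain n q g where 1: "\<forall>j<n. q j \<in> regular C X \<and> g j \<in> G" "\<forall>x\<in>X. p x = (\<Sum>j<(n::nat). q j x * g j x)"
    using assms(1) unfolding ideal_generated_def by blast
  have "\<forall>j<n. (\<lambda>x. r x * q j x) \<in> regular C X \<and> g j \<in> G"
  proof (intro allI impI conjI)
    fix j assume "j < n"
    then show "g j \<in> G" "(\<lambda>x. r x * q j x) \<in> regular C X"
      using 1(1) regular_mult[OF assms(2), of "q j"] by blast+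
  qed
  moreover have "\<forall>x\<in>X. r x * p x = (\<Sum>j<n. r x * q j x * g j x)"
    using 1(2) by (simp add: sum_distrib_left mult.assoc)
  ultimately show ?thesis
    unfolding ideal_generated_def
    by (intro CollectI exI[of _ n] exI[of _ "\<lambda>j x. r x * q j x"] exI[of _ g] conjI)
qed

lemma ideal_generated_cong:
  assumes "p \<in> ideal_generated C X G" "\<And>x. x \<in> X \<Longrightarrow> p' x = p x"
  shows "p' \<in> ideal_generated C X G"
proof -
  obtain n q g where 1: "\<forall>j<n. q j \<in> regular C X \<and> g j \<in> G" "\<forall>x\<in>X. p x = (\<Sum>j<(n::nat). q j x * g j x)"
    using assms(1) unfolding ideal_generated_def by blast
  have "\<forall>x\<in>X. p' x = (\<Sum>j<n. q j x * g j x)" using 1(2) assms(2) by simp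
  with 1(1) show ?thesis
    unfolding ideal_generated_def by (intro CollectI exI[of _ n] exI[of _ q] exI[of _ g] conjI)
qed

context quintic_component
begin

section \<open>The determinants and the upper bound\<close>

text \<open>
  The value of a quintic at the point of the curve with parameter \<open>\<tau>\<close>. The homogeneous form of the
  evaluation is a polynomial function of \<open>c\<close> on the whole space of tuples, not only on \<open>M d\<close>.
\<close>

definition value_at :: "form \<Rightarrow> complex \<Rightarrow> tuple \<Rightarrow> complex" where
  "value_at f \<tau> c = form_eval 5 f (hom_value d c \<tau> 1)"

lemma value_at_polynomial: "value_at f \<tau> \<in> polynomial_functions M_coords"
  using form_eval_polynomial[of 5 f d \<tau> 1] by (simp add: value_at_def[abs_def])

lemma value_at_affine: "c \<in> M d \<Longrightarrow> value_at f \<tau> c = form_eval 5 f (affine_value c \<tau>)"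
  by (simp add: value_at_def hom_value_affine)

lemma form_eval_plane_form:
  "form_eval 5 (plane_form x y z) p = x * form_eval 5 f0 p + y * form_eval 5 f1 p + z * form_eval 5 f2 p"
  by (simp add: form_eval_def sum_distrib_left sum.distrib algebra_simps)

lemma value_at_plane_form: "value_at (plane_form x y z) \<tau> c = x * value_at f0 \<tau> c + y * value_at f1 \<tau> c + z * value_at f2 \<tau> c"
  by (simp add: value_at_def form_eval_plane_form)

lemma value_at_\<Gamma>:
  assumes "(c, f) \<in> \<Gamma>"
  shows "pairing b0 f * value_at f0 \<tau> c + pairing b1 f * value_at f1 \<tau> c + pairing b2 f * value_at f2 \<tau> c = 0"
proof -
  have "value_at f \<tau> c = poly (pullback f c) \<tau>"
    using incidenceD(1)[OF assms] by (simp add: value_at_affine poly_pullback)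
  also have "\<dots> = 0" using incidenceD(4)[OF assms] by simp
  finally have "value_at f \<tau> c = 0" .
  moreover have "value_at f \<tau> c = value_at (plane_form (pairing b0 f) (pairing b1 f) (pairing b2 f)) \<tau> c"
    by (rule arg_cong[OF L_coordinates(1)[OF incidenceD(3)[OF assms]]])
  ultimately show ?thesis unfolding value_at_plane_form by simp
qed

text \<open>
  The determinant in the definition of \<open>\<phi>\<^sub>i\<close>, expanded along the column of \<open>f0\<close>.
\<close>

definition incidence_det :: "nat \<Rightarrow> tuple \<Rightarrow> complex" where
  "incidence_det i c = value_at f0 (t i) c * (value_at f2 (t 1) c * value_at f1 (t 2) c - value_at f1 (t 1) c * value_at f2 (t 2) c)
         + value_at f0 (t 1) c * (value_at f1 (t i) c * value_at f2 (t 2) c - value_at f2 (t i) c * value_at f1 (t 2) c)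
         + value_at f0 (t 2) c * (value_at f2 (t i) c * value_at f1 (t 1) c - value_at f1 (t i) c * value_at f2 (t 1) c)"

lemma incidence_det_polynomial: "incidence_det i \<in> polynomial_functions M_coords"
  unfolding incidence_det_def[abs_def] by (intro pf_intros value_at_polynomial)

lemma phi_incidence_det:
  assumes "c \<in> M d" "v \<in> M d"
  shows "phi f0 f1 f2 t i c v = differential (incidence_det i) c v"
  unfolding phi_def
proof (rule differential_cong[of d])
  fix c assume c: "c \<in> M d"
  show "(let val = (\<lambda>f j. form_eval 5 f (affine_value c (t j))) in
       det (vector [vector [val f2 i, val f1 i, val f0 i],
                    vector [val f2 1, val f1 1, val f0 1],
                    vector [val f2 2, val f1 2, val f0 2]] :: complex ^ 3 ^ 3)) = incidence_det i c"
    unfolding Let_def det_3 value_at_affine[OF c, symmetric] incidence_det_def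
    by (simp add: vector_3 algebra_simps)
qed (use assms in auto)

text \<open>
  Cramer's rule in the coordinate ring. For \<open>x = (c, f)\<close> let \<open>a\<^sub>j\<close> be the plane coordinates of \<open>f\<close>. The
  combination \<open>?S \<tau>\<close> of the values of the \<open>f\<^sub>j\<close> at the parameter \<open>\<tau>\<close> with coefficients \<open>a\<^sub>j\<close> is the value of
  \<open>f\<close> up to the linear equations of the plane, so it lies in the incidence ideal. Eliminating \<open>a\<^sub>1\<close> and
  \<open>a\<^sub>2\<close> shows that \<open>a\<^sub>0\<close> times the determinant lies in it too, and \<open>a\<^sub>0\<close> is 1 at a point over \<open>f0\<close>.
\<close>

lemma incidence_det_in_J: "incidence_det i \<in> J"
proof -
  let ?X = "M d \<times> quintics"
  let ?Gen = "{\<lambda>(c, f). coeff (pullback f c) k | k. True} \<union>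
        {\<lambda>(c, f). (\<Sum>e\<in>exponents 5. b e * f e) | b.
            \<forall>g\<in>{f0, f1, f2}. (\<Sum>e\<in>exponents 5. b e * g e) = 0} :: (tuple \<times> form \<Rightarrow> complex) set"
  let ?ID = "ideal_generated MS_coords ?X ?Gen"
  let ?S = "\<lambda>\<tau> x. pairing b0 (snd x) * value_at f0 \<tau> (fst x) + pairing b1 (snd x) * value_at f1 \<tau> (fst x)
      + pairing b2 (snd x) * value_at f2 \<tau> (fst x)"
  let ?\<delta> = "\<lambda>e f. f e - plane_form (pairing b0 f) (pairing b1 f) (pairing b2 f) e"
  let ?mon = "\<lambda>e \<tau> c. \<Prod>i\<in>UNIV. (hom_value d c \<tau> 1 $ i) ^ e i"
  have ev_reg: "(\<lambda>x. value_at f \<tau> (fst x)) \<in> regular MS_coords ?X" for f \<tau>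
    by (intro pf_regular pf_fst value_at_polynomial)
  have S: "?S \<tau> \<in> ?ID" for \<tau>
  proof (rule ideal_generated_cong)
    show "(\<lambda>x. (\<Sum>k\<in>{..5 * d}. \<tau> ^ k * coeff (pullback (snd x) (fst x)) k)
        + (\<Sum>e\<in>exponents 5. (- ?mon e \<tau> (fst x)) * ?\<delta> e (snd x))) \<in> ?ID"
    proof (intro ideal_generated_add ideal_generated_sum finite_atMost finite_exponents)
      show "(\<lambda>x. \<tau> ^ k * coeff (pullback (snd x) (fst x)) k) \<in> ?ID" for k
        by (rule ideal_generated_base[of "\<lambda>(c, f). coeff (pullback f c) k" _ "\<lambda>_. \<tau> ^ k"])
           (auto intro: pf_regular polynomial_functions.const)
      fix e assume e: "e \<in> exponents (5 :: nat)"
      define b where "b e' = (if e' = e then 1 else 0) - (b0 e' * f0 e + b1 e' * f1 e + b2 e' * f2 e)" for e'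
      have b: "pairing b f = ?\<delta> e f" for f
      proof -
        have "pairing b f = (\<Sum>e'\<in>exponents 5. (if e' = e then f e' else 0))
            - (pairing b0 f * f0 e + pairing b1 f * f1 e + pairing b2 f * f2 e)"
          unfolding pairing_def b_def sum_distrib_right sum.distrib[symmetric] sum_subtractf[symmetric]
          by (intro sum.cong) (auto simp: algebra_simps)
        then show ?thesis using e finite_exponents by simp
      qed
      have "\<forall>g\<in>{f0, f1, f2}. (\<Sum>e'\<in>exponents 5. b e' * g e') = 0"
        using b[of f0] b[of f1] b[of f2] by (simp add: pairing_def[of b, symmetric])
      then have "(\<lambda>(c, f). (\<Sum>e'\<in>exponents 5. b e' * f e')) \<in> ?Gen"
        by (intro UnI2 CollectI exI[of _ b] conjI refl)
      then show "(\<lambda>x. (- ?mon e \<tau> (fst x)) * ?\<delta> e (snd x)) \<in> ?ID"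
      proof (rule ideal_generated_base)
        show "(\<lambda>x. - ?mon e \<tau> (fst x)) \<in> regular MS_coords ?X"
          by (intro pf_regular pf_intros pf_fst hom_value_polynomial)
        show "- ?mon e \<tau> (fst x) * ?\<delta> e (snd x)
            = - ?mon e \<tau> (fst x) * (case x of (c, f) \<Rightarrow> \<Sum>e'\<in>exponents 5. b e' * f e')" for x
          by (simp only: b[symmetric] pairing_def[of b] case_prod_unfold)
      qed
    qed
    fix x assume "x \<in> ?X"
    then obtain c f where x: "x = (c, f)" and c: "c \<in> M d" by auto
    have "(\<Sum>k\<le>5 * d. \<tau> ^ k * coeff (pullback f c) k) = value_at f \<tau> c"
      using poly_coeff_sum[OF degree_pullback[OF c, of f], of \<tau>] poly_pullback[of f c \<tau>] c
      by (simp add: value_at_affine mult.commute)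
    moreover have "(\<Sum>e\<in>exponents 5. (- ?mon e \<tau> c) * ?\<delta> e f)
        = value_at (plane_form (pairing b0 f) (pairing b1 f) (pairing b2 f)) \<tau> c - value_at f \<tau> c"
      unfolding value_at_def form_eval_def sum_subtractf[symmetric]
      by (intro sum.cong refl) (simp add: algebra_simps)
    ultimately show "?S \<tau> x = (\<Sum>k\<in>{..5 * d}. \<tau> ^ k * coeff (pullback (snd x) (fst x)) k)
        + (\<Sum>e\<in>exponents 5. (- ?mon e \<tau> (fst x)) * ?\<delta> e (snd x))"
      by (simp add: x value_at_plane_form)
  qed
  have "(\<lambda>x. (value_at f2 (t 1) (fst x) * value_at f1 (t 2) (fst x) - value_at f1 (t 1) (fst x) * value_at f2 (t 2) (fst x)) * ?S (t i) x
      + (value_at f1 (t i) (fst x) * value_at f2 (t 2) (fst x) - value_at f2 (t i) (fst x) * value_at f1 (t 2) (fst x)) * ?S (t 1) x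
      + (value_at f2 (t i) (fst x) * value_at f1 (t 1) (fst x) - value_at f1 (t i) (fst x) * value_at f2 (t 1) (fst x)) * ?S (t 2) x) \<in> ?ID"
    by (intro ideal_generated_add ideal_generated_mult S pf_regular pf_intros pf_fst value_at_polynomial)
  then have "(\<lambda>x. pairing b0 (snd x) * (case x of (c, f) \<Rightarrow> incidence_det i c)) \<in> ?ID"
    by (rule ideal_generated_cong) (simp add: incidence_det_def case_prod_unfold algebra_simps)
  moreover have "(\<lambda>x. pairing b0 (snd x)) \<in> regular MS_coords ?X"
    by (intro pf_regular pf_pairing)
  moreover obtain x where "x \<in> \<Gamma>" "snd x = f0" using onto L(2) by auto
  then have "\<exists>x\<in>\<Gamma>. pairing b0 (snd x) \<noteq> 0" by (intro bexI[of _ x]) simp_all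
  ultimately have "(\<lambda>(c, f). incidence_det i c) \<in> generic_ideal d f0 f1 f2 \<Gamma>"
    unfolding generic_ideal_def incidence_ideal_def
    by (intro CollectI conjI pf_fst_regular[OF pf_regular[OF incidence_det_polynomial]]
        bexI[of _ "\<lambda>x. pairing b0 (snd x)"])
  then show ?thesis
    unfolding image_ideal_def by (intro CollectI conjI pf_regular[OF incidence_det_polynomial])
qed

text \<open>
  The \<open>\<phi>\<^sub>i\<close> are differentials of equations of the image, so they kill its tangent vectors, while a nonzero
  value of \<open>omega\<close> provides \<open>5 d - 1\<close> vectors that are independent modulo their common kernel.
\<close>

lemma dim_tangent_le:
  assumes K: "J \<subseteq> K" "K \<subseteq> I" and c: "c \<in> V" and v: "\<forall>j\<in>{3..5 * d + 1}. v j \<in> M d"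
    and nz: "omega d f0 f1 f2 t c v \<noteq> 0"
  shows "ts.dim (tangent_vectors d K c) \<le> 6"
proof -
  let ?A = "{3..5 * d + 1}" and ?T = "M_basis ` (UNIV \<times> {..d})"
  have cM: "c \<in> M d" using c V_subset by blast
  have Kr: "K \<subseteq> regular M_coords (M d)" using K(2) by (auto simp: I_iff)
  have "ts.dim (tangent_vectors d K c) + card ?A \<le> card ?T"
  proof (rule ts.dim_upper_bound)
    show "ts.subspace (tangent_vectors d K c)" by (rule subspace_tangent_vectors[OF Kr cM])
    show "tangent_vectors d K c \<subseteq> ts.span ?T"
      unfolding M_span[symmetric] by (auto simp: tangent_vectors_def)
    show "v ` ?A \<subseteq> ts.span ?T" unfolding M_span[symmetric] using v by auto
    fix a assume w: "(\<Sum>j\<in>?A. tscale (a j) (v j)) \<in> tangent_vectors d K c"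
    have sum: "differential (incidence_det i) c (\<Sum>j\<in>A. tscale (a j) (v j)) = (\<Sum>j\<in>A. a j * differential (incidence_det i) c (v j))" for i A
    proof (induction A rule: infinite_finite_induct)
      case empty
      show ?case using differential_tscale[OF incidence_det_polynomial, of _ c 0 0] by simp
    next
      case (infinite A)
      then show ?case using differential_tscale[OF incidence_det_polynomial, of _ c 0 0] by simp
    next
      case (insert x A)
      then show ?case
        by (simp add: differential_add_vector[OF incidence_det_polynomial] differential_tscale[OF incidence_det_polynomial])
    qed
    have dep: "(\<Sum>j\<in>?A. phi f0 f1 f2 t i c (v j) * a j) = 0" for i
    proof -
      have "(\<Sum>j\<in>?A. a j * differential (incidence_det i) c (v j)) = 0"
        unfolding sum[symmetric] using w subsetD[OF K(1) incidence_det_in_J] unfolding tangent_vectors_def by blast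
      then show ?thesis using v cM by (simp add: phi_incidence_det mult.commute)
    qed
    show "\<forall>j\<in>?A. a j = 0"
    proof (rule ballI, rule ccontr)
      fix j assume "j \<in> ?A" "a j \<noteq> 0"
      with minor_dependent_columns[where R = ?A and l = a and a = "\<lambda>i j. phi f0 f1 f2 t i c (v j)", OF _ dep]
      show False using nz unfolding omega_minor by blast
    qed
  qed auto
  then show ?thesis using d by (simp add: card_M_basis)
qed

section \<open>Linear independence of the differential forms\<close>

lemma phi_regular:
  assumes "v \<in> M d"
  shows "(\<lambda>c. phi f0 f1 f2 t i c v) \<in> regular M_coords (M d)"
  by (rule regularI[OF differential_along_polynomial_field[OF incidence_det_polynomial[of i], of "\<lambda>_. v"]])
     (auto simp: phi_incidence_det assms intro: polynomial_functions.const)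

lemma omega_regular:
  assumes "\<forall>j\<in>{3..5 * d + 1}. v j \<in> M d"
  shows "(\<lambda>c. omega d f0 f1 f2 t c v) \<in> regular M_coords (M d)"
  unfolding omega_minor using assms by (intro minor_regular phi_regular) auto

text \<open>
  A relation with coefficients \<open>g i\<close> is a dependency between the rows of the matrix of values. Therefore
  \<open>g i\<close> times \<open>omega\<close> vanishes on \<open>V\<close>, and \<open>I\<close> is prime.
\<close>

lemma omega_nonzero_imp_independent:
  assumes "omega_nonzero_on d f0 f1 f2 t V"
  shows "phi_independent_mod d f0 f1 f2 t I"
  unfolding phi_independent_mod_def
proof (intro allI impI ballI)
  let ?A = "{3..5 * d + 1}"
  fix g i assume g: "\<forall>i\<in>?A. g i \<in> regular M_coords (M d)"
    and rel: "\<forall>v\<in>M d. (\<lambda>c. \<Sum>i\<in>?A. g i c * phi f0 f1 f2 t i c v) \<in> I" and i: "i \<in> ?A"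
  obtain c v where c: "c \<in> V" and v: "\<forall>j\<in>?A. v j \<in> M d" and nz: "omega d f0 f1 f2 t c v \<noteq> 0"
    using assms unfolding omega_nonzero_on_def by blast
  have "g i x * omega d f0 f1 f2 t x v = 0" if x: "x \<in> V" for x
  proof (cases "g i x = 0")
    case False
    have "minor ?A (\<lambda>i j. phi f0 f1 f2 t i x (v j)) = 0"
    proof (rule minor_dependent_rows[where l = "\<lambda>i. g i x"])
      show "(\<Sum>i\<in>?A. g i x * phi f0 f1 f2 t i x (v j)) = 0" if "j \<in> ?A" for j
        using rel v that x by (simp add: I_iff_V)
    qed (use i False in auto)
    then show ?thesis by (simp add: omega_minor)
  qed simp
  from V_prime[OF _ omega_regular[OF v] this] g i c nz
  have "\<forall>x\<in>V. g i x = 0" by blast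
  then show "g i \<in> I" using g i by (simp add: I_iff_V)
qed

text \<open>
  Take a maximal set \<open>R\<close> of rows with a minor that does not vanish on \<open>V\<close>. Adding one more row and
  one more column with an arbitrary vector \<open>w\<close> gives a vanishing minor; its expansion along that column is
  a relation whose coefficients do not depend on \<open>w\<close>, and the coefficient of the added row is the
  nonvanishing minor.
\<close>

lemma independent_imp_omega_nonzero:
  assumes ind: "phi_independent_mod d f0 f1 f2 t I"
  shows "omega_nonzero_on d f0 f1 f2 t V"
proof (rule ccontr)
  assume no: "\<not> ?thesis"
  let ?A = "{3..5 * d + 1}"
  let ?m = "\<lambda>R v c. minor R (\<lambda>i j. phi f0 f1 f2 t i c (v j))"
  define P where "P R \<longleftrightarrow> R \<subseteq> ?A \<and> (\<exists>v c. (\<forall>j\<in>R. v j \<in> M d) \<and> c \<in> V \<and> ?m R v c \<noteq> 0)" for R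
  obtain x where "x \<in> \<Gamma>" using \<Gamma>_nonempty by blast
  then have "fst x \<in> V" using \<Gamma>_V[of "fst x" "snd x"] by simp
  then have "P {}" by (auto simp: P_def minor_def intro!: exI[of _ "fst x"])
  have "finite {R. P R}" by (rule finite_subset[of _ "Pow ?A"]) (auto simp: P_def)
  then have "\<exists>R. R \<in> {R. P R} \<and> (\<forall>R'\<in>{R. P R}. R \<subseteq> R' \<longrightarrow> R = R')"
    using finite_has_maximal[of "{R. P R}"] \<open>P {}\<close> by blast
  then obtain R where R: "P R" and max: "\<And>R'. P R' \<Longrightarrow> R \<subseteq> R' \<Longrightarrow> R = R'" by blast
  obtain v c where v: "\<forall>j\<in>R. v j \<in> M d" and c: "c \<in> V" and nz: "?m R v c \<noteq> 0" and RA: "R \<subseteq> ?A"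
    using R unfolding P_def by blast
  have fR: "finite R" using RA finite_subset by blast
  have "R \<noteq> ?A" using no nz v c unfolding omega_nonzero_on_def omega_minor by blast
  then obtain i0 where i0: "i0 \<in> ?A" "i0 \<notin> R" using RA by blast
  let ?R = "insert i0 R"
  have fR': "finite ?R" and RA': "?R \<subseteq> ?A" using fR RA i0 by auto
  define g where "g i c = (if i \<in> ?R then cofactor ?R (\<lambda>i j. phi f0 f1 f2 t i c (v j)) i i0 else 0)" for i c
  have greg: "g i \<in> regular M_coords (M d)" for i
  proof (cases "i \<in> ?R")
    case True
    have "(\<lambda>c. cofactor ?R (\<lambda>i j. phi f0 f1 f2 t i c (v j)) i i0) \<in> regular M_coords (M d)"
      using True v by (intro cofactor_regular phi_regular) auto
    then show ?thesis using True by (simp add: g_def[abs_def])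
  next
    case False
    then show ?thesis by (simp add: g_def[abs_def] pf_regular polynomial_functions.const)
  qed
  have "(\<lambda>c. \<Sum>i\<in>?A. g i c * phi f0 f1 f2 t i c w) \<in> I" if w: "w \<in> M d" for w
    unfolding I_iff_V
  proof (intro conjI ballI regular_sum regular_mult greg phi_regular w)
    fix x assume x: "x \<in> V"
    let ?v = "v(i0 := w)"
    have "\<forall>j\<in>?R. ?v j \<in> M d" using v w by auto
    then have "?m ?R ?v x = 0" using max[of ?R] x RA' i0(2) unfolding P_def by blast
    moreover have "?m ?R ?v x = (\<Sum>i\<in>?R. phi f0 f1 f2 t i x w * g i x)"
      unfolding minor_expand_column[OF fR' insertI1]
    proof (rule sum.cong[OF refl])
      fix i assume i: "i \<in> ?R"
      have "cofactor ?R (\<lambda>i j. phi f0 f1 f2 t i x (?v j)) i i0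
          = cofactor ?R (\<lambda>i j. phi f0 f1 f2 t i x (v j)) i i0"
        using i by (intro cofactor_cong) auto
      then show "phi f0 f1 f2 t i x (?v i0) * cofactor ?R (\<lambda>i j. phi f0 f1 f2 t i x (?v j)) i i0
          = phi f0 f1 f2 t i x w * g i x"
        using i by (simp only: g_def if_True fun_upd_same)
    qed
    moreover have "(\<Sum>i\<in>?A. g i x * phi f0 f1 f2 t i x w) = (\<Sum>i\<in>?R. g i x * phi f0 f1 f2 t i x w)"
      using RA' by (intro sum.mono_neutral_right) (auto simp: g_def)
    ultimately show "(\<Sum>i\<in>?A. g i x * phi f0 f1 f2 t i x w) = 0" by (simp add: mult.commute)
  qed
  then have "g i0 \<in> I" using ind greg i0(1) unfolding phi_independent_mod_def by blast
  then have "g i0 c = 0" using c by (simp add: I_iff_V)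
  moreover have "g i0 c = ?m R v c" using cofactor_insert[OF i0(2) fR] by (simp add: g_def)
  ultimately show False using nz by simp
qed

end

context quintic_component
begin

section \<open>Tangent vectors of the image\<close>

text \<open>
  An equation of the image vanishes along \<open>flow\<close> through each point of the projection of \<open>\<Gamma>\<close>, so its
  derivative there vanishes. As a function of the point this derivative is polynomial, so it vanishes on
  the closure \<open>V\<close>.
\<close>

lemma flow_velocity_tangent:
  assumes c: "c \<in> V"
  shows "flow_velocity d a b g h c \<in> tangent_vectors d I c"
proof -
  have cM: "c \<in> M d" using c V_subset by blast
  have "differential r c (flow_velocity d a b g h c) = 0" if r: "r \<in> I" for r
  proof -
    have rr: "r \<in> regular M_coords (M d)" using r by (simp add: I_iff)
    let ?p = "representative d r"
    note p = representative[OF rr]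
    have "differential ?p c' (flow_velocity d a b g h c') = 0" if cf: "(c', f) \<in> \<Gamma>" for c' f
    proof -
      have M': "c' \<in> M d" using incidenceD[OF cf] by simp
      let ?h = "\<lambda>s. ?p (flow d a b g h c' s)"
      have hp: "is_poly ?h"
        by (rule polynomial_function_along[OF p(1)]) (auto simp: M_coords_def flow_is_poly)
      have hz: "?h s = 0" if "(1 + s * a) * (1 + s * h) - (s * b) * (s * g) \<noteq> 0" for s
        using flow_in_\<Gamma>[OF that cf] incidenceD(1) r p(2) by (force simp: I_iff)
      have "?h s = 0" for s
        by (rule is_poly_zero[OF hp flow_invertible_infinite[of a h b g]]) (use hz in blast)
      then have h0: "?h = (\<lambda>_. 0)" by (rule ext)
      note has_differential[OF p(1) flow_tangent[OF M', of a b g h], unfolded h0 flow_0[OF M']]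
      from DERIV_unique[OF this DERIV_const] show ?thesis .
    qed
    from V_vanish[OF pf_regular[OF differential_along_polynomial_field[OF p(1) flow_velocity_polynomial]] this c]
    have "differential ?p c (flow_velocity d a b g h c) = 0" .
    then show ?thesis using p(3)[OF cM flow_velocity_in_M[OF cM]] by simp
  qed
  then show ?thesis using flow_velocity_in_M[OF cM] by (simp add: tangent_vectors_def)
qed

text \<open>
  The equations with coefficients in \<open>k\<close> span all equations of the image, and for such an equation \<open>r\<close> the
  differential at \<open>c\<close> in the direction \<open>D c\<close> is \<open>D (r c) = D 0 = 0\<close>.
\<close>

lemma derivation_tangent:
  assumes c: "c \<in> V" and D: "derivation D" "\<And>a. a \<in> k \<Longrightarrow> D a = 0"
    and k: "I \<inter> polynomial_functions M_coords
      \<subseteq> fs.span ((I \<inter> polynomial_functions M_coords) \<inter> polys_over k M_coords)"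
  shows "apply_derivation D c \<in> tangent_vectors d I c"
proof -
  have cM: "c \<in> M d" using c V_subset by blast
  let ?v = "apply_derivation D c"
  have vM: "?v \<in> M d" by (rule apply_derivation_M[OF D(1) cM])
  have *: "p \<in> polynomial_functions M_coords \<and> differential p c ?v = 0"
    if "p \<in> fs.span ((I \<inter> polynomial_functions M_coords) \<inter> polys_over k M_coords)" for p
    using that
  proof (induction rule: fs.span_induct_alt)
    case base
    then show ?case
      using polynomial_functions.const[of 0 M_coords] by (simp add: zero_fun_def differential_const)
  next
    case (step a x y)
    have x: "x \<in> polynomial_functions M_coords" using step.hyps by blast
    have "x c = 0" using step.hyps c by (auto simp: I_iff_V)
    moreover have xk: "x \<in> polys_over k M_coords" using step.hyps by blast
    ultimately have "differential x c ?v = 0"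
      using derivation_polys_over[OF D xk, of c] derivation_rules(1)[OF D(1)] by simp
    then show ?case
      using x step.IH differential_add[OF polynomial_functions.mult[OF polynomial_functions.const x] conjunct1[OF step.IH], of a c ?v]
      by (auto simp: fscale_def plus_fun_def differential_cmult intro!: polynomial_functions.const polynomial_functions.add polynomial_functions.mult)
  qed
  have "differential r c ?v = 0" if r: "r \<in> I" for r
  proof -
    have rr: "r \<in> regular M_coords (M d)" using r by (simp add: I_iff)
    note p = representative[OF rr]
    have "representative d r x = 0" if "x \<in> V" for x
      using r p(2)[of x] that V_subset by (auto simp: I_iff_V)
    then have "representative d r \<in> I" using pf_regular[OF p(1)] by (simp add: I_iff_V)
    then show ?thesis using *[OF subsetD[OF k]] p(1) p(3)[OF cM vM] by simp
  qed
  then show ?thesis using vM by (simp add: tangent_vectors_def)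
qed

section \<open>The quintic through a curve\<close>

text \<open>
  The cross product of the rows \<open>(f0, f1, f2)\<close> evaluated at the two parameters \<open>\<tau>\<close> and \<open>\<sigma>\<close>. A quintic of
  the plane that contains the curve has coordinates orthogonal to both rows, hence proportional to
  the cross product; so this is a polynomial formula for the quintic in terms of the curve.
\<close>

definition cross0 where "cross0 \<tau> \<sigma> c = value_at f1 \<tau> c * value_at f2 \<sigma> c - value_at f2 \<tau> c * value_at f1 \<sigma> c"
definition cross1 where "cross1 \<tau> \<sigma> c = value_at f2 \<tau> c * value_at f0 \<sigma> c - value_at f0 \<tau> c * value_at f2 \<sigma> c"
definition cross2 where "cross2 \<tau> \<sigma> c = value_at f0 \<tau> c * value_at f1 \<sigma> c - value_at f1 \<tau> c * value_at f0 \<sigma> c"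

lemmas cross_defs = cross0_def cross1_def cross2_def

lemma cross_polynomial:
  "cross0 \<tau> \<sigma> \<in> polynomial_functions M_coords" "cross1 \<tau> \<sigma> \<in> polynomial_functions M_coords"
  "cross2 \<tau> \<sigma> \<in> polynomial_functions M_coords"
  unfolding cross_defs[abs_def] by (intro pf_intros value_at_polynomial)+

lemma cross_orthogonal:
  fixes u0 :: complex
  assumes "u0 * value_at f0 \<tau> c + u1 * value_at f1 \<tau> c + u2 * value_at f2 \<tau> c = 0"
    "u0 * value_at f0 \<sigma> c + u1 * value_at f1 \<sigma> c + u2 * value_at f2 \<sigma> c = 0"
  shows "cross1 \<tau> \<sigma> c * u0 = cross0 \<tau> \<sigma> c * u1" "cross2 \<tau> \<sigma> c * u0 = cross0 \<tau> \<sigma> c * u2"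
    "cross2 \<tau> \<sigma> c * u1 = cross1 \<tau> \<sigma> c * u2"
  using assms unfolding cross_defs by algebra+

lemma cross_proportional:
  assumes "(c, f) \<in> \<Gamma>"
  shows "cross1 \<tau> \<sigma> c * pairing b0 f = cross0 \<tau> \<sigma> c * pairing b1 f"
    "cross2 \<tau> \<sigma> c * pairing b0 f = cross0 \<tau> \<sigma> c * pairing b2 f"
    "cross2 \<tau> \<sigma> c * pairing b1 f = cross1 \<tau> \<sigma> c * pairing b2 f"
  using cross_orthogonal[OF value_at_\<Gamma>[OF assms] value_at_\<Gamma>[OF assms]] by auto

lemma cross_vanishes_on_curve:
  assumes c: "c \<in> V"
  shows "cross0 \<tau> \<sigma> c * value_at f0 \<rho> c + cross1 \<tau> \<sigma> c * value_at f1 \<rho> c + cross2 \<tau> \<sigma> c * value_at f2 \<rho> c = 0"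
    (is "?w c = 0")
proof (rule V_vanish[OF _ _ c])
  show "?w \<in> regular M_coords (M d)"
    by (intro pf_regular pf_intros cross_polynomial value_at_polynomial)
  fix c f assume cf: "(c, f) \<in> \<Gamma>"
  let ?b0 = "pairing b0 f" and ?b1 = "pairing b1 f" and ?b2 = "pairing b2 f"
  have e: "?b0 * value_at f0 \<rho> c + ?b1 * value_at f1 \<rho> c + ?b2 * value_at f2 \<rho> c = 0" by (rule value_at_\<Gamma>[OF cf])
  note p = cross_proportional[OF cf, of \<tau> \<sigma>]
  have "?b0 * ?w c = 0" "?b1 * ?w c = 0" "?b2 * ?w c = 0" using e p by algebra+
  moreover have "?b0 \<noteq> 0 \<or> ?b1 \<noteq> 0 \<or> ?b2 \<noteq> 0" using L_coordinates(2)[OF incidenceD(3)[OF cf]] by auto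
  ultimately show "?w c = 0" by auto
qed

text \<open>
  Near \<open>f0\<close> the first plane coordinate of the quintic is nonzero, so the proportionality carries a
  nonzero component of the cross product over to the first one.
\<close>

lemma cross0_nonzero:
  assumes c: "c \<in> V" and nz: "(cross0 \<tau> \<sigma> c, cross1 \<tau> \<sigma> c, cross2 \<tau> \<sigma> c) \<noteq> (0, 0, 0)"
  shows "\<exists>x\<in>V. cross0 \<tau> \<sigma> x \<noteq> 0"
proof -
  obtain x0 where x0: "x0 \<in> \<Gamma>" "snd x0 = f0" using onto L(2) by auto
  have "\<exists>x\<in>V. cross0 \<tau> \<sigma> x \<noteq> 0"
    if F: "F \<in> polynomial_functions M_coords" "F c \<noteq> 0"
      "\<And>c f. (c, f) \<in> \<Gamma> \<Longrightarrow> F c * pairing b0 f \<noteq> 0 \<Longrightarrow> cross0 \<tau> \<sigma> c \<noteq> 0" for F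
  proof -
    obtain y where y: "y \<in> \<Gamma>" "F (fst y) \<noteq> 0" using V_witness[OF pf_regular[OF F(1)] c F(2)] by blast
    obtain z where z: "z \<in> \<Gamma>" "F (fst z) \<noteq> 0" "pairing b0 (snd z) \<noteq> 0"
      using \<Gamma>_prime[OF pf_fst[OF F(1)] pf_pairing[of b0] y x0(1)] x0(2) by auto
    then have "cross0 \<tau> \<sigma> (fst z) \<noteq> 0" using F(3)[of "fst z" "snd z"] by simp
    moreover have "fst z \<in> V" using \<Gamma>_V[of "fst z" "snd z"] z(1) by simp
    ultimately show ?thesis by blast
  qed
  note * = this
  have "cross0 \<tau> \<sigma> c \<noteq> 0 \<or> cross1 \<tau> \<sigma> c \<noteq> 0 \<or> cross2 \<tau> \<sigma> c \<noteq> 0" using nz by auto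
  then show ?thesis
  proof (elim disjE)
    assume "cross0 \<tau> \<sigma> c \<noteq> 0"
    then show ?thesis using c by blast
  next
    assume n: "cross1 \<tau> \<sigma> c \<noteq> 0"
    show ?thesis
      by (rule *[OF cross_polynomial(2) n]) (auto simp: cross_proportional)
  next
    assume n: "cross2 \<tau> \<sigma> c \<noteq> 0"
    show ?thesis
      by (rule *[OF cross_polynomial(3) n]) (auto simp: cross_proportional)
  qed
qed

text \<open>
  \<open>L\<close> contains an open neighbourhood of \<open>f0\<close>, the origin of the affine chart \<open>(1, x, y)\<close> of the plane. A
  polynomial vanishing there vanishes identically, as one sees on lines through the origin.
\<close>

lemma homogeneous_vanishing:
  assumes H: "\<And>f. f \<in> L \<Longrightarrow>
    (\<Sum>i\<le>N. \<Sum>j\<le>N. P i j * pairing b1 f ^ i * pairing b2 f ^ j * pairing b0 f ^ (2 * N - i - j)) = 0"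
  shows "\<forall>i\<le>N. \<forall>j\<le>N. P i j = 0"
proof -
  obtain Gs where Gs: "Gs \<subseteq> polynomial_functions form_coords"
    "plane f0 f1 f2 - L = {f \<in> plane f0 f1 f2. \<forall>g\<in>Gs. g f = 0}"
    using L(1) unfolding open_in_plane_def zariski_closed_def by blast
  have "f0 \<in> plane f0 f1 f2" using L unfolding open_in_plane_def by blast
  then obtain g where g: "g \<in> Gs" "g f0 \<noteq> 0" using Gs(2) L(2) by blast
  have gp: "g \<in> polynomial_functions form_coords" using g(1) Gs(1) by blast
  have z: "(\<Sum>i\<le>N. (\<Sum>j\<le>N. P i j * y ^ j) * x ^ i) = 0" for x y
  proof -
    let ?H = "\<lambda>s. \<Sum>i\<le>N. \<Sum>j\<le>N. P i j * (s * x) ^ i * (s * y) ^ j"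
    let ?f = "\<lambda>s. plane_form 1 (s * x) (s * y)"
    have prod: "?H s * g (?f s) = 0" for s
    proof (cases "g (?f s) = 0")
      case False
      have "?f s \<in> plane f0 f1 f2"
        unfolding plane_eq
        by (intro CollectI exI[of _ 1] exI[of _ "s * x"] exI[of _ "s * y"]) simp
      then have "?f s \<in> L" using False g(1) Gs(2) by blast
      from H[OF this, unfolded pairing_linear] show ?thesis by simp
    qed simp
    have Hp: "is_poly ?H" by (intro is_poly_intros)
    have gp': "is_poly (\<lambda>s. g (?f s))"
      by (rule polynomial_function_along[OF gp]) (auto simp: form_coords_def intro!: is_poly_intros)
    have "?f 0 = f0" by simp
    then have "g (?f 0) \<noteq> 0" using g(2) by simp
    have "(\<forall>s. ?H s = 0) \<or> (\<forall>s. g (?f s) = 0)"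
      by (rule is_poly_no_zero_divisors[OF Hp gp' prod infinite_UNIV_char_0])
    then have "\<forall>s. ?H s = 0"
    proof
      assume "\<forall>s. g (?f s) = 0"
      from spec[OF this, of 0] \<open>g (?f 0) \<noteq> 0\<close> show ?thesis by (rule notE[rotated])
    qed
    then have "?H 1 = 0" by (rule spec)
    then show ?thesis unfolding sum_distrib_right by (simp add: mult_ac)
  qed
  have "(\<Sum>j\<le>N. P i j * y ^ j) = 0" if "i \<le> N" for i y
    using z polyfun_eq_0[of "\<lambda>i. \<Sum>j\<le>N. P i j * y ^ j" N] that by blast
  then show ?thesis using polyfun_eq_0[of "P _" N] by blast
qed

text \<open>
  An algebraic relation over \<open>k\<close> between the affine plane coordinates of the quintic through \<open>c\<close> becomes,
  after clearing denominators, a polynomial over \<open>k\<close> that vanishes at \<open>c\<close>. As \<open>c\<close> is generic over \<open>k\<close>, it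
  vanishes on all of \<open>V\<close>, and then on all of \<open>L\<close> because \<open>\<Gamma>\<close> maps onto \<open>L\<close>.
\<close>

lemma plane_coordinates_independent:
  assumes k: "subring_set k" "\<And>e. f0 e \<in> k" "\<And>e. f1 e \<in> k" "\<And>e. f2 e \<in> k" "\<tau> \<in> k" "\<sigma> \<in> k"
    and gen: "\<And>p. p \<in> polys_over k M_coords \<Longrightarrow> p c = 0 \<Longrightarrow> \<forall>x\<in>V. p x = 0"
    and c: "c \<in> V" and nz: "cross0 \<tau> \<sigma> c \<noteq> 0"
  shows "algebraically_independent_pair k (cross1 \<tau> \<sigma> c / cross0 \<tau> \<sigma> c) (cross2 \<tau> \<sigma> c / cross0 \<tau> \<sigma> c)"
  unfolding algebraically_independent_pair_def
proof (intro allI impI)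
  fix P :: "nat \<Rightarrow> nat \<Rightarrow> complex" and N i j
  assume P: "\<forall>i j. P i j \<in> k"
    and 0: "(\<Sum>i\<le>N. \<Sum>j\<le>N. P i j * (cross1 \<tau> \<sigma> c / cross0 \<tau> \<sigma> c) ^ i * (cross2 \<tau> \<sigma> c / cross0 \<tau> \<sigma> c) ^ j) = 0"
    and ij: "i \<le> N" "j \<le> N"
  \<comment> \<open>The exponent \<open>2 N - i - j\<close> makes the polynomial homogeneous of degree \<open>2 N\<close>.\<close>
  have hom: "(\<Sum>i\<le>N. \<Sum>j\<le>N. P i j * (u * x) ^ i * (u * y) ^ j * (u * z) ^ (2 * N - i - j))
      = u ^ (2 * N) * (\<Sum>i\<le>N. \<Sum>j\<le>N. P i j * x ^ i * y ^ j * z ^ (2 * N - i - j))" for u x y z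
    unfolding sum_distrib_left
  proof (intro sum.cong refl)
    fix i j assume "i \<in> {..N}" "j \<in> {..N}"
    then have "u ^ (2 * N) = u ^ i * u ^ j * u ^ (2 * N - i - j)" by (simp flip: power_add)
    then show "P i j * (u * x) ^ i * (u * y) ^ j * (u * z) ^ (2 * N - i - j)
        = u ^ (2 * N) * (P i j * x ^ i * y ^ j * z ^ (2 * N - i - j))"
      by (simp add: power_mult_distrib mult_ac)
  qed
  let ?h = "\<lambda>c. \<Sum>i\<le>N. \<Sum>j\<le>N. P i j * cross1 \<tau> \<sigma> c ^ i * cross2 \<tau> \<sigma> c ^ j * cross0 \<tau> \<sigma> c ^ (2 * N - i - j)"
  have "value_at f \<rho> \<in> polys_over k M_coords" if "f \<in> {f0, f1, f2}" "\<rho> \<in> {\<tau>, \<sigma>}" for f \<rho>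
    using that k subring_setD(1)[OF k(1)] unfolding value_at_def[abs_def]
    by (intro form_eval_polys_over) auto
  then have "cross0 \<tau> \<sigma> \<in> polys_over k M_coords" "cross1 \<tau> \<sigma> \<in> polys_over k M_coords"
    "cross2 \<tau> \<sigma> \<in> polys_over k M_coords"
    unfolding cross_defs[abs_def] by (intro polys_over_more[OF k(1)] polys_over.mult; simp)+
  then have "?h \<in> polys_over k M_coords"
    using P by (intro polys_over_more[OF k(1)] polys_over.mult polys_over.const) auto
  moreover have "?h c = 0"
    using hom[of "cross0 \<tau> \<sigma> c" "cross1 \<tau> \<sigma> c / cross0 \<tau> \<sigma> c" "cross2 \<tau> \<sigma> c / cross0 \<tau> \<sigma> c" 1] 0 nz by simp
  ultimately have hV: "\<forall>x\<in>V. ?h x = 0" by (rule gen)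
  let ?H = "\<lambda>x :: tuple \<times> form. \<Sum>i\<le>N. \<Sum>j\<le>N. P i j * pairing b1 (snd x) ^ i * pairing b2 (snd x) ^ j
      * pairing b0 (snd x) ^ (2 * N - i - j)"
  have Hp: "?H \<in> polynomial_functions MS_coords" by (intro pf_intros pf_pairing)
  have prod: "cross0 \<tau> \<sigma> (fst x) * ?H x = 0" if x: "x \<in> \<Gamma>" for x
  proof -
    obtain c' f where xx: "x = (c', f)" by (cases x)
    have "?h c' = 0" using hV \<Gamma>_V[of c' f] x xx by blast
    then have "pairing b0 f ^ (2 * N) * ?h c' = 0" by simp
    also have "pairing b0 f ^ (2 * N) * ?h c'
       = (\<Sum>i\<le>N. \<Sum>j\<le>N. P i j * (pairing b0 f * cross1 \<tau> \<sigma> c') ^ i * (pairing b0 f * cross2 \<tau> \<sigma> c') ^ j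
            * (pairing b0 f * cross0 \<tau> \<sigma> c') ^ (2 * N - i - j))" by (rule hom[symmetric])
    also have "\<dots> = (\<Sum>i\<le>N. \<Sum>j\<le>N. P i j * (cross0 \<tau> \<sigma> c' * pairing b1 f) ^ i * (cross0 \<tau> \<sigma> c' * pairing b2 f) ^ j
            * (cross0 \<tau> \<sigma> c' * pairing b0 f) ^ (2 * N - i - j))"
      using cross_proportional[of c' f \<tau> \<sigma>] x xx by (simp add: mult.commute)
    also have "\<dots> = cross0 \<tau> \<sigma> c' ^ (2 * N) * ?H x" unfolding hom xx by simp
    finally show ?thesis by (auto simp: xx)
  qed
  have "?H x = 0" if x: "x \<in> \<Gamma>" for x
  proof (rule ccontr)
    assume "?H x \<noteq> 0"
    obtain y where y: "y \<in> \<Gamma>" "cross0 \<tau> \<sigma> (fst y) \<noteq> 0"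
      using V_witness[OF pf_regular[OF cross_polynomial(1)] c nz] by blast
    from \<Gamma>_prime[OF pf_fst[OF cross_polynomial(1)] Hp y x \<open>?H x \<noteq> 0\<close>] prod show False by auto
  qed
  then have "(\<Sum>i\<le>N. \<Sum>j\<le>N. P i j * pairing b1 f ^ i * pairing b2 f ^ j * pairing b0 f ^ (2 * N - i - j)) = 0"
    if "f \<in> L" for f
    using that onto by force
  from homogeneous_vanishing[OF this] show "P i j = 0" using ij by blast
qed

text \<open>
  The derivative of a 3 by 3 determinant is a combination of its 2 by 2 minors, which are the entries of the
  cross products of two rows.
\<close>

lemma differential_incidence_det:
  "differential (incidence_det i) c v =
     differential (value_at f0 (t i)) c v * cross0 (t 1) (t 2) c * (- 1)
   + differential (value_at f1 (t i)) c v * cross1 (t 1) (t 2) c * (- 1)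
   + differential (value_at f2 (t i)) c v * cross2 (t 1) (t 2) c * (- 1)
   + differential (value_at f0 (t 1)) c v * cross0 (t 2) (t i) c * (- 1)
   + differential (value_at f1 (t 1)) c v * cross1 (t 2) (t i) c * (- 1)
   + differential (value_at f2 (t 1)) c v * cross2 (t 2) (t i) c * (- 1)
   + differential (value_at f0 (t 2)) c v * cross0 (t i) (t 1) c * (- 1)
   + differential (value_at f1 (t 2)) c v * cross1 (t i) (t 1) c * (- 1)
   + differential (value_at f2 (t 2)) c v * cross2 (t i) (t 1) c * (- 1)"
proof -
  note e = value_at_polynomial
  note m = polynomial_functions.mult[OF e e]
  show ?thesis
    unfolding incidence_det_def[abs_def] cross_defs
    by (simp add: differential_add differential_mult differential_diff e m
        pf_diff polynomial_functions.add polynomial_functions.mult algebra_simps)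
qed

text \<open>
  Where all 2 by 2 minors vanish, the differentials \<open>\<phi>\<^sub>i\<close> of the 3 by 3 determinants vanish. Hence a nonzero
  \<open>omega\<close> at \<open>c\<close> makes two of the rows at \<open>t\<^sub>1, t\<^sub>2, t\<^sub>3\<close> independent.
\<close>

lemma omega_nonzero_cross:
  assumes c: "c \<in> V" and v: "\<forall>j\<in>{3..5 * d + 1}. v j \<in> M d"
    and nz: "omega d f0 f1 f2 t c v \<noteq> 0"
  shows "\<exists>l m. \<exists>x\<in>V. cross0 (t l) (t m) x \<noteq> 0"
proof (rule ccontr)
  assume "\<not> ?thesis"
  then have 0: "cross0 (t l) (t m) c = 0 \<and> cross1 (t l) (t m) c = 0 \<and> cross2 (t l) (t m) c = 0" for l m
    using cross0_nonzero[OF c, of "t l" "t m"] by blast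
  have cM: "c \<in> M d" using c V_subset by blast
  have "phi f0 f1 f2 t 3 c (v j) = 0" if "j \<in> {3..5 * d + 1}" for j
    using that v cM by (simp add: phi_incidence_det differential_incidence_det 0)
  moreover have 3: "3 \<in> {3..5 * d + 1}" using d by simp
  ultimately have "(\<Prod>i = 3..5 * d + 1. phi f0 f1 f2 t i c (v (\<pi> i))) = 0"
    if "\<pi> permutes {3..5 * d + 1}" for \<pi>
    using permutes_in_image[OF that, of 3] by (intro prod_zero bexI[of _ 3]) auto
  then show False using nz unfolding omega_def by simp
qed

section \<open>The lower bound\<close>

text \<open>
  Reparametrizing a curve keeps it on each quintic that contains it.
\<close>

lemma curve_relation_differential:
  assumes c: "c \<in> M d" and z: "\<And>\<tau>. x0 * value_at f0 \<tau> c + x1 * value_at f1 \<tau> c + x2 * value_at f2 \<tau> c = 0"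
  shows "x0 * differential (value_at f0 \<tau>) c (flow_velocity d a b g h c) + x1 * differential (value_at f1 \<tau>) c (flow_velocity d a b g h c)
    + x2 * differential (value_at f2 \<tau>) c (flow_velocity d a b g h c) = 0"
proof -
  let ?F = "plane_form x0 x1 x2" and ?\<phi> = "\<lambda>c'. x0 * value_at f0 \<tau> c' + x1 * value_at f1 \<tau> c' + x2 * value_at f2 \<tau> c'"
  have "pullback ?F c = 0"
    using z c by (intro pullback_zeroI) (simp add: form_eval_plane_form value_at_affine)
  then have "value_at ?F \<tau> (flow d a b g h c s) = 0" for s
    using pullback_zero_hom[OF c] by (simp add: value_at_def flow_def hom_value_act)
  then have 0: "(\<lambda>s. ?\<phi> (flow d a b g h c s)) = (\<lambda>_. 0)" by (simp add: value_at_plane_form)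
  have p: "?\<phi> \<in> polynomial_functions M_coords" by (intro pf_intros value_at_polynomial)
  note has_differential[OF p flow_tangent[OF c, of a b g h], unfolded 0 flow_0[OF c]]
  from DERIV_unique[OF this DERIV_const] have "differential ?\<phi> c (flow_velocity d a b g h c) = 0" .
  then show ?thesis
    by (simp add: differential_add differential_cmult value_at_polynomial pf_intros)
qed

text \<open>
  Six tangent vectors: the velocities of the reparametrizations for the four matrix units and the vectors
  \<open>D1 c\<close>, \<open>D2 c\<close> for derivations dual to the plane coordinates \<open>x, y\<close> of the quintic through \<open>c\<close>. In a
  linear relation the last two combine to \<open>D c\<close> with \<open>D = l 0 D1 + l 1 D2\<close>, and \<open>D c\<close> is the velocity of
  a reparametrization. Applying \<open>D\<close> to the equation that the quintic \<open>F\<close> through \<open>c\<close> vanishes on the curve,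
  the terms from moving the curve cancel. What remains says that \<open>D F\<close> is also orthogonal to the rows at \<open>\<tau>\<close> and \<open>\<sigma>\<close>, so
  \<open>D F\<close> is proportional to \<open>F\<close>, and \<open>D\<close> kills the quotients \<open>x\<close> and \<open>y\<close> of coordinates of \<open>F\<close>. Hence \<open>D = 0\<close>
  in the relation, and the four velocities are independent by the Wronskian.
\<close>

lemma dim_tangent_ge:
  assumes K: "K \<subseteq> I" and c: "c \<in> V"
    and k: "subring_set k" "\<And>e. f0 e \<in> k" "\<And>e. f1 e \<in> k" "\<And>e. f2 e \<in> k" "\<tau> \<in> k" "\<sigma> \<in> k"
      "I \<inter> polynomial_functions M_coords
        \<subseteq> fs.span ((I \<inter> polynomial_functions M_coords) \<inter> polys_over k M_coords)"
    and gen: "\<And>p. p \<in> polys_over k M_coords \<Longrightarrow> p c = 0 \<Longrightarrow> \<forall>x\<in>V. p x = 0"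
    and nz: "cross0 \<tau> \<sigma> c \<noteq> 0" and W: "wronskian c i j \<noteq> 0"
  shows "6 \<le> ts.dim (tangent_vectors d K c)"
proof -
  have cM: "c \<in> M d" using c V_subset by blast
  define x where "x = cross1 \<tau> \<sigma> c / cross0 \<tau> \<sigma> c"
  define y where "y = cross2 \<tau> \<sigma> c / cross0 \<tau> \<sigma> c"
  have ind: "algebraically_independent_pair k x y"
    unfolding x_def y_def by (rule plane_coordinates_independent[OF k(1-6) gen c nz])
  obtain D1 where D1: "derivation D1" "\<forall>a\<in>k. D1 a = 0" "D1 x = 1" "D1 y = 0"
    using algebraically_independent_derivation[OF k(1) ind] by (elim exE conjE)
  obtain D2 where D2: "derivation D2" "\<forall>a\<in>k. D2 a = 0" "D2 y = 1" "D2 x = 0"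
    using algebraically_independent_derivation[OF k(1) algebraically_independent_swap[OF ind]]
    by (elim exE conjE)
  define u where "u n = (if n = (0::nat) then apply_derivation D1 c
     else if n = 1 then apply_derivation D2 c
     else flow_velocity d (of_bool (n = 2)) (of_bool (n = 3)) (of_bool (n = 4)) (of_bool (n = 5)) c)" for n
  have "card {..<6::nat} \<le> ts.dim (tangent_vectors d K c)"
  proof (rule ts.dim_lower_bound)
    show "tangent_vectors d K c \<subseteq> ts.span (M_basis ` (UNIV \<times> {..d}))"
      unfolding M_span[symmetric] by (auto simp: tangent_vectors_def)
    have "tangent_vectors d I c \<subseteq> tangent_vectors d K c" using K by (auto simp: tangent_vectors_def)
    moreover have "u n \<in> tangent_vectors d I c" for n
      using D1 D2 by (auto simp: u_def intro: flow_velocity_tangent[OF c] derivation_tangent[OF c _ _ k(7)])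
    ultimately show "u ` {..<6} \<subseteq> tangent_vectors d K c" by blast
    fix l :: "nat \<Rightarrow> complex" assume l: "(\<Sum>n<6. tscale (l n) (u n)) = 0"
    define D where "D z = l 0 * D1 z + l 1 * D2 z" for z
    have D: "derivation D" "\<And>a. a \<in> k \<Longrightarrow> D a = 0"
      using derivation_combination[OF D1(1) D2(1)] D1(2) D2(2) by (auto simp: D_def[abs_def])
    let ?w = "apply_derivation D c" and ?xi = "flow_velocity d (l 2) (l 3) (l 4) (l 5) c"
    have "?w = tscale (l 0) (apply_derivation D1 c) + tscale (l 1) (apply_derivation D2 c)"
      using D(1) D1(1) D2(1) by (auto simp: vec_eq_iff poly_eq_iff coeff_apply_derivation D_def)
    moreover have "?xi = tscale (l 2) (u 2) + tscale (l 3) (u 3) + tscale (l 4) (u 4) + tscale (l 5) (u 5)"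
      using flow_velocity_linear[of d l "\<lambda>n. of_bool (n = 2)" "{2, 3, 4, 5}" "\<lambda>n. of_bool (n = 3)"
          "\<lambda>n. of_bool (n = 4)" "\<lambda>n. of_bool (n = 5)" c]
      by (simp add: u_def algebra_simps)
    moreover have "{..<6} = {0, 1, 2, 3, 4, 5 :: nat}" by auto
    ultimately have wxi: "?w + ?xi = 0" using l by (simp add: u_def algebra_simps)
    let ?e = "\<lambda>f \<rho>. value_at f \<rho> c"
    let ?F0 = "cross0 \<tau> \<sigma> c" and ?F1 = "cross1 \<tau> \<sigma> c" and ?F2 = "cross2 \<tau> \<sigma> c"
    have rel: "?F0 * ?e f0 \<rho> + ?F1 * ?e f1 \<rho> + ?F2 * ?e f2 \<rho> = 0" for \<rho>
      by (rule cross_vanishes_on_curve[OF c])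
    have De: "D (?e f \<rho>) = - differential (value_at f \<rho>) c ?xi" if "f \<in> {f0, f1, f2}" "\<rho> \<in> {\<tau>, \<sigma>}" for f \<rho>
    proof -
      have evk: "value_at f \<rho> \<in> polys_over k M_coords"
        using that k subring_setD(1)[OF k(1)] unfolding value_at_def[abs_def]
        by (intro form_eval_polys_over) auto
      have "D (?e f \<rho>) = differential (value_at f \<rho>) c ?w" by (rule derivation_polys_over[OF D evk])
      moreover have "differential (value_at f \<rho>) c ?w + differential (value_at f \<rho>) c ?xi = 0"
        using differential_tscale[OF value_at_polynomial, of f \<rho> c 0 0]
        unfolding differential_add_vector[OF value_at_polynomial, symmetric] wxi by simp
      ultimately show ?thesis by (simp add: eq_neg_iff_add_eq_0)
    qed
    \<comment> \<open>Both parts of \<open>D\<close> of the relation: the one in which \<open>D\<close> hits the values vanishes,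
      as \<open>D c\<close> is minus the velocity of a reparametrization.\<close>
    have DF: "D ?F0 * ?e f0 \<rho> + D ?F1 * ?e f1 \<rho> + D ?F2 * ?e f2 \<rho> = 0" if "\<rho> \<in> {\<tau>, \<sigma>}" for \<rho>
    proof -
      have "0 = D (?F0 * ?e f0 \<rho> + ?F1 * ?e f1 \<rho> + ?F2 * ?e f2 \<rho>)"
        unfolding rel using derivation_rules(1)[OF D(1)] by simp
      also have "\<dots> = (D ?F0 * ?e f0 \<rho> + D ?F1 * ?e f1 \<rho> + D ?F2 * ?e f2 \<rho>)
          - (?F0 * differential (value_at f0 \<rho>) c ?xi + ?F1 * differential (value_at f1 \<rho>) c ?xi
            + ?F2 * differential (value_at f2 \<rho>) c ?xi)"
        using De[OF _ that] by (simp add: derivation_rules[OF D(1)] algebra_simps)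
      also have "?F0 * differential (value_at f0 \<rho>) c ?xi + ?F1 * differential (value_at f1 \<rho>) c ?xi
            + ?F2 * differential (value_at f2 \<rho>) c ?xi = 0"
        by (rule curve_relation_differential[OF cM rel])
      finally show ?thesis by simp
    qed
    have DF\<tau>: "?F1 * D ?F0 = ?F0 * D ?F1" "?F2 * D ?F0 = ?F0 * D ?F2"
      using cross_orthogonal[OF DF DF, of \<tau> \<sigma>] by auto
    have Dq: "D q = 0" if "q * ?F0 = F" "F * D ?F0 = ?F0 * D F" for q F
    proof -
      have 1: "q * D ?F0 + D q * ?F0 = D F"
        unfolding that(1)[symmetric] by (simp add: derivation_rules[OF D(1)])
      have "?F0 * ?F0 * D q = ?F0 * (q * D ?F0 + D q * ?F0) - (q * ?F0) * D ?F0"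
        by (simp add: algebra_simps)
      also have "\<dots> = 0" unfolding 1 that(1) using that(2) by simp
      finally have "?F0 * ?F0 * D q = 0" .
      then show ?thesis using nz by simp
    qed
    have "D x = 0" "D y = 0" using nz DF\<tau> by (auto intro!: Dq simp: x_def y_def)
    then have l01: "l 0 = 0" "l 1 = 0" using D1 D2 by (simp_all add: D_def)
    then have "?w = 0" using D(1) by (auto simp: vec_eq_iff poly_eq_iff coeff_apply_derivation D_def)
    then have "?xi = 0" using wxi by simp
    from flow_velocity_injective[OF this W d] l01 show "\<forall>n\<in>{..<6}. l n = 0"
      unfolding \<open>{..<6} = {0, 1, 2, 3, 4, 5 :: nat}\<close> by simp
  qed auto
  then show ?thesis by simp
qed

lemma wronskian_nonzero:
  "\<exists>i j \<tau> p. p \<in> polynomial_functions M_coords \<and> (\<forall>c\<in>M d. poly (wronskian c i j) \<tau> = p c) \<and> (\<exists>x\<in>V. p x \<noteq> 0)"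
proof -
  obtain c f where cf: "(c, f) \<in> \<Gamma>" using \<Gamma>_nonempty by auto
  have "birational_onto_image c" using incidenceD(2)[OF cf] by (simp add: M_bir_def)
  then obtain i j where "wronskian c i j \<noteq> 0" using birational_wronskian by blast
  then obtain \<tau> where \<tau>: "poly (wronskian c i j) \<tau> \<noteq> 0" using poly_all_0_iff_0 by blast
  obtain p where "p \<in> polynomial_functions M_coords" "\<forall>c\<in>M d. poly (wronskian c i j) \<tau> = p c"
    using wronskian_regular by blast
  moreover have "p c \<noteq> 0" using \<tau> incidenceD(1)[OF cf] calculation(2) by auto
  then have "\<exists>x\<in>V. p x \<noteq> 0" using \<Gamma>_V[OF cf] by blast
  ultimately show ?thesis by blast
qed

text \<open>
  The excluded closed subsets are the zero sets of the polynomials over a countable ring \<open>k\<close> that do not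
  vanish on \<open>V\<close>, and of three more functions: a value of \<open>omega\<close>, a Wronskian and a cross product.
\<close>

lemma generic_tangent_dimension:
  assumes om: "omega_nonzero_on d f0 f1 f2 t V" and K: "J \<subseteq> K" "K \<subseteq> I"
  shows "generically M_coords V (\<lambda>c. ts.dim (tangent_vectors d K c) = 6)"
proof -
  obtain c v where c: "c \<in> V" and v: "\<forall>j\<in>{3..5 * d + 1}. v j \<in> M d"
    and nz: "omega d f0 f1 f2 t c v \<noteq> 0" using om unfolding omega_nonzero_on_def by blast
  obtain q where q: "q \<in> polynomial_functions M_coords" "\<And>x. x \<in> M d \<Longrightarrow> omega d f0 f1 f2 t x v = q x"
    using regularE[OF omega_regular[OF v]] by blast
  obtain l m where lm: "\<exists>x\<in>V. cross0 (t l) (t m) x \<noteq> 0" using omega_nonzero_cross[OF c v nz] by blast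
  obtain i j \<tau> p where p: "p \<in> polynomial_functions M_coords"
    "\<forall>c\<in>M d. poly (wronskian c i j) \<tau> = p c" "\<exists>x\<in>V. p x \<noteq> 0"
    using wronskian_nonzero by blast
  have Mc: "countable (M_coords :: (tuple \<Rightarrow> complex) set)"
  proof -
    have "M_coords = (\<lambda>(i, k) c. coeff (c $ i) k) ` (UNIV :: (5 \<times> nat) set)"
      by (auto simp: M_coords_def image_def)
    then show ?thesis using countable_image[OF countableI_type] by metis
  qed
  \<comment> \<open>The ring must contain the data of the cross product, whose polynomials enter the independence of
    the plane coordinates; the element 0 is the value of the forms outside \<open>exponents 5\<close>.\<close>
  let ?A = "insert 0 (f0 ` exponents 5 \<union> f1 ` exponents 5 \<union> f2 ` exponents 5 \<union> {t l, t m})"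
  have "countable ?A" using finite_exponents by (intro countable_finite) auto
  from span_over_countable_ring[OF Mc _ this, of "I \<inter> polynomial_functions M_coords"]
  obtain k where k: "countable k" "subring_set k" "?A \<subseteq> k"
    "I \<inter> polynomial_functions M_coords
      \<subseteq> fs.span ((I \<inter> polynomial_functions M_coords) \<inter> polys_over k M_coords)" by auto
  have fk: "f e \<in> k" if "f \<in> {f0, f1, f2}" for f e
    using that k(3) quintics by (cases "e \<in> exponents 5") (auto simp: forms_def)
  define Ps where "Ps = insert q (insert p (insert (cross0 (t l) (t m)) (polys_over k M_coords)))"
  define \<Z> where "\<Z> = (\<lambda>g. {x\<in>V. g x = 0}) ` {g\<in>Ps. \<exists>x\<in>V. g x \<noteq> 0}"
  have Ps: "Ps \<subseteq> polynomial_functions M_coords"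
    using q(1) p(1) cross_polynomial polys_over_pf by (auto simp: Ps_def)
  have "countable \<Z>"
    unfolding \<Z>_def Ps_def using countable_polys_over[OF k(1) Mc]
    by (intro countable_image countable_subset[OF Collect_restrict]) simp
  moreover have "zariski_closed M_coords V Z \<and> Z \<noteq> V" if Z: "Z \<in> \<Z>" for Z
  proof -
    obtain g where g: "g \<in> Ps" "\<exists>x\<in>V. g x \<noteq> 0" "Z = {x\<in>V. g x = 0}"
      using Z unfolding \<Z>_def by blast
    then show ?thesis
      unfolding zariski_closed_def using Ps by (intro conjI exI[of _ "{g}"]) auto
  qed
  moreover have "ts.dim (tangent_vectors d K x) = 6" if x: "x \<in> V - \<Union>\<Z>" for x
  proof -
    have nzx: "g x \<noteq> 0" if "g \<in> Ps" "\<exists>x\<in>V. g x \<noteq> 0" for g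
      using x that by (auto simp: \<Z>_def)
    have xV: "x \<in> V" and xM: "x \<in> M d" using x V_subset by auto
    have "q c \<noteq> 0" using nz c q(2)[of c] V_subset by auto
    then have "q x \<noteq> 0" using c by (intro nzx) (auto simp: Ps_def)
    then have "omega d f0 f1 f2 t x v \<noteq> 0" using q(2)[OF xM] by simp
    then have le: "ts.dim (tangent_vectors d K x) \<le> 6" by (rule dim_tangent_le[OF K xV v])
    have "p x \<noteq> 0" using p(3) by (intro nzx) (auto simp: Ps_def)
    then have W: "wronskian x i j \<noteq> 0" using p(2) xM by auto
    have "6 \<le> ts.dim (tangent_vectors d K x)"
    proof (rule dim_tangent_ge[OF K(2) xV k(2) _ _ _ _ _ k(4) _ _ W])
      show "f0 e \<in> k" "f1 e \<in> k" "f2 e \<in> k" for e using fk by auto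
      show "t l \<in> k" "t m \<in> k" using k(3) by auto
      show "cross0 (t l) (t m) x \<noteq> 0" using lm by (intro nzx) (auto simp: Ps_def)
      show "\<forall>y\<in>V. r y = 0" if "r \<in> polys_over k M_coords" "r x = 0" for r
        using nzx[of r] that by (auto simp: Ps_def)
    qed
    with le show ?thesis by simp
  qed
  ultimately show ?thesis unfolding generically_def by (intro exI[of _ \<Z>]) blast
qed

lemma generic_zariski_tangent_dimension:
  assumes om: "omega_nonzero_on d f0 f1 f2 t V" and K: "K = I \<or> K = J"
  shows "generically M_coords V (\<lambda>c. fs.dim (zariski_tangent_space M_coords (M d) K c) =
    ts.dim (M d) - (5 * d - 1))"
proof -
  have JKI: "J \<subseteq> K" "K \<subseteq> I" using K J_subset_I by auto
  have Kr: "K \<subseteq> regular M_coords (M d)" using JKI(2) by (auto simp: I_iff)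
  obtain \<Z> where \<Z>: "countable \<Z>" "\<forall>Z\<in>\<Z>. zariski_closed M_coords V Z \<and> Z \<noteq> V"
    "\<forall>x\<in>V - \<Union>\<Z>. ts.dim (tangent_vectors d K x) = 6"
    using generic_tangent_dimension[OF om JKI] unfolding generically_def by (elim exE conjE)
  have "fs.dim (zariski_tangent_space M_coords (M d) K c) = ts.dim (M d) - (5 * d - 1)"
    if c: "c \<in> V - \<Union>\<Z>" for c
  proof -
    have cV: "c \<in> V" "c \<in> M d" using c V_subset by auto
    have "fs.dim (zariski_tangent_space M_coords (M d) K c) = ts.dim (tangent_vectors d K c)"
    proof (rule dim_zariski_tangent_space[OF cV(2) Kr])
      show "g c = 0" if "g \<in> K" for g using that JKI(2) cV(1) I_iff_V by blast
      show "g \<in> K" if "g \<in> regular M_coords (M d)" "\<And>x. x \<in> M d \<Longrightarrow> g x = 0" for g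
        using J_trivial[OF that] JKI(1) by blast
    qed
    also have "\<dots> = ts.dim (M d) - (5 * d - 1)" using \<Z>(3) c d by (simp add: dim_M)
    finally show ?thesis .
  qed
  then show ?thesis unfolding generically_def using \<Z>(1,2) by (intro exI[of _ \<Z>]) blast
qed

end

section \<open>Generic planes of quintics\<close>

definition pure_power :: "5 \<Rightarrow> (5 \<Rightarrow> nat)" where
  "pure_power i = (\<lambda>j. if j = i then 5 else 0)"

text \<open>
  Nonvanishing of this determinant of coefficients of \<open>x\<^sub>0\<^sup>5, x\<^sub>1\<^sup>5, x\<^sub>2\<^sup>5\<close> is the
  genericity condition on \<open>f0, f1, f2\<close>: it provides coordinates on the plane that are linear in the
  coefficients of a quintic.
\<close>

definition power_minor :: "form \<Rightarrow> form \<Rightarrow> form \<Rightarrow> complex" where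
  "power_minor f g h = (let p = pure_power 0; q = pure_power 1; r = pure_power 2 in
     f p * (g q * h r - g r * h q) + f q * (g r * h p - g p * h r) + f r * (g p * h q - g q * h p))"

lemma pure_power_exponents: "pure_power i \<in> exponents 5"
  by (simp add: pure_power_def exponents_def)

lemma pure_power_distinct: "pure_power i = pure_power j \<longleftrightarrow> i = j"
  by (auto simp: pure_power_def fun_eq_iff split: if_splits)

text \<open>
  The coefficient vector \<open>b\<close> is supported on the three pure powers, where its entries form a row of the
  inverse of the 3 by 3 coefficient matrix.
\<close>

lemma dual_forms:
  assumes "power_minor f0 f1 f2 \<noteq> 0"
  shows "\<exists>b. (\<Sum>e\<in>exponents 5. b e * f0 e) = 1 \<and> (\<Sum>e\<in>exponents 5. b e * f1 e) = 0 \<and>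
    (\<Sum>e\<in>exponents 5. b e * f2 e) = 0"
proof -
  define p q r where pqr: "p = pure_power 0" "q = pure_power 1" "r = pure_power 2"
  have d: "p \<noteq> q" "p \<noteq> r" "q \<noteq> r" by (simp_all add: pqr pure_power_distinct)
  let ?\<Delta> = "power_minor f0 f1 f2"
  define x y z where xyz: "x = (f1 q * f2 r - f1 r * f2 q) / ?\<Delta>"
    "y = (f1 r * f2 p - f1 p * f2 r) / ?\<Delta>" "z = (f1 p * f2 q - f1 q * f2 p) / ?\<Delta>"
  define b where "b e = (if e = p then x else if e = q then y else if e = r then z else 0)" for e
  have sum: "(\<Sum>e\<in>exponents 5. b e * f e) = x * f p + y * f q + z * f r" for f
  proof -
    have "(\<Sum>e\<in>exponents 5. b e * f e) = (\<Sum>e\<in>{p, q, r}. b e * f e)"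
      using pure_power_exponents finite_exponents
      by (intro sum.mono_neutral_right) (auto simp: b_def pqr)
    also have "\<dots> = x * f p + y * f q + z * f r" using d by (simp add: b_def)
    finally show ?thesis .
  qed
  have \<Delta>: "?\<Delta> = f0 p * (f1 q * f2 r - f1 r * f2 q) + f0 q * (f1 r * f2 p - f1 p * f2 r)
      + f0 r * (f1 p * f2 q - f1 q * f2 p)"
    by (simp add: power_minor_def Let_def pqr)
  have "x * f0 p + y * f0 q + z * f0 r = ?\<Delta> / ?\<Delta>"
    unfolding xyz by (subst (4) \<Delta>) (simp add: add_divide_distrib[symmetric] algebra_simps)
  moreover have "x * f1 p + y * f1 q + z * f1 r = 0" "x * f2 p + y * f2 q + z * f2 r = 0"
    unfolding xyz by (simp_all add: add_divide_distrib[symmetric] algebra_simps)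
  ultimately show ?thesis using sum assms by (intro exI[of _ b]) simp
qed

lemma power_minor_cyclic:
  "power_minor f1 f2 f0 = power_minor f0 f1 f2" "power_minor f2 f0 f1 = power_minor f0 f1 f2"
  by (simp_all add: power_minor_def Let_def algebra_simps)

lemma generic_power_minor:
  "generically form_triple_coords (quintics \<times> quintics \<times> quintics)
     (\<lambda>(f0, f1, f2). f0 \<in> quintics \<and> f1 \<in> quintics \<and> f2 \<in> quintics \<and> power_minor f0 f1 f2 \<noteq> 0)"
proof -
  let ?X = "quintics \<times> quintics \<times> quintics"
  let ?\<Delta> = "\<lambda>x :: form \<times> form \<times> form. power_minor (fst x) (fst (snd x)) (snd (snd x))"
  let ?Z = "{x \<in> ?X. ?\<Delta> x = 0}"
  have "(\<lambda>x :: form \<times> form \<times> form. fst x e) \<in> form_triple_coords"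
    "(\<lambda>x :: form \<times> form \<times> form. fst (snd x) e) \<in> form_triple_coords"
    "(\<lambda>x :: form \<times> form \<times> form. snd (snd x) e) \<in> form_triple_coords" for e
    by (auto simp: form_triple_coords_def case_prod_unfold)
  then have "?\<Delta> \<in> polynomial_functions form_triple_coords"
    unfolding power_minor_def Let_def by (intro pf_intros polynomial_functions.coord)
  then have "zariski_closed form_triple_coords ?X ?Z"
    unfolding zariski_closed_def by (intro exI[of _ "{?\<Delta>}"]) auto
  moreover have "?Z \<noteq> ?X"
  proof -
    define m :: "5 \<Rightarrow> form" where "m i e = of_bool (e = pure_power i)" for i e
    have "m i \<in> quintics" for i using pure_power_exponents by (auto simp: m_def forms_def)
    moreover have "power_minor (m 0) (m 1) (m 2) \<noteq> 0"
      by (simp add: power_minor_def m_def pure_power_distinct)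
    ultimately have "(m 0, m 1, m 2) \<in> ?X - ?Z" by simp
    then show ?thesis by blast
  qed
  ultimately show ?thesis
    unfolding generically_def by (intro exI[of _ "{?Z}"]) auto
qed

lemma generically_mono:
  "generically C X P \<Longrightarrow> (\<And>x. P x \<Longrightarrow> Q x) \<Longrightarrow> generically C X Q"
  unfolding generically_def by meson

lemma generically_UNIV: "(\<And>x. P x) \<Longrightarrow> generically C X P"
  unfolding generically_def by (intro exI[of _ "{}"]) simp

theorem proposition1p4:
  fixes d :: nat
  assumes "d \<ge> 1"
  shows
    "generically form_triple_coords (quintics \<times> quintics \<times> quintics) (\<lambda>(f0, f1, f2).
       generically {\<lambda>t. t i | i. i \<in> {1..5 * d + 1}} UNIV (\<lambda>t :: nat \<Rightarrow> complex.
         inj_on t {1..5 * d + 1} \<longrightarrow>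
         (\<forall>L \<Gamma>.
            open_in_plane f0 f1 f2 L \<longrightarrow> f0 \<in> L \<longrightarrow>
            irreducible_component MS_coords (incidence d L) \<Gamma> \<longrightarrow>
            snd ` \<Gamma> = L \<longrightarrow> (\<exists>c0. (c0, f0) \<in> \<Gamma>) \<longrightarrow>
            (omega_nonzero_on d f0 f1 f2 t (image_points d \<Gamma>) \<longleftrightarrow>
               phi_independent_mod d f0 f1 f2 t (image_ideal d (reduced_ideal d \<Gamma>))) \<and>
            (omega_nonzero_on d f0 f1 f2 t (image_points d \<Gamma>) \<longrightarrow>
               (\<forall>K \<in> {reduced_ideal d \<Gamma>, generic_ideal d f0 f1 f2 \<Gamma>}.
                  generically M_coords (image_points d \<Gamma>) (\<lambda>c.
                    vector_space.dim fscale
                      (zariski_tangent_space M_coords (M d) (image_ideal d K) c) =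
                    vector_space.dim tscale (M d) - (5 * d - 1)))))))"
proof (rule generically_mono[OF generic_power_minor], clarify, rule generically_UNIV, intro impI allI)
  fix f0 f1 f2 :: form and t :: "nat \<Rightarrow> complex" and L :: "form set" and \<Gamma> :: "(tuple \<times> form) set"
  assume f: "f0 \<in> quintics" "f1 \<in> quintics" "f2 \<in> quintics" and \<Delta>: "power_minor f0 f1 f2 \<noteq> 0"
    and L: "open_in_plane f0 f1 f2 L" "f0 \<in> L"
      "irreducible_component MS_coords (incidence d L) \<Gamma>" "snd ` \<Gamma> = L"
  obtain b0 where b0: "(\<Sum>e\<in>exponents 5. b0 e * f0 e) = 1" "(\<Sum>e\<in>exponents 5. b0 e * f1 e) = 0"
    "(\<Sum>e\<in>exponents 5. b0 e * f2 e) = 0" using dual_forms[OF \<Delta>] by blast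
  obtain b1 where b1: "(\<Sum>e\<in>exponents 5. b1 e * f1 e) = 1" "(\<Sum>e\<in>exponents 5. b1 e * f2 e) = 0"
    "(\<Sum>e\<in>exponents 5. b1 e * f0 e) = 0"
    using dual_forms[of f1 f2 f0] \<Delta> by (auto simp: power_minor_cyclic)
  obtain b2 where b2: "(\<Sum>e\<in>exponents 5. b2 e * f2 e) = 1" "(\<Sum>e\<in>exponents 5. b2 e * f0 e) = 0"
    "(\<Sum>e\<in>exponents 5. b2 e * f1 e) = 0"
    using dual_forms[of f2 f0 f1] \<Delta> by (auto simp: power_minor_cyclic)
  interpret quintic_component d f0 f1 f2 b0 b1 b2 t L \<Gamma>
    by unfold_locales (fact assms f b0 b1 b2 L)+
  show "(omega_nonzero_on d f0 f1 f2 t (image_points d \<Gamma>) \<longleftrightarrow>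
             phi_independent_mod d f0 f1 f2 t (image_ideal d (reduced_ideal d \<Gamma>))) \<and>
          (omega_nonzero_on d f0 f1 f2 t (image_points d \<Gamma>) \<longrightarrow>
             (\<forall>K \<in> {reduced_ideal d \<Gamma>, generic_ideal d f0 f1 f2 \<Gamma>}.
                generically M_coords (image_points d \<Gamma>) (\<lambda>c.
                  vector_space.dim fscale
                    (zariski_tangent_space M_coords (M d) (image_ideal d K) c) =
                  vector_space.dim tscale (M d) - (5 * d - 1))))"
    using omega_nonzero_imp_independent independent_imp_omega_nonzero
      generic_zariski_tangent_dimension by auto
qed

end
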